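(* Let $n\geq 1$, $m\geq 0$ be integers, let $f:[0,1]^{n+m}\to X$ be a Lipschitz map into a metric space $X$, and let $E\subset[0,1]^{n+m}$ be a measurable set. Then the following conditions are equivalent: (b') $\operatorname{rank}\operatorname{md}(f,x)\leq n-1$ for almost every $x\in E$. (c') $\Theta^{*n}(f,x)=0$ for almost every $x\in E$. (d') $\Theta^{n}_*(f,x)=0$ for almost every $x\in E$. (e') $\mathcal{H}^{n,m}_\infty(f,E)=0$. (f') $\hat{\mathcal{H}}^{n,m}_\infty(f,E)=0$.
   Context: "Measurable" and "almost every" refer to Lebesgue measure; points of the boundary of the cube are ignored. Metric derivative: a map $f$ from an open set $\Omega\subset\mathbb{R}^k$ to a metric space $(X,d)$ is metrically differentiable at $x\in\Omega$ if there is a seminorm $\operatorname{md}(f,x)(\cdot)$ on $\mathbb{R}^k$ with $$\lim_{y\to x}\frac{d(f(y),f(x))-\operatorname{md}(f,x)(y-x)}{|y-x|}=0 .$$ The seminorm is then unique; Lipschitz maps are metrically differentiable a.e. (Kirchheim). For a map defined on a closed cube this is applied in the interior. The rank of a seminorm $\sigma$ on $\mathbb{R}^k$ is $k-\dim\{v:\sigma(v)=0\}$. Hausdorff content: $\mathcal{H}^s_\infty(A)=\inf\sum_i\frac{\omega_s}{2^s}(\operatorname{diam}A_i)^s$, the infimum over all countable coverings $A\subset\bigcup_iA_i$ by sets of finite diameter; $\omega_s=\pi^{s/2}/\Gamma(\frac s2+1)$ (so $\omega_n$ is the volume of the unit ball of $\mathbb{R}^n$). Densities: for $x$ in the interior of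 the cube, $$\Theta^{*n}(f,x)=\limsup_{r\to0}\frac{\mathcal{H}^n_\infty(f(B(x,r)))}{\omega_nr^n},\qquad \Theta^{n}_*(f,x)=\liminf_{r\to0}\frac{\mathcal{H}^n_\infty(f(B(x,r)))}{\omega_nr^n}.$$ Mapping contents: with $Q_o=[0,1]^{n+m}$ and $E\subset Q_o$, $$\mathcal{H}^{n,m}_\infty(f,E)=\inf\sum_i\mathcal{H}^n_\infty(f(Q_i))(\operatorname{diam}Q_i)^m,$$ the infimum over all countable coverings $E\subset\bigcup_iQ_i\subset Q_o$ by closed dyadic cubes, and $$\hat{\mathcal{H}}^{n,m}_\infty(f,E)=\inf\sum_i\mathcal{H}^n_\infty(f(A_i))(\operatorname{diam}A_i)^m,$$ the infimum over all countable coverings $E\subset\bigcup_iA_i\subset Q_o$ by arbitrary sets. When $m=0$, the factor $(\operatorname{diam})^0$ is understood as $1$. *)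

theory Defs
  imports "HOL-Analysis.Analysis"
begin

definition is_seminorm :: "('a::real_vector \<Rightarrow> real) \<Rightarrow> bool" where
  "is_seminorm \<sigma> \<longleftrightarrow>
     (\<forall>v w. \<sigma> (v + w) \<le> \<sigma> v + \<sigma> w) \<and> (\<forall>c v. \<sigma> (c *\<^sub>R v) = \<bar>c\<bar> * \<sigma> v)"

definition seminorm_rank :: "('a::euclidean_space \<Rightarrow> real) \<Rightarrow> nat" where
  "seminorm_rank \<sigma> = DIM('a) - dim {v. \<sigma> v = 0}"

text \<open>The limit only sees \<open>f\<close> near \<open>x\<close>, so for a map given on a closed cube and extended
  arbitrarily outside of it, this is meaningful at interior points of the cube.\<close>

definition has_metric_derivative ::
    "('a::euclidean_space \<Rightarrow> 'b::metric_space) \<Rightarrow> ('a \<Rightarrow> real) \<Rightarrow> 'a \<Rightarrow> bool" where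
  "has_metric_derivative f \<sigma> x \<longleftrightarrow>
     is_seminorm \<sigma> \<and>
     ((\<lambda>y. (dist (f y) (f x) - \<sigma> (y - x)) / norm (y - x)) \<longlongrightarrow> 0) (at x)"

definition metrically_differentiable ::
    "('a::euclidean_space \<Rightarrow> 'b::metric_space) \<Rightarrow> 'a \<Rightarrow> bool" where
  "metrically_differentiable f x \<longleftrightarrow> (\<exists>\<sigma>. has_metric_derivative f \<sigma> x)"

definition md :: "('a::euclidean_space \<Rightarrow> 'b::metric_space) \<Rightarrow> 'a \<Rightarrow> 'a \<Rightarrow> real" where
  "md f x = (THE \<sigma>. has_metric_derivative f \<sigma> x)"

lemma has_metric_derivative_unique:
  assumes "has_metric_derivative f \<sigma> x" and "has_metric_derivative f \<tau> x"
  shows "\<sigma> = \<tau>"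
proof
  fix v
  have s: "\<sigma> (c *\<^sub>R w) = \<bar>c\<bar> * \<sigma> w" and t: "\<tau> (c *\<^sub>R w) = \<bar>c\<bar> * \<tau> w" for c w
    using assms by (auto simp: has_metric_derivative_def is_seminorm_def)
  show "\<sigma> v = \<tau> v"
  proof (cases "v = 0")
    case True
    then show ?thesis using s[of 0 v] t[of 0 v] by simp
  next
    case False
    have "((\<lambda>y. (dist (f y) (f x) - \<tau> (y - x)) / norm (y - x)
        - (dist (f y) (f x) - \<sigma> (y - x)) / norm (y - x)) \<longlongrightarrow> 0 - 0) (at x)"
      using assms by (intro tendsto_diff) (auto simp: has_metric_derivative_def)
    then have lim: "((\<lambda>y. (\<sigma> (y - x) - \<tau> (y - x)) / norm (y - x)) \<longlongrightarrow> 0) (at x)"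
      by (simp add: diff_divide_distrib)
    have "filterlim (\<lambda>r. x + r *\<^sub>R v) (at x) (at_right (0::real))"
      unfolding filterlim_at
    proof
      show "\<forall>\<^sub>F r in at_right (0::real). x + r *\<^sub>R v \<in> UNIV \<and> x + r *\<^sub>R v \<noteq> x"
        using False by (auto simp: eventually_at_filter)
      have "((\<lambda>r::real. x + r *\<^sub>R v) \<longlongrightarrow> x + 0 *\<^sub>R v) (at_right 0)"
        by (intro tendsto_intros)
      then show "((\<lambda>r::real. x + r *\<^sub>R v) \<longlongrightarrow> x) (at_right 0)" by simp
    qed
    from filterlim_compose[OF lim this]
    have "((\<lambda>r. (\<sigma> (r *\<^sub>R v) - \<tau> (r *\<^sub>R v)) / norm (r *\<^sub>R v)) \<longlongrightarrow> 0) (at_right (0::real))"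
      by simp
    moreover have "\<forall>\<^sub>F r in at_right (0::real).
        (\<sigma> (r *\<^sub>R v) - \<tau> (r *\<^sub>R v)) / norm (r *\<^sub>R v) = (\<sigma> v - \<tau> v) / norm v"
      using False by (auto simp: eventually_at_filter s t field_simps)
    ultimately have "((\<lambda>r::real. (\<sigma> v - \<tau> v) / norm v) \<longlongrightarrow> 0) (at_right 0)"
      by (rule Lim_transform_eventually)
    then have "(\<sigma> v - \<tau> v) / norm v = 0"
      by (simp add: tendsto_const_iff)
    then show ?thesis using False by simp
  qed
qed

text \<open>Only integer exponents are needed; the natural-number power satisfies \<open>0 ^ 0 = 1\<close>,
  which is the convention wanted below when \<open>m = 0\<close>.  Coverings are countable (possibly
  finite) sets of sets, and all contents take values in the extended nonnegative reals, where
  sums of arbitrary families exist.\<close>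

definition hausdorff_content :: "nat \<Rightarrow> 'a::metric_space set \<Rightarrow> ennreal" where
  "hausdorff_content n A =
     (INF \<C> \<in> {\<C>. countable \<C> \<and> A \<subseteq> \<Union>\<C> \<and> (\<forall>B\<in>\<C>. bounded B)}.
        \<Sum>\<^sub>\<infinity>B\<in>\<C>. ennreal (unit_ball_vol (real n) / 2 ^ n * diameter B ^ n))"

definition upper_density ::
    "nat \<Rightarrow> ('a::euclidean_space \<Rightarrow> 'b::metric_space) \<Rightarrow> 'a \<Rightarrow> ennreal" where
  "upper_density n f x =
     Limsup (at_right 0)
       (\<lambda>r. hausdorff_content n (f ` ball x r) / ennreal (unit_ball_vol (real n) * r ^ n))"

definition lower_density ::
    "nat \<Rightarrow> ('a::euclidean_space \<Rightarrow> 'b::metric_space) \<Rightarrow> 'a \<Rightarrow> ennreal" where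
  "lower_density n f x =
     Liminf (at_right 0)
       (\<lambda>r. hausdorff_content n (f ` ball x r) / ennreal (unit_ball_vol (real n) * r ^ n))"

abbreviation unit_cube :: "(real ^ 'k) set" where
  "unit_cube \<equiv> cbox 0 1"

text \<open>Dyadic cubes of side larger than \<open>1\<close> are left out, since none of them is contained in the
  unit cube.\<close>

definition dyadic_cube :: "(real ^ 'k) set \<Rightarrow> bool" where
  "dyadic_cube Q \<longleftrightarrow>
     (\<exists>(j::nat) (z :: int ^ 'k).
        Q = cbox (\<chi> i. of_int (z $ i) / 2 ^ j) (\<chi> i. (of_int (z $ i) + 1) / 2 ^ j))"

definition dyadic_mapping_content ::
    "nat \<Rightarrow> nat \<Rightarrow> (real ^ 'k \<Rightarrow> 'b::metric_space) \<Rightarrow> (real ^ 'k) set \<Rightarrow> ennreal" where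
  "dyadic_mapping_content n m f E =
     (INF \<Q> \<in> {\<Q>. countable \<Q> \<and> E \<subseteq> \<Union>\<Q> \<and> (\<forall>Q\<in>\<Q>. dyadic_cube Q \<and> Q \<subseteq> unit_cube)}.
        \<Sum>\<^sub>\<infinity>Q\<in>\<Q>. hausdorff_content n (f ` Q) * ennreal (diameter Q ^ m))"

definition mapping_content ::
    "nat \<Rightarrow> nat \<Rightarrow> (real ^ 'k \<Rightarrow> 'b::metric_space) \<Rightarrow> (real ^ 'k) set \<Rightarrow> ennreal" where
  "mapping_content n m f E =
     (INF \<A> \<in> {\<A>. countable \<A> \<and> E \<subseteq> \<Union>\<A> \<and> (\<forall>A\<in>\<A>. A \<subseteq> unit_cube)}.
        \<Sum>\<^sub>\<infinity>A\<in>\<A>. hausdorff_content n (f ` A) * ennreal (diameter A ^ m))"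

end

theory Submission
  imports Defs
begin

text \<open>The five conditions are linked in a cycle: rank condition, upper density, lower
density, dyadic content, content over arbitrary sets, and back to the rank condition. Passing
from the upper to the lower density, and from dyadic cubes to arbitrary sets, only compares a
\<open>limsup\<close> with a \<open>liminf\<close> and an infimum with one over more coverings.
For the steps that involve the metric derivative, \<open>f\<close> is extended to a Lipschitz
map \<open>g\<close> of the whole space by composing it with the nearest-point projection onto
the cube; this changes nothing near interior points.

Rank implies density. If the metric derivative \<open>\<sigma>\<close> at \<open>x\<close> has
rank at most \<open>n - 1\<close>, then \<open>\<sigma> v \<le> L * (\<Sum> \<bar>b \<bullet>
v\<bar>)\<close> for at most \<open>n - 1\<close> vectors \<open>b\<close> in the unit ball.
The metric derivative compares \<open>g\<close> only with the value at \<open>x\<close>,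
whereas a bound for \<open>g ` ball x r\<close> needs to compare \<open>g\<close> at pairs of
points of the ball. This gap is closed by decomposing the space into countably many closed sets
on which the estimate holds at a uniform scale: such a set is not porous at almost all of its
points, so each point of a small ball around \<open>x\<close> has a point of the set much
closer than \<open>r\<close>. Cutting the ball into slabs orthogonal to the vectors
\<open>b\<close> then gives about \<open>e powr (1 - n)\<close> pieces whose images have
diameter of order \<open>e * r\<close>, hence content of order \<open>e * r ^ n\<close>
(\<open>AE_upper_density_zero_of_rank\<close>).

Density implies content. Around a point of vanishing lower density there are dyadic cubes
\<open>Q\<close> with \<open>hausdorff_content n (f ` Q) \<le> e * diameter Q ^ n\<close>. The
maximal ones do not overlap, so their volumes have sum at most one and the corresponding
covering has total at most a constant times \<open>e\<close>; null sets are covered by cubes of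
small total volume (\<open>dyadic_mapping_content_zero_of_lower_density\<close>).

Content implies rank. If \<open>\<sigma>\<close> has rank at least \<open>n\<close>, then
\<open>\<kappa> * norm v - (\<Sum> \<bar>c \<bullet> v\<bar>) \<le> \<sigma> v\<close> for at
most \<open>m\<close> vectors \<open>c\<close> in the unit ball. On a set \<open>F\<close>
where \<open>f\<close> satisfies this estimate at a uniform scale, the part of \<open>F\<close>
inside \<open>A\<close> and above a set \<open>B\<close> of diameter \<open>s\<close> is cut by
slabs of width \<open>s\<close> orthogonal to the vectors \<open>c\<close> into about
\<open>(diameter A / s) ^ m\<close> pieces of diameter of order \<open>s\<close>. Its outer
measure is thus at most a constant times \<open>s ^ n * diameter A ^ m\<close>, which bounds
the outer measure of \<open>F\<close> by the mapping content
(\<open>negligible_of_mapping_content_zero\<close>). Counting slabs takes the place here of an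
integration over the \<open>n\<close>-dimensional fibres of \<open>F\<close>.

The last step also needs that \<open>g\<close> is metrically differentiable almost everywhere,
which is Kirchheim's theorem (\<open>AE_metrically_differentiable\<close>). Along a line the
metric speed exists almost everywhere by a continuous induction argument and Lebesgue's density
theorem; Fubini's theorem along lines carries this to every fixed direction; and non-porosity
again allows the derivative to be compared at nearby base points, which yields the triangle
inequality for the directional speeds.\<close>

section \<open>Line slices and density points\<close>

text \<open>Integrating \<open>indicator {0..1} t * indicator P (x + t *\<^sub>R v)\<close>
first over \<open>x\<close> gives the measure of \<open>P\<close> by translation invariance,
and integrating first over \<open>t\<close> gives zero. This form of Fubini's theorem serves an
arbitrary direction \<open>v\<close> without a change of coordinates.\<close>
lemma null_set_of_null_line_slices:
  fixes P :: "'a::euclidean_space set"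
  assumes P[measurable]: "P \<in> sets borel"
    and slice: "\<And>x. {t. x + t *\<^sub>R v \<in> P} \<in> null_sets lborel"
  shows "P \<in> null_sets lborel"
proof -
  define h :: "real \<Rightarrow> 'a \<Rightarrow> ennreal" where "h t x = indicator {0..1} t * indicator P (x + t *\<^sub>R v)" for t x
  have [measurable]: "case_prod h \<in> borel_measurable (lborel \<Otimes>\<^sub>M lborel)"
    unfolding h_def by measurable
  have "(\<integral>\<^sup>+x. h t x \<partial>lborel) = indicator {0..1} t * emeasure lborel P" for t
  proof -
    have "emeasure lborel P = emeasure (distr lborel borel ((+) (t *\<^sub>R v))) P"
      by (simp add: lborel_distr_plus)
    also have "\<dots> = (\<integral>\<^sup>+x. indicator P x \<partial>distr lborel borel ((+) (t *\<^sub>R v)))"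
      by (subst nn_integral_indicator) auto
    also have "\<dots> = (\<integral>\<^sup>+x. indicator P (x + t *\<^sub>R v) \<partial>lborel)"
      by (subst nn_integral_distr) (auto simp: add.commute)
    finally show ?thesis
      unfolding h_def by (subst nn_integral_cmult) auto
  qed
  then have "(\<integral>\<^sup>+t. (\<integral>\<^sup>+x. h t x \<partial>lborel) \<partial>lborel) = emeasure lborel P"
    by (simp add: nn_integral_multc)
  moreover have "(\<integral>\<^sup>+t. (\<integral>\<^sup>+x. h t x \<partial>lborel) \<partial>lborel) = (\<integral>\<^sup>+x. (\<integral>\<^sup>+t. h t x \<partial>lborel) \<partial>lborel)"
    by (rule lborel_pair.Fubini') simp
  moreover have "(\<integral>\<^sup>+t. h t x \<partial>lborel) = 0" for x
  proof -
    have "AE t in lborel. t \<notin> {t. x + t *\<^sub>R v \<in> P}"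
      by (rule AE_not_in[OF slice])
    then have "AE t in lborel. h t x = 0"
      by eventually_elim (auto simp: h_def)
    from nn_integral_cong_AE[OF this] show ?thesis by simp
  qed
  ultimately have "emeasure lborel P = 0" by simp
  then show ?thesis using P by (auto simp: null_sets_def)
qed

text \<open>This is Lebesgue's differentiation theorem for the indicator function of the
complement of \<open>P\<close>, in the one-sided form that suits right-hand speeds.\<close>
lemma AE_right_density_point:
  fixes P :: "real set"
  assumes P: "P \<in> sets borel"
  shows "AE t in lebesgue. t \<in> P \<longrightarrow>
           (\<forall>e>0. \<exists>d>0. \<forall>h. 0 < h \<and> h < d \<longrightarrow> measure lebesgue ({t..t + h} - P) \<le> e * h)"
proof -
  have L: "{a..b} - P \<in> lmeasurable" for a b
    using P by (intro fmeasurable_Diff) auto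
  have eq: "((\<lambda>x. indicat_real (-P) x) has_integral measure lebesgue ({a..b} - P)) {a..b}" for a b
  proof -
    have "((\<lambda>x. if x \<in> {a..b} then indicat_real (-P) x else 0) has_integral measure lebesgue ({a..b} - P)) UNIV"
      using L[of a b] unfolding lmeasurable_iff_has_integral
      by (rule has_integral_eq_rhs[OF has_integral_eq, rotated]) (auto simp: indicator_def)
    then show ?thesis by (simp only: has_integral_restrict_UNIV)
  qed
  obtain N where N: "negligible N"
    "\<And>x e. \<lbrakk>x \<notin> N; 0 < e\<rbrakk> \<Longrightarrow> \<exists>d>0. \<forall>h. 0 < h \<and> h < d \<longrightarrow>
        norm (integral (cbox x (x + h *\<^sub>R One)) (indicat_real (-P)) /\<^sub>R h ^ DIM(real) - indicat_real (-P) x) < e"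
    using integrable_ccontinuous_explicit[of "indicat_real (-P)"] eq by (metis cbox_interval has_integral_integrable)
  have "\<exists>d>0. \<forall>h. 0 < h \<and> h < d \<longrightarrow> measure lebesgue ({t..t + h} - P) \<le> e * h"
    if t: "t \<notin> N" "t \<in> P" "e > 0" for t e
  proof -
    obtain d where d: "d > 0" "\<And>h. 0 < h \<and> h < d \<Longrightarrow>
        norm (integral (cbox t (t + h *\<^sub>R One)) (indicat_real (-P)) /\<^sub>R h ^ DIM(real) - indicat_real (-P) t) < e"
      using N(2)[OF t(1,3)] by blast
    have "measure lebesgue ({t..t + h} - P) \<le> e * h" if h: "0 < h" "h < d" for h
    proof -
      have "integral (cbox t (t + h *\<^sub>R One)) (indicat_real (-P)) = measure lebesgue ({t..t + h} - P)"
        using eq[of t "t + h"] by (simp add: integral_unique)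
      then have "measure lebesgue ({t..t + h} - P) / h < e"
        using d(2)[of h] h \<open>t \<in> P\<close> by (simp add: divide_inverse mult.commute)
      then show ?thesis using h by (simp add: field_simps)
    qed
    then show ?thesis using d(1) by blast
  qed
  then show ?thesis
    unfolding eventually_ae_filter_negligible using N(1) by blast
qed

section \<open>Metric speed along lines\<close>

text \<open>Continuous induction. The set of \<open>s\<close> for which the estimate holds on
\<open>[p, s]\<close> is closed; from a point outside \<open>U\<close> one can move right by
some \<open>h\<close> at speed \<open>a\<close>, and from a point of the open set
\<open>U\<close> by some \<open>h\<close> at the Lipschitz speed, which the measure of
\<open>U\<close> pays for. Hence its supremum is \<open>q\<close>.\<close>
lemma dist_curve_le:
  fixes \<gamma> :: "real \<Rightarrow> 'b::metric_space"
  assumes lip: "L-lipschitz_on UNIV \<gamma>" and a: "a \<ge> 0" and U: "open U" and "p \<le> q"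
    and tags: "\<And>t k. t \<in> {p..q} \<Longrightarrow> t \<notin> U \<Longrightarrow> k > 0 \<Longrightarrow> \<exists>h. 0 < h \<and> h < k \<and> dist (\<gamma> (t + h)) (\<gamma> t) \<le> a * h"
  shows "dist (\<gamma> p) (\<gamma> q) \<le> a * (q - p) + L * measure lebesgue (U \<inter> {p..q})"
proof -
  define m where "m s = measure lebesgue (U \<inter> {p..s})" for s
  have L0: "L \<ge> 0" using lip by (rule lipschitz_on_nonneg)
  have lipD: "dist (\<gamma> x) (\<gamma> y) \<le> L * \<bar>x - y\<bar>" for x y
    using lipschitz_onD[OF lip, of x y] by (simp add: dist_real_def)
  have fm: "U \<inter> {p..s} \<in> lmeasurable" for s
    using U by (metis borel_open bounded_Int bounded_closed_interval bounded_set_imp_lmeasurable closed_atLeastAtMost borel_closed sets.Int sets_completionI_sets sets_lborel)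
  have mono: "m s \<le> m t" if "s \<le> t" for s t
    unfolding m_def by (rule measure_mono_fmeasurable) (use that fm in auto)
  have jump: "m s + h \<le> m (s + h)" if "h > 0" "{s..s + h} \<subseteq> U" "p \<le> s" for s h
  proof -
    have Ioc: "{s<..s + h} \<in> lmeasurable"
      by (rule bounded_set_imp_lmeasurable) (auto intro: bounded_subset[OF bounded_closed_interval[of s "s + h"]])
    have "m s + h = measure lebesgue (U \<inter> {p..s}) + measure lebesgue {s<..s+h}"
      using that by (simp add: m_def)
    also have "\<dots> = measure lebesgue ((U \<inter> {p..s}) \<union> {s<..s+h})"
      using fm Ioc by (intro measure_Un_AE[symmetric]) auto
    also have "\<dots> \<le> m (s + h)"
      unfolding m_def by (rule measure_mono_fmeasurable) (use that fm in \<open>auto intro!: sets.Un fmeasurableD Ioc\<close>)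
    finally show ?thesis .
  qed
  define S where "S = {s \<in> {p..q}. dist (\<gamma> p) (\<gamma> s) \<le> a * (s - p) + L * m s}"
  define s where "s = Sup S"
  have pS: "p \<in> S" using \<open>p \<le> q\<close> L0 by (auto simp: S_def m_def)
  have bdd: "bdd_above S" by (auto simp: S_def)
  have sI: "p \<le> s" "s \<le> q"
    unfolding s_def using pS bdd by (auto intro: cSup_upper) (rule cSup_least, auto simp: S_def)
  have sS: "s \<in> S"
  proof -
    have "dist (\<gamma> p) (\<gamma> s) \<le> a * (s - p) + L * m s + e" if "e > 0" for e
    proof -
      define \<eta> where "\<eta> = e / (L + 1)"
      have "\<eta> > 0" using that L0 by (simp add: \<eta>_def)
      then obtain t where t: "t \<in> S" "t > s - \<eta>"
        unfolding s_def using less_cSupD[of S "Sup S - \<eta>"] pS by (smt (verit, ccfv_SIG) empty_iff)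
      have ts: "t \<le> s" unfolding s_def using t bdd by (simp add: cSup_upper)
      have "dist (\<gamma> p) (\<gamma> s) \<le> dist (\<gamma> p) (\<gamma> t) + dist (\<gamma> t) (\<gamma> s)" by (rule dist_triangle)
      also have "\<dots> \<le> (a * (t - p) + L * m t) + L * \<eta>"
        using t ts lipD[of t s] L0 mult_left_mono[of "\<bar>t - s\<bar>" \<eta> L] by (auto simp: S_def)
      also have "\<dots> \<le> a * (s - p) + L * m s + e"
      proof -
        have "L * \<eta> \<le> e" using L0 that by (simp add: \<eta>_def field_simps)
        moreover have "a * (t - p) \<le> a * (s - p)" using ts a by (simp add: mult_left_mono)
        moreover have "L * m t \<le> L * m s" using mono[OF ts] L0 by (simp add: mult_left_mono)
        ultimately show ?thesis by linarith
      qed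
      finally show ?thesis .
    qed
    then have "dist (\<gamma> p) (\<gamma> s) \<le> a * (s - p) + L * m s" by (rule field_le_epsilon)
    then show ?thesis using sI by (simp add: S_def)
  qed
  have "s = q"
  proof (rule ccontr)
    assume "s \<noteq> q"
    then have sq: "s < q" using sI by simp
    have ds: "dist (\<gamma> p) (\<gamma> s) \<le> a * (s - p) + L * m s" using sS by (simp add: S_def)
    have "\<exists>h>0. s + h \<in> S"
    proof (cases "s \<in> U")
      case True
      then obtain r where r: "r > 0" "cball s r \<subseteq> U" using U open_contains_cball by blast
      define h where "h = min r (q - s)"
      have h: "h > 0" "s + h \<le> q" "h \<le> r" using r sq by (auto simp: h_def)
      have "{s..s + h} \<subseteq> U" using r h by (auto simp: subset_iff dist_real_def)
      from jump[OF h(1) this sI(1)] have "L * m s + L * h \<le> L * m (s + h)"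
        using L0 by (metis distrib_left mult_left_mono)
      moreover have "dist (\<gamma> p) (\<gamma> (s + h)) \<le> dist (\<gamma> p) (\<gamma> s) + L * h"
        using dist_triangle[of "\<gamma> p" "\<gamma> (s + h)" "\<gamma> s"] lipD[of s "s + h"] h by simp
      moreover have "a * (s - p) \<le> a * (s + h - p)" using a h by (intro mult_left_mono) auto
      ultimately have "s + h \<in> S" using ds h sI by (auto simp: S_def)
      then show ?thesis using h by blast
    next
      case False
      then obtain h where h: "0 < h" "h < q - s" "dist (\<gamma> (s + h)) (\<gamma> s) \<le> a * h"
        using tags[of s "q - s"] sI sq by auto
      have "L * m s \<le> L * m (s + h)" using mono[of s "s + h"] h L0 by (simp add: mult_left_mono)
      moreover have "dist (\<gamma> p) (\<gamma> (s + h)) \<le> dist (\<gamma> p) (\<gamma> s) + a * h"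
        using dist_triangle[of "\<gamma> p" "\<gamma> (s + h)" "\<gamma> s"] h by (simp add: dist_commute)
      ultimately have "s + h \<in> S" using ds h sI by (auto simp: S_def algebra_simps)
      then show ?thesis using h by blast
    qed
    then show False using bdd unfolding s_def by (meson cSup_upper less_add_same_cancel1 not_le)
  qed
  then show ?thesis using sS by (simp add: S_def m_def)
qed

text \<open>A small \<open>liminf\<close> of the right-hand speed forces a small
\<open>limsup\<close>: at a density point of \<open>P\<close> the complement of
\<open>P\<close> occupies a vanishing proportion of \<open>[t, t + h]\<close>, and
\<open>P\<close> consists of points from which arbitrarily short steps at speed below
\<open>a\<close> are possible.\<close>
lemma AE_curve_speed_le:
  fixes \<gamma> :: "real \<Rightarrow> 'b::metric_space"
  assumes lip: "L-lipschitz_on UNIV \<gamma>" and a: "a \<ge> 0"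
    and P: "P = {t. \<forall>k>0. \<exists>h. 0 < h \<and> h < k \<and> dist (\<gamma> (t + h)) (\<gamma> t) < a * h}"
    and Pb: "P \<in> sets borel"
  shows "AE t in lebesgue. t \<in> P \<longrightarrow>
          (\<forall>e>0. \<exists>d>0. \<forall>h. 0 < h \<and> h < d \<longrightarrow> dist (\<gamma> (t + h)) (\<gamma> t) \<le> (a + e) * h)"
  using AE_right_density_point[OF Pb]
proof eventually_elim
  case (elim t)
  have L0: "L \<ge> 0" using lip by (rule lipschitz_on_nonneg)
  show ?case
  proof (intro impI allI)
    fix e :: real assume tP: "t \<in> P" and "e > 0"
    define \<eta> where "\<eta> = e / (2 * (L + 1))"
    have \<eta>: "\<eta> > 0" "L * (2 * \<eta>) \<le> e" using \<open>e > 0\<close> L0 by (auto simp: \<eta>_def field_simps)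
    obtain d where d: "d > 0" "\<And>h. 0 < h \<and> h < d \<Longrightarrow> measure lebesgue ({t..t + h} - P) \<le> \<eta> * h"
      using elim tP \<eta> by blast
    have "dist (\<gamma> (t + h)) (\<gamma> t) \<le> (a + e) * h" if h: "0 < h" "h < d" for h
    proof -
      let ?S = "{t..t + h} - P"
      have Sm: "?S \<in> lmeasurable" using Pb by (intro fmeasurable_Diff) auto
      obtain U where U: "open U" "?S \<subseteq> U" "U - ?S \<in> lmeasurable" "emeasure lebesgue (U - ?S) < ennreal (\<eta> * h)"
        using sets_lebesgue_outer_open[of ?S "\<eta> * h"] Sm \<eta> h by (auto simp: fmeasurableD)
      have "measure lebesgue (U - ?S) \<le> \<eta> * h"
        using U(3,4) \<eta> h by (simp add: emeasure_eq_measure2 ennreal_less_iff)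
      have "measure lebesgue (U \<inter> {t..t+h}) \<le> measure lebesgue (?S \<union> (U - ?S))"
        by (rule measure_mono_fmeasurable)
          (use U(1) fmeasurable.Un[OF Sm U(3)] in \<open>auto intro!: sets.Int simp: borel_open\<close>)
      also have "\<dots> \<le> measure lebesgue ?S + measure lebesgue (U - ?S)"
        by (rule measure_Un_le) (use Sm U in \<open>auto simp: fmeasurableD\<close>)
      also have "\<dots> \<le> 2 * \<eta> * h"
        using d(2)[of h] h \<open>measure lebesgue (U - ?S) \<le> \<eta> * h\<close> by simp
      finally have mU: "measure lebesgue (U \<inter> {t..t+h}) \<le> 2 * \<eta> * h" .
      have "dist (\<gamma> t) (\<gamma> (t + h)) \<le> a * (t + h - t) + L * measure lebesgue (U \<inter> {t..t+h})"
        by (rule dist_curve_le[OF lip a U(1)]) (use U(2) h P in \<open>auto simp: less_imp_le subset_iff\<close>, meson less_imp_le)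
      also have "\<dots> \<le> a * h + L * (2 * \<eta> * h)"
        using mU L0 by (simp add: mult_left_mono)
      also have "\<dots> \<le> (a + e) * h"
      proof -
        have "L * (2 * \<eta>) * h \<le> e * h" using \<eta> h by (intro mult_right_mono) auto
        then show ?thesis by (simp add: algebra_simps)
      qed
      finally show ?thesis by (simp add: dist_commute)
    qed
    then show "\<exists>d>0. \<forall>h. 0 < h \<and> h < d \<longrightarrow> dist (\<gamma> (t + h)) (\<gamma> t) \<le> (a + e) * h"
      using d(1) by blast
  qed
qed

text \<open>Such a set is a countable intersection of open sets: the union over
\<open>h\<close> may be uncountable, and \<open>k\<close> only needs to run through the numbers
\<open>1 / (n + 1)\<close>.\<close>
lemma borel_frequently_small:
  fixes Q :: "real \<Rightarrow> 'a::topological_space \<Rightarrow> bool"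
  assumes "\<And>h. open {x. Q h x}"
  shows "{x. \<forall>k>0. \<exists>h. 0 < h \<and> h < k \<and> Q h x} \<in> sets borel"
proof -
  have "{x. \<forall>k>0. \<exists>h. 0 < h \<and> h < k \<and> Q h x}
      = (\<Inter>n::nat. \<Union>h\<in>{0<..<inverse (Suc n)}. {x. Q h x})"
    apply (auto)
    subgoal for x n
      apply (drule spec[of _ "inverse (1 + real n)"]) by auto
    subgoal for x k
      using reals_Archimedean[of k] by (metis (no_types) greaterThanLessThan_iff of_nat_Suc order.strict_trans)
    done
  moreover have "\<dots> \<in> sets borel"
    using assms by (intro sets.countable_INT borel_open) (auto intro!: borel_open open_UN)
  ultimately show ?thesis by simp
qed

text \<open>If the limit does not exist, there are rationals \<open>a < b\<close> such that the
difference quotient is below \<open>a\<close> and also above \<open>b\<close> for arbitrarily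
small \<open>h\<close>. For each such pair these points form a Borel set whose intersection
with every line in direction \<open>v\<close> is null.\<close>
lemma AE_directional_metric_derivative:
  fixes g :: "'a::euclidean_space \<Rightarrow> 'b::metric_space"
  assumes lip: "L-lipschitz_on UNIV g"
  shows "AE x in lebesgue. \<exists>s. ((\<lambda>h. dist (g (x + h *\<^sub>R v)) (g x) / h) \<longlongrightarrow> s) (at_right 0)"
proof -
  define lo where "lo a = {x. \<forall>k>0. \<exists>h. 0 < h \<and> h < k \<and> dist (g (x + h *\<^sub>R v)) (g x) < a * h}" for a
  define hi where "hi b = {x. \<forall>k>0. \<exists>h. 0 < h \<and> h < k \<and> dist (g (x + h *\<^sub>R v)) (g x) > b * h}" for b
  have cont: "continuous_on UNIV g" using lip by (rule lipschitz_on_continuous_on)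
  have c1[continuous_intros]: "continuous_on UNIV (\<lambda>x. g (x + w))" for w
    by (rule continuous_on_compose2[OF cont, of UNIV "\<lambda>x. x + w"]) (auto intro: continuous_on_add continuous_on_id continuous_on_const)
  have lo[measurable]: "lo a \<in> sets borel" for a
    unfolding lo_def
    by (rule borel_frequently_small) (intro open_Collect_less continuous_intros cont)
  have hi[measurable]: "hi a \<in> sets borel" for a
    unfolding hi_def
    by (rule borel_frequently_small) (intro open_Collect_less continuous_intros cont)
  have null: "lo a \<inter> hi b \<in> null_sets lborel" if "a < b" for a b
  proof (rule null_set_of_null_line_slices[where v = v])
    fix x
    define \<gamma> where "\<gamma> t = g (x + t *\<^sub>R v)" for t
    have shift: "g (x + t *\<^sub>R v + h *\<^sub>R v) = \<gamma> (t + h)" for t h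
      by (simp add: \<gamma>_def algebra_simps)
    define P where "P = {t. \<forall>k>0. \<exists>h. 0 < h \<and> h < k \<and> dist (\<gamma> (t + h)) (\<gamma> t) < a * h}"
    have loP: "{t. x + t *\<^sub>R v \<in> lo a} = P"
      by (simp add: lo_def P_def shift, simp add: \<gamma>_def)
    have [measurable]: "(\<lambda>t. x + t *\<^sub>R v) \<in> borel_measurable borel" by measurable
    have Pb: "P \<in> sets borel"
      unfolding loP[symmetric] by measurable
    have sb: "{t. x + t *\<^sub>R v \<in> lo a \<inter> hi b} \<in> sets lborel" by measurable
    show "{t. x + t *\<^sub>R v \<in> lo a \<inter> hi b} \<in> null_sets lborel"
    proof (cases "a \<ge> 0")
      case False
      have "a * h < 0" if "h > 0" for h using False that by (simp add: mult_neg_pos)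
      then have "\<not> dist p q < a * h" if "h > 0" for h and p q :: 'b
        using that by (smt (verit) zero_le_dist)
      then have "lo a = {}" by (force simp: lo_def intro: exI[of _ 1])
      then show ?thesis by simp
    next
      case True
      have lg: "(L * norm v)-lipschitz_on UNIV \<gamma>"
      proof (rule lipschitz_onI)
        fix s t :: real
        have "dist (\<gamma> s) (\<gamma> t) \<le> L * dist (x + s *\<^sub>R v) (x + t *\<^sub>R v)"
          unfolding \<gamma>_def by (rule lipschitz_onD[OF lip]) auto
        also have "dist (x + s *\<^sub>R v) (x + t *\<^sub>R v) = norm v * dist s t"
          by (simp add: dist_norm dist_real_def flip: scaleR_diff_left)
        finally show "dist (\<gamma> s) (\<gamma> t) \<le> L * norm v * dist s t" by (simp add: mult.assoc)
      qed (use lipschitz_on_nonneg[OF lip] in auto)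
      have "AE t in lebesgue. t \<notin> {t. x + t *\<^sub>R v \<in> lo a \<inter> hi b}"
        using AE_curve_speed_le[OF lg True P_def Pb]
      proof eventually_elim
        case (elim t)
        show ?case
        proof
          assume "t \<in> {t. x + t *\<^sub>R v \<in> lo a \<inter> hi b}"
          then have t: "t \<in> P" "x + t *\<^sub>R v \<in> hi b" using loP by auto
          then obtain d where d: "d > 0" "\<forall>h. 0 < h \<and> h < d \<longrightarrow> dist (\<gamma> (t + h)) (\<gamma> t) \<le> (a + (b - a)) * h"
            using elim \<open>a < b\<close> by (metis diff_gt_0_iff_gt)
          then obtain h where "0 < h" "h < d" "dist (\<gamma> (t + h)) (\<gamma> t) > b * h"
            using t(2) by (auto simp: hi_def shift) (auto simp: \<gamma>_def)
          then show False using d by force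
        qed
      qed
      then have "{t. x + t *\<^sub>R v \<in> lo a \<inter> hi b} \<in> null_sets lebesgue"
        using sb by (subst AE_iff_null_sets) auto
      then show ?thesis using sb by (simp add: null_sets_completion_iff)
    qed
  qed measurable
  have "AE x in lborel. \<forall>a\<in>\<rat>. \<forall>b\<in>\<rat>. a < b \<longrightarrow> x \<notin> lo a \<inter> hi b"
  proof (intro AE_ball_countable[THEN iffD2, rule_format] countable_rat)
    fix a b :: real
    show "AE x in lborel. a < b \<longrightarrow> x \<notin> lo a \<inter> hi b"
      using AE_not_in[OF null, of a b] by (cases "a < b") auto
  qed
  then have "AE x in lebesgue. \<forall>a\<in>\<rat>. \<forall>b\<in>\<rat>. a < b \<longrightarrow> x \<notin> lo a \<inter> hi b"
    by (rule AE_completion)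
  then show ?thesis
  proof eventually_elim
    case (elim x)
    define q where "q h = dist (g (x + h *\<^sub>R v)) (g x) / h" for h
    define F where "F = at_right (0::real)"
    have nF: "F \<noteq> bot" by (simp add: F_def)
    have bnd: "\<forall>\<^sub>F h in F. 0 \<le> q h \<and> q h \<le> L * norm v"
      unfolding F_def eventually_at_right_field
    proof (intro exI[of _ 1] conjI allI impI)
      fix h :: real assume h: "0 < h"
      show "0 \<le> q h" using h by (simp add: q_def)
      have "dist (g (x + h *\<^sub>R v)) (g x) \<le> L * (h * norm v)"
        using lipschitz_onD[OF lip, of "x + h *\<^sub>R v" x] h by (simp add: dist_norm)
      then show "q h \<le> L * norm v" using h by (simp add: q_def field_simps)
    qed simp
    define l u where "l = Liminf F (\<lambda>h. ereal (q h))" and "u = Limsup F (\<lambda>h. ereal (q h))"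
    have l0: "0 \<le> l" unfolding l_def
      by (rule Liminf_bounded) (use bnd in \<open>auto elim: eventually_mono\<close>)
    have u1: "u \<le> ereal (L * norm v)" unfolding u_def
      by (rule Limsup_bounded) (use bnd in \<open>auto elim: eventually_mono\<close>)
    have lu: "l \<le> u" unfolding l_def u_def by (rule Liminf_le_Limsup[OF nF])
    have "\<not> l < u"
    proof
      assume "l < u"
      moreover have "l \<noteq> \<infinity>" "l \<noteq> -\<infinity>" "u \<noteq> \<infinity>" "u \<noteq> -\<infinity>" using l0 u1 lu by auto
      ultimately obtain l' u' where lu': "l = ereal l'" "u = ereal u'" "l' < u'"
        by (metis ereal_less(2) ereal_cases less_ereal.simps(1))
      obtain a where a: "a \<in> \<rat>" "l' < a" "a < u'" using Rats_dense_in_real[OF lu'(3)] by blast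
      obtain b where b: "b \<in> \<rat>" "a < b" "b < u'" using Rats_dense_in_real[OF a(3)] by blast
      have "\<exists>\<^sub>F h in F. ereal (q h) < ereal a"
      proof (rule ccontr)
        assume "\<not> ?thesis"
        then have "\<forall>\<^sub>F h in F. ereal a \<le> ereal (q h)" by (simp add: frequently_def not_less)
        then have "ereal a \<le> l" unfolding l_def by (rule Liminf_bounded)
        then show False using a lu' by simp
      qed
      then have "x \<in> lo a"
        unfolding lo_def q_def F_def frequently_def eventually_at_right_field
        by (simp add: field_simps)
      moreover have "\<exists>\<^sub>F h in F. ereal b < ereal (q h)"
      proof (rule ccontr)
        assume "\<not> ?thesis"
        then have "\<forall>\<^sub>F h in F. ereal (q h) \<le> ereal b" by (simp add: frequently_def not_less)
        then have "u \<le> ereal b" unfolding u_def by (rule Limsup_bounded)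
        then show False using b lu' by simp
      qed
      then have "x \<in> hi b"
        unfolding hi_def q_def F_def frequently_def eventually_at_right_field
        by (simp add: field_simps)
      ultimately show False using elim a b by blast
    qed
    then have "l = u" using lu by simp
    moreover obtain s where "l = ereal s" using l0 u1 lu by (cases l) auto
    ultimately have "((\<lambda>h. ereal (q h)) \<longlongrightarrow> ereal s) F"
      using tendsto_iff_Liminf_eq_Limsup[OF nF] l_def u_def by auto
    then show ?case by (auto simp: q_def F_def)
  qed
qed

section \<open>Non-porosity of closed sets\<close>

text \<open>A hole of \<open>F\<close> of radius \<open>e * h\<close> around \<open>x + h
*\<^sub>R u\<close> removes a fixed proportion of the segment from \<open>x\<close> to \<open>x
+ h *\<^sub>R u\<close>, so \<open>x\<close> is not a density point of the intersection of
\<open>F\<close> with the line.\<close>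
lemma AE_not_porous_in_direction:
  fixes F :: "'a::euclidean_space set"
  assumes F: "closed F"
  shows "AE x in lebesgue. x \<in> F \<longrightarrow>
           (\<forall>e>0. \<exists>d>0. \<forall>h. 0 < h \<and> h < d \<longrightarrow> infdist (x + h *\<^sub>R u) F \<le> e * h)"
proof -
  define bad where "bad e = F \<inter> {x. \<forall>k>0. \<exists>h. 0 < h \<and> h < k \<and> infdist (x + h *\<^sub>R u) F > e * h}" for e
  have bad[measurable]: "bad e \<in> sets borel" for e
    unfolding bad_def
    by (intro sets.Int borel_closed F borel_frequently_small open_Collect_less continuous_intros)
  have null: "bad e \<in> null_sets lborel" if "e > 0" for e
  proof (rule null_set_of_null_line_slices[where v = u])
    fix y
    define G where "G = {t. y + t *\<^sub>R u \<in> F}"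
    have "closed G"
      unfolding G_def using continuous_closed_vimage[OF F, of "\<lambda>t. y + t *\<^sub>R u"]
      by (auto simp: vimage_def intro!: continuous_intros)
    then have Gb: "G \<in> sets borel" by simp
    have [measurable]: "(\<lambda>t. y + t *\<^sub>R u) \<in> borel_measurable borel" by measurable
    have sb: "{t. y + t *\<^sub>R u \<in> bad e} \<in> sets lborel" by measurable
    have "AE t in lebesgue. t \<notin> {t. y + t *\<^sub>R u \<in> bad e}"
      using AE_right_density_point[OF Gb]
    proof eventually_elim
      case (elim t)
      show ?case
      proof
        assume t: "t \<in> {t. y + t *\<^sub>R u \<in> bad e}"
        then have "t \<in> G" by (auto simp: G_def bad_def)
        \<comment> \<open>the part of length \<open>\<rho> * h\<close> at the right end of \<open>[t, t + h]\<close> lies in the hole\<close>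
        define \<rho> where "\<rho> = min 1 (e / (norm u + 1))"
        have \<rho>: "\<rho> > 0" "\<rho> \<le> 1" using \<open>e > 0\<close> by (auto simp: \<rho>_def add_nonneg_pos)
        have \<rho>u: "\<rho> * norm u \<le> e"
        proof -
          have "\<rho> * norm u \<le> e / (norm u + 1) * (norm u + 1)"
            using \<open>e > 0\<close> by (intro mult_mono) (auto simp: \<rho>_def)
          also have "\<dots> = e" by (simp add: add_nonneg_eq_0_iff)
          finally show ?thesis .
        qed
        obtain d where d: "d > 0" "\<And>h. 0 < h \<and> h < d \<Longrightarrow> measure lebesgue ({t..t + h} - G) \<le> \<rho> / 2 * h"
          using elim \<open>t \<in> G\<close> \<rho> by (meson half_gt_zero)
        obtain h where h: "0 < h" "h < d" "infdist (y + t *\<^sub>R u + h *\<^sub>R u) F > e * h"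
          using t d(1) by (auto simp: bad_def)
        have "{t + h - \<rho> * h..t + h} \<subseteq> {t..t + h} - G"
        proof
          fix s assume s: "s \<in> {t + h - \<rho> * h..t + h}"
          have "\<rho> * h \<le> h" using \<rho> h by (simp add: mult_left_le_one_le)
          moreover have "s \<notin> G"
          proof
            assume "s \<in> G"
            then have "infdist (y + t *\<^sub>R u + h *\<^sub>R u) F \<le> dist (y + t *\<^sub>R u + h *\<^sub>R u) (y + s *\<^sub>R u)"
              by (intro infdist_le) (simp add: G_def)
            also have "\<dots> = \<bar>t + h - s\<bar> * norm u"
              by (simp add: dist_norm flip: scaleR_add_left scaleR_diff_left)
            also have "\<dots> \<le> (\<rho> * h) * norm u"
              using s by (intro mult_right_mono) auto
            also have "\<dots> \<le> e * h"
              using \<rho>u h by (simp add: mult.assoc mult.commute mult.left_commute)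
            finally show False using h by simp
          qed
          ultimately show "s \<in> {t..t + h} - G" using s by auto
        qed
        then have "measure lebesgue {t + h - \<rho> * h..t + h} \<le> measure lebesgue ({t..t + h} - G)"
          using Gb by (intro measure_mono_fmeasurable fmeasurable_Diff) auto
        moreover have "measure lebesgue {t + h - \<rho> * h..t + h} = \<rho> * h" using h \<rho> by simp
        ultimately have "\<rho> * h \<le> \<rho> / 2 * h" using d(2)[of h] h by linarith
        then show False using h \<rho> mult_pos_pos[of \<rho> h] by linarith
      qed
    qed
    then have "{t. y + t *\<^sub>R u \<in> bad e} \<in> null_sets lebesgue"
      using sb by (subst AE_iff_null_sets) auto
    then show "{t. y + t *\<^sub>R u \<in> bad e} \<in> null_sets lborel" using sb by (simp add: null_sets_completion_iff)
  qed measurable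
  have "AE x in lborel. \<forall>n::nat. x \<notin> bad (inverse (Suc n))"
    using null by (intro AE_all_countable[THEN iffD2] allI AE_not_in) auto
  then have "AE x in lebesgue. \<forall>n::nat. x \<notin> bad (inverse (Suc n))"
    by (rule AE_completion)
  then show ?thesis
  proof eventually_elim
    case (elim x)
    show ?case
    proof (intro impI allI)
      fix e :: real assume "x \<in> F" "e > 0"
      then obtain n where n: "inverse (real (Suc n)) < e" using reals_Archimedean by blast
      obtain d where d: "d > 0" "\<And>h. 0 < h \<Longrightarrow> h < d \<Longrightarrow> infdist (x + h *\<^sub>R u) F \<le> inverse (Suc n) * h"
        using elim[rule_format, of n] \<open>x \<in> F\<close> unfolding bad_def Int_iff mem_Collect_eq by (meson not_less)
      have "infdist (x + h *\<^sub>R u) F \<le> e * h" if "0 < h" "h < d" for h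
        using d(2)[OF that] mult_right_mono[of "inverse (real (Suc n))" e h] n that by linarith
      then show "\<exists>d>0. \<forall>h. 0 < h \<and> h < d \<longrightarrow> infdist (x + h *\<^sub>R u) F \<le> e * h"
        using d(1) by blast
    qed
  qed
qed

lemma countable_dense_directions:
  obtains D :: "'a::euclidean_space set" where "countable D" "closure D = UNIV"
proof -
  obtain D :: "'a set" where "countable D" and D: "\<And>X. open X \<Longrightarrow> X \<noteq> {} \<Longrightarrow> \<exists>d\<in>D. d \<in> X"
    using countable_dense_setE by blast
  have "x \<in> closure D" for x
    unfolding closure_approachable
  proof (intro allI impI)
    fix e :: real assume "e > 0"
    then have "x \<in> ball x e" by simp
    then obtain y where "y \<in> D" "y \<in> ball x e" using D[of "ball x e"] by blast
    then show "\<exists>y\<in>D. dist y x < e" by (auto simp: dist_commute)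
  qed
  then have "closure D = UNIV" by blast
  with \<open>countable D\<close> show ?thesis using that by blast
qed

lemma finite_net_of_dense:
  fixes D :: "'a::metric_space set"
  assumes "compact K" "closure D = UNIV" "e > 0"
  obtains N where "finite N" "N \<subseteq> D" "\<And>x. x \<in> K \<Longrightarrow> \<exists>u\<in>N. dist x u < e"
proof -
  have "K \<subseteq> (\<Union>u\<in>D. ball u e)"
  proof
    fix x assume "x \<in> K"
    have "x \<in> closure D" using assms by simp
    then show "x \<in> (\<Union>u\<in>D. ball u e)" using \<open>e > 0\<close> by (auto simp: closure_approachable)
  qed
  then obtain N where "N \<subseteq> D" "finite N" "K \<subseteq> (\<Union>u\<in>N. ball u e)"
    using compactE_image[OF assms(1), of D "\<lambda>u. ball u e"] by auto
  moreover have "\<exists>u\<in>N. dist x u < e" if "x \<in> K" for x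
    using \<open>K \<subseteq> (\<Union>u\<in>N. ball u e)\<close> that unfolding subset_iff UN_iff mem_ball by (metis dist_commute)
  ultimately show ?thesis using that by blast
qed

text \<open>The version for all directions at once: the exceptional null sets of countably many
dense directions are discarded, and compactness of the unit ball reduces the estimate at a
given precision to finitely many of these directions.\<close>
lemma AE_not_porous:
  fixes F :: "'a::euclidean_space set"
  assumes F: "closed F"
  shows "AE x in lebesgue. x \<in> F \<longrightarrow>
           (\<forall>e>0. \<exists>d>0. \<forall>z. dist z x < d \<longrightarrow> infdist z F \<le> e * dist z x)"
proof -
  obtain D :: "'a set" where D: "countable D" "closure D = UNIV"
    using countable_dense_directions by blast
  have "AE x in lebesgue. \<forall>u\<in>D. x \<in> F \<longrightarrow>
      (\<forall>e>0. \<exists>d>0. \<forall>h. 0 < h \<and> h < d \<longrightarrow> infdist (x + h *\<^sub>R u) F \<le> e * h)"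
    by (intro AE_ball_countable[THEN iffD2] ballI AE_not_porous_in_direction F D(1))
  then show ?thesis
  proof eventually_elim
    case (elim x)
    show ?case
    proof (intro impI allI)
      fix e :: real assume x: "x \<in> F" and e: "e > 0"
      obtain N where N: "finite N" "N \<subseteq> D" "\<And>w. w \<in> cball 0 1 \<Longrightarrow> \<exists>u\<in>N. dist w u < e/2"
        using finite_net_of_dense[OF compact_cball D(2), of "e/2" 0 1] e by auto
      have "\<forall>\<^sub>F h in at_right 0. \<forall>u\<in>N. infdist (x + h *\<^sub>R u) F \<le> e/2 * h"
        unfolding eventually_ball_finite_distrib[OF N(1)]
      proof
        fix u assume "u \<in> N"
        then obtain d where "d > 0" "\<forall>h. 0 < h \<and> h < d \<longrightarrow> infdist (x + h *\<^sub>R u) F \<le> e/2 * h"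
          using elim x e N(2) by (metis half_gt_zero subsetD)
        then show "\<forall>\<^sub>F h in at_right 0. infdist (x + h *\<^sub>R u) F \<le> e/2 * h"
          unfolding eventually_at_right_field by blast
      qed
      then obtain d where d: "d > 0" "\<And>h u. 0 < h \<Longrightarrow> h < d \<Longrightarrow> u \<in> N \<Longrightarrow> infdist (x + h *\<^sub>R u) F \<le> e/2 * h"
        unfolding eventually_at_right_field by auto
      have "infdist z F \<le> e * dist z x" if z: "dist z x < d" for z
      proof (cases "z = x")
        case True
        then show ?thesis using x by simp
      next
        case False
        define r where "r = dist z x"
        define w where "w = (z - x) /\<^sub>R r"
        have r: "r > 0" "r < d" using False z by (auto simp: r_def)
        have "w \<in> cball 0 1" using r by (simp add: w_def r_def dist_norm)
        then obtain u where u: "u \<in> N" "dist w u < e/2" using N(3) by blast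
        have "z = x + r *\<^sub>R w" using r by (simp add: w_def)
        then have "dist z (x + r *\<^sub>R u) = r * dist w u"
          using r by (simp add: dist_norm flip: scaleR_diff_right)
        also have "\<dots> \<le> r * (e/2)" using u r by (intro mult_left_mono) auto
        finally have "dist z (x + r *\<^sub>R u) \<le> r * (e/2)" .
        moreover have "infdist z F \<le> infdist (x + r *\<^sub>R u) F + dist z (x + r *\<^sub>R u)"
          by (rule infdist_triangle)
        moreover have "infdist (x + r *\<^sub>R u) F \<le> e/2 * r" using d(2) r u by blast
        ultimately show ?thesis by (simp add: r_def mult.commute)
      qed
      then show "\<exists>d>0. \<forall>z. dist z x < d \<longrightarrow> infdist z F \<le> e * dist z x"
        using d(1) by blast
    qed
  qed
qed

section \<open>Metric differentiability almost everywhere\<close>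

text \<open>The directional speed at \<open>x\<close> is also seen from the moving base point
\<open>x + t *\<^sub>R u\<close>. The sets \<open>F a k j\<close> collect the points whose
speed in direction \<open>v\<close> is within \<open>1 / (j + 1)\<close> of \<open>a\<close> at
all scales up to \<open>1 / (k + 1)\<close>. They are closed, and at a point where \<open>F a k
j\<close> is not porous, \<open>x + t *\<^sub>R u\<close> is within \<open>o(t)\<close> of a
point of that set.\<close>
lemma AE_metric_derivative_at_shifted_point:
  fixes g :: "'a::euclidean_space \<Rightarrow> 'b::metric_space"
  assumes lip: "L-lipschitz_on UNIV g"
  shows "AE x in lebesgue. \<exists>s. ((\<lambda>t. dist (g (x + t *\<^sub>R v)) (g x) / t) \<longlongrightarrow> s) (at_right 0) \<and>
           ((\<lambda>t. dist (g (x + t *\<^sub>R u + t *\<^sub>R v)) (g (x + t *\<^sub>R u)) / t) \<longlongrightarrow> s) (at_right 0)"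
proof -
  define F where "F a k j = {y. \<forall>t. 0 < t \<and> t \<le> inverse (real (Suc k)) \<longrightarrow>
      \<bar>dist (g (y + t *\<^sub>R v)) (g y) - a * t\<bar> \<le> t * inverse (real (Suc j))}" for a k j
  have L0: "L \<ge> 0" using lip by (rule lipschitz_on_nonneg)
  have cont: "continuous_on UNIV g" using lip by (rule lipschitz_on_continuous_on)
  have c1: "continuous_on UNIV (\<lambda>x. g (x + w))" for w
    by (rule continuous_on_compose2[OF cont, of UNIV "\<lambda>x. x + w"]) (auto intro: continuous_on_add continuous_on_id continuous_on_const)
  have clF: "closed (F a k j)" for a k j
    unfolding F_def by (intro closed_Collect_all closed_Collect_imp open_Collect_const closed_Collect_le continuous_intros c1 cont)
  have "AE x in lebesgue. \<forall>a\<in>\<rat>. \<forall>k j. x \<in> F a k j \<longrightarrow>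
      (\<forall>e>0. \<exists>d>0. \<forall>z. dist z x < d \<longrightarrow> infdist z (F a k j) \<le> e * dist z x)"
    by (intro AE_ball_countable[THEN iffD2] ballI AE_all_countable[THEN iffD2] allI AE_not_porous clF countable_rat)
  with AE_directional_metric_derivative[OF lip, of v] show ?thesis
  proof eventually_elim
    case (elim x)
    then obtain s where s: "((\<lambda>t. dist (g (x + t *\<^sub>R v)) (g x) / t) \<longlongrightarrow> s) (at_right 0)" by blast
    have "((\<lambda>t. dist (g (x + t *\<^sub>R u + t *\<^sub>R v)) (g (x + t *\<^sub>R u)) / t) \<longlongrightarrow> s) (at_right 0)"
    proof (rule tendstoI)
      fix e :: real assume e: "e > 0"
      obtain j where j: "inverse (real (Suc j)) < e/4" using reals_Archimedean[of "e/4"] e by auto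
      define \<eta> where "\<eta> = inverse (real (Suc j))"
      have \<eta>: "\<eta> > 0" "\<eta> < e/4" using j by (auto simp: \<eta>_def)
      obtain a where a: "a \<in> \<rat>" "s - \<eta>/2 < a" "a < s + \<eta>/2"
        using Rats_dense_in_real[of "s - \<eta>/2" "s + \<eta>/2"] \<eta> by auto
      have "\<forall>\<^sub>F t in at_right 0. dist (dist (g (x + t *\<^sub>R v)) (g x) / t) s < \<eta>/2"
        using s \<eta> by (intro tendstoD) auto
      then obtain b where b: "b > 0" "\<And>t. 0 < t \<Longrightarrow> t < b \<Longrightarrow> \<bar>dist (g (x + t *\<^sub>R v)) (g x) / t - s\<bar> < \<eta>/2"
        unfolding eventually_at_right_field dist_real_def by blast
      obtain k where k: "inverse (real (Suc k)) < b" using reals_Archimedean[OF b(1)] by blast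
      have xF: "x \<in> F a k j"
        unfolding F_def
      proof (intro CollectI allI impI)
        fix t :: real assume t: "0 < t \<and> t \<le> inverse (real (Suc k))"
        then have "\<bar>dist (g (x + t *\<^sub>R v)) (g x) / t - a\<bar> \<le> \<eta>"
          using b(2)[of t] k a by linarith
        then have "\<bar>dist (g (x + t *\<^sub>R v)) (g x) / t - a\<bar> * t \<le> \<eta> * t"
          using t by (intro mult_right_mono) auto
        moreover have "\<bar>dist (g (x + t *\<^sub>R v)) (g x) / t - a\<bar> * t = \<bar>dist (g (x + t *\<^sub>R v)) (g x) - a * t\<bar>"
          using t by (subst abs_mult_pos) (auto simp: left_diff_distrib)
        ultimately show "\<bar>dist (g (x + t *\<^sub>R v)) (g x) - a * t\<bar> \<le> t * inverse (real (Suc j))"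
          by (simp add: \<eta>_def mult.commute)
      qed
      \<comment> \<open>moving the base point to \<open>p\<close>, the error allowed by \<open>F a k j\<close>, and \<open>\<bar>a - s\<bar>\<close> contribute \<open>e / 4\<close> each\<close>
      define M where "M = (L + 1) * (norm u + 1)"
      define \<rho> where "\<rho> = e / (8 * M)"
      have pos: "M > 0" unfolding M_def using L0 by (intro mult_pos_pos) (auto simp: add_nonneg_pos)
      have \<rho>: "\<rho> > 0" unfolding \<rho>_def using e pos by (intro divide_pos_pos) auto
      have \<rho>L: "2 * L * (\<rho> * norm u) \<le> e / 4"
      proof -
        have "2 * L * (\<rho> * norm u) = 2 * \<rho> * (L * norm u)" by simp
        also have "\<dots> \<le> 2 * \<rho> * M"
          unfolding M_def using \<rho> L0 by (intro mult_left_mono mult_mono) auto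
        also have "\<dots> = e / 4" using pos by (simp add: \<rho>_def)
        finally show ?thesis .
      qed
      obtain d where d: "d > 0" "\<And>z. dist z x < d \<Longrightarrow> infdist z (F a k j) \<le> \<rho> * dist z x"
        using elim xF a(1) \<rho> by blast
      define b' where "b' = min (inverse (real (Suc k))) (d / (norm u + 1))"
      have b': "b' > 0" using d by (simp add: b'_def add_nonneg_pos)
      have "dist (dist (g (x + t *\<^sub>R u + t *\<^sub>R v)) (g (x + t *\<^sub>R u)) / t) s < e" if t: "0 < t" "t < b'" for t
      proof -
        let ?z = "x + t *\<^sub>R u"
        have dz: "dist ?z x = t * norm u" using t by (simp add: dist_norm)
        have "t * (norm u + 1) < d" using t pos_less_divide_eq[of "norm u + 1" t d] by (simp add: b'_def add_nonneg_pos)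
        then have "t * norm u < d" using t by (simp add: distrib_left)
        then have "infdist ?z (F a k j) \<le> \<rho> * (t * norm u)" using d(2)[of ?z] dz by simp
        moreover obtain p where p: "p \<in> F a k j" "infdist ?z (F a k j) = dist ?z p"
          using infdist_attains_inf[OF clF, of a k j ?z] xF by blast
        ultimately have zp: "dist ?z p \<le> \<rho> * norm u * t" by (simp add: mult_ac)
        have l: "dist (g y) (g w) \<le> L * dist y w" for y w using lipschitz_onD[OF lip] by simp
        have "\<bar>dist (g (?z + t *\<^sub>R v)) (g ?z) - dist (g (p + t *\<^sub>R v)) (g p)\<bar>
           \<le> dist (g (?z + t *\<^sub>R v)) (g (p + t *\<^sub>R v)) + dist (g ?z) (g p)"
          by (smt (verit) dist_triangle dist_commute)
        also have "\<dots> \<le> L * dist ?z p + L * dist ?z p"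
          using l[of "?z + t *\<^sub>R v" "p + t *\<^sub>R v"] l[of ?z p] by simp
        also have "\<dots> \<le> 2 * L * (\<rho> * norm u * t)" using zp L0 mult_left_mono[OF zp, of "2 * L"] by simp
        also have "\<dots> \<le> e / 4 * t" using mult_right_mono[OF \<rho>L, of t] t by (simp add: mult_ac)
        finally have 1: "\<bar>dist (g (?z + t *\<^sub>R v)) (g ?z) - dist (g (p + t *\<^sub>R v)) (g p)\<bar> \<le> e / 4 * t" .
        have "\<bar>dist (g (p + t *\<^sub>R v)) (g p) - a * t\<bar> \<le> t * \<eta>"
          using p(1) t by (auto simp: F_def \<eta>_def b'_def)
        also have "\<dots> \<le> e / 4 * t" using mult_left_mono[of \<eta> "e/4" t] \<eta> t by (simp add: mult_ac)
        finally have 2: "\<bar>dist (g (p + t *\<^sub>R v)) (g p) - a * t\<bar> \<le> e / 4 * t" .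
        have "\<bar>a - s\<bar> \<le> e / 4" using a \<eta> unfolding abs_le_iff by linarith
        then have "\<bar>a - s\<bar> * t \<le> e / 4 * t" using t by (intro mult_right_mono) auto
        then have 3: "\<bar>a * t - s * t\<bar> \<le> e / 4 * t" using t by (simp add: abs_mult flip: left_diff_distrib)
        have "\<bar>dist (g (?z + t *\<^sub>R v)) (g ?z) - s * t\<bar> \<le> 3 * (e / 4 * t)" using 1 2 3 by linarith
        also have "\<dots> < e * t" using e t by simp
        finally have "\<bar>dist (g (?z + t *\<^sub>R v)) (g ?z) - s * t\<bar> / t < e" using t by (simp add: field_simps)
        moreover have "dist (g (?z + t *\<^sub>R v)) (g ?z) / t - s = (dist (g (?z + t *\<^sub>R v)) (g ?z) - s * t) / t"
          using t by (simp add: field_simps)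
        ultimately show ?thesis using t by (simp add: dist_real_def)
      qed
      then show "\<forall>\<^sub>F t in at_right 0. dist (dist (g (x + t *\<^sub>R u + t *\<^sub>R v)) (g (x + t *\<^sub>R u)) / t) s < e"
        unfolding eventually_at_right_field using b' by blast
    qed
    with s show ?case by blast
  qed
qed

text \<open>Moving base points give the triangle inequality (with base point shifted by
\<open>u\<close>) and symmetry (with shift \<open>- v\<close>, which exchanges the two end
points). The limits are uniform over unit vectors because all difference quotients are
\<open>L\<close>-Lipschitz in the direction.\<close>
lemma has_metric_derivative_of_directional_limits:
  fixes g :: "'a::euclidean_space \<Rightarrow> 'b::metric_space"
  assumes lip: "L-lipschitz_on UNIV g"
    and lim: "\<And>u v. ((\<lambda>t. dist (g (x + t *\<^sub>R u + t *\<^sub>R v)) (g (x + t *\<^sub>R u)) / t) \<longlongrightarrow> \<sigma> v) (at_right 0)"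
    and \<sigma>: "L-lipschitz_on UNIV \<sigma>"
  shows "has_metric_derivative g \<sigma> x"
proof -
  have L0: "L \<ge> 0" using lip by (rule lipschitz_on_nonneg)
  have l: "dist (g y) (g w) \<le> L * dist y w" for y w using lipschitz_onD[OF lip] by simp
  have lim0: "((\<lambda>t. dist (g (x + t *\<^sub>R v)) (g x) / t) \<longlongrightarrow> \<sigma> v) (at_right 0)" for v
    using lim[of 0 v] by simp
  have nb: "at_right (0::real) \<noteq> bot" by simp
  have zero: "\<sigma> 0 = 0"
    using lim0[of 0] by (simp add: tendsto_const_iff)
  have pos: "\<sigma> (c *\<^sub>R v) = c * \<sigma> v" if c: "c > 0" for c v
  proof -
    have "filterlim (\<lambda>t. c * t) (at_right 0) (at_right (0::real))"
      using c by (intro filterlim_times_pos[where p = 0]) (auto simp: filterlim_ident)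
    from tendsto_mult_left[OF filterlim_compose[OF lim0[of v] this], of c]
    have "((\<lambda>t. c * (dist (g (x + (c * t) *\<^sub>R v)) (g x) / (c * t))) \<longlongrightarrow> c * \<sigma> v) (at_right 0)" .
    moreover have "c * (dist (g (x + (c * t) *\<^sub>R v)) (g x) / (c * t))
        = dist (g (x + t *\<^sub>R c *\<^sub>R v)) (g x) / t" for t
      using c by (simp add: mult.commute[of t c])
    ultimately have "((\<lambda>t. dist (g (x + t *\<^sub>R c *\<^sub>R v)) (g x) / t) \<longlongrightarrow> c * \<sigma> v) (at_right 0)"
      by simp
    from tendsto_unique[OF nb lim0 this] show ?thesis .
  qed
  have sym: "\<sigma> (- v) = \<sigma> v" for v
  proof -
    have "((\<lambda>t. dist (g (x + t *\<^sub>R (-v))) (g x) / t) \<longlongrightarrow> \<sigma> v) (at_right 0)"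
      using lim[of "-v" v] by (simp add: dist_commute)
    from tendsto_unique[OF nb lim0 this] show ?thesis .
  qed
  have hom: "\<sigma> (c *\<^sub>R v) = \<bar>c\<bar> * \<sigma> v" for c v
  proof (cases "c > 0")
    case False
    then show ?thesis
    proof (cases "c = 0")
      case False
      then have "\<sigma> ((- c) *\<^sub>R v) = - c * \<sigma> v" using \<open>\<not> c > 0\<close> by (intro pos) simp
      then show ?thesis using sym[of "c *\<^sub>R v"] \<open>\<not> c > 0\<close> by simp
    qed (simp add: zero)
  qed (simp add: pos)
  have tri: "\<sigma> (u + v) \<le> \<sigma> u + \<sigma> v" for u v
  proof (rule tendsto_le[OF nb tendsto_add[OF lim0[of u] lim[of u v]] lim0[of "u + v"]])
    show "\<forall>\<^sub>F t in at_right 0. dist (g (x + t *\<^sub>R (u + v))) (g x) / t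
        \<le> dist (g (x + t *\<^sub>R u)) (g x) / t + dist (g (x + t *\<^sub>R u + t *\<^sub>R v)) (g (x + t *\<^sub>R u)) / t"
      unfolding eventually_at_right_field
    proof (intro exI[of _ 1] conjI allI impI)
      fix t :: real assume t: "0 < t"
      have "dist (g (x + t *\<^sub>R (u + v))) (g x)
          \<le> dist (g (x + t *\<^sub>R u)) (g x) + dist (g (x + t *\<^sub>R u + t *\<^sub>R v)) (g (x + t *\<^sub>R u))"
        using dist_triangle[of "g (x + t *\<^sub>R (u + v))" "g x" "g (x + t *\<^sub>R u)"]
        by (simp add: scaleR_add_right add.assoc)
      then show "dist (g (x + t *\<^sub>R (u + v))) (g x) / t
        \<le> dist (g (x + t *\<^sub>R u)) (g x) / t + dist (g (x + t *\<^sub>R u + t *\<^sub>R v)) (g (x + t *\<^sub>R u)) / t"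
        using t by (simp add: divide_right_mono flip: add_divide_distrib)
    qed simp
  qed
  have "((\<lambda>y. (dist (g y) (g x) - \<sigma> (y - x)) / norm (y - x)) \<longlongrightarrow> 0) (at x)"
  proof (rule tendstoI)
    fix e :: real assume e: "e > 0"
    define \<delta> where "\<delta> = e / (4 * (L + 1))"
    have \<delta>: "\<delta> > 0" "2 * L * \<delta> \<le> e / 2" using e L0 by (auto simp: \<delta>_def field_simps)
    obtain N where N: "finite N" "N \<subseteq> (UNIV::'a set)" "\<And>w. w \<in> cball 0 1 \<Longrightarrow> \<exists>u\<in>N. dist w u < \<delta>"
      using finite_net_of_dense[OF compact_cball closure_UNIV \<delta>(1), of 0 1] by blast
    have "\<forall>\<^sub>F t in at_right 0. \<forall>w\<in>N. dist (dist (g (x + t *\<^sub>R w)) (g x) / t) (\<sigma> w) < e/2"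
      unfolding eventually_ball_finite_distrib[OF N(1)] using e by (intro ballI tendstoD[OF lim0]) auto
    then obtain d where d: "d > 0" "\<And>t w. 0 < t \<Longrightarrow> t < d \<Longrightarrow> w \<in> N \<Longrightarrow> \<bar>dist (g (x + t *\<^sub>R w)) (g x) / t - \<sigma> w\<bar> < e/2"
      unfolding eventually_at_right_field dist_real_def by auto
    have "dist ((dist (g y) (g x) - \<sigma> (y - x)) / norm (y - x)) 0 < e" if y: "y \<noteq> x" "dist y x < d" for y
    proof -
      define t where "t = norm (y - x)"
      define w where "w = (y - x) /\<^sub>R t"
      have t: "0 < t" "t < d" using y by (auto simp: t_def dist_norm)
      have nw: "norm w = 1" using t by (simp add: w_def t_def)
      have yw: "y = x + t *\<^sub>R w" "y - x = t *\<^sub>R w" using t by (auto simp: w_def)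
      have "w \<in> cball 0 1" using t by (simp add: w_def t_def)
      then obtain u where u: "u \<in> N" "dist w u < \<delta>" using N(3) by blast
      have "\<bar>dist (g (x + t *\<^sub>R w)) (g x) - dist (g (x + t *\<^sub>R u)) (g x)\<bar> \<le> dist (g (x + t *\<^sub>R w)) (g (x + t *\<^sub>R u))"
        by (smt (verit) dist_triangle dist_commute)
      also have "\<dots> \<le> L * dist (x + t *\<^sub>R w) (x + t *\<^sub>R u)" by (rule l)
      also have "dist (x + t *\<^sub>R w) (x + t *\<^sub>R u) = t * dist w u"
        using t by (simp add: dist_norm flip: scaleR_diff_right)
      also have "L * (t * dist w u) \<le> L * (t * \<delta>)"
        using u t L0 by (intro mult_left_mono) auto
      finally have "\<bar>dist (g (x + t *\<^sub>R w)) (g x) - dist (g (x + t *\<^sub>R u)) (g x)\<bar> / t \<le> L * \<delta>"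
        using t by (simp add: field_simps)
      then have 1: "\<bar>dist (g (x + t *\<^sub>R w)) (g x) / t - dist (g (x + t *\<^sub>R u)) (g x) / t\<bar> \<le> L * \<delta>"
        using t by (simp add: diff_divide_distrib[symmetric])
      have 2: "\<bar>dist (g (x + t *\<^sub>R u)) (g x) / t - \<sigma> u\<bar> < e/2" using d(2) t u by blast
      have "dist (\<sigma> w) (\<sigma> u) \<le> L * dist w u" using lipschitz_onD[OF \<sigma>] by simp
      also have "\<dots> \<le> L * \<delta>" using u L0 by (intro mult_left_mono) auto
      finally have 3: "\<bar>\<sigma> w - \<sigma> u\<bar> \<le> L * \<delta>" by (simp add: dist_real_def)
      have "\<bar>dist (g (x + t *\<^sub>R w)) (g x) / t - \<sigma> w\<bar> < e" using 1 2 3 \<delta>(2) by linarith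
      moreover have "(dist (g y) (g x) - \<sigma> (y - x)) / norm (y - x) = dist (g (x + t *\<^sub>R w)) (g x) / t - \<sigma> w"
        unfolding yw(2) using t yw(1) nw by (simp add: hom diff_divide_distrib)
      ultimately show ?thesis by (simp add: dist_real_def)
    qed
    then show "\<forall>\<^sub>F y in at x. dist ((dist (g y) (g x) - \<sigma> (y - x)) / norm (y - x)) 0 < e"
      unfolding eventually_at using d(1) by blast
  qed
  then show ?thesis using hom tri by (simp add: has_metric_derivative_def is_seminorm_def)
qed

text \<open>Kirchheim's theorem. The directional limits are available for a countable dense set
of directions; being \<open>L\<close>-Lipschitz there, they extend to all directions.\<close>
theorem AE_metrically_differentiable:
  fixes g :: "'a::euclidean_space \<Rightarrow> 'b::metric_space"
  assumes lip: "L-lipschitz_on UNIV g"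
  shows "AE x in lebesgue. metrically_differentiable g x"
proof -
  have L0: "L \<ge> 0" using lip by (rule lipschitz_on_nonneg)
  have l: "dist (g y) (g w) \<le> L * dist y w" for y w using lipschitz_onD[OF lip] by simp
  obtain D :: "'a set" where D: "countable D" "closure D = UNIV"
    using countable_dense_directions by blast
  have "AE x in lebesgue. \<forall>u\<in>D. \<forall>v\<in>D. \<exists>s. ((\<lambda>t. dist (g (x + t *\<^sub>R v)) (g x) / t) \<longlongrightarrow> s) (at_right 0) \<and>
           ((\<lambda>t. dist (g (x + t *\<^sub>R u + t *\<^sub>R v)) (g (x + t *\<^sub>R u)) / t) \<longlongrightarrow> s) (at_right 0)"
    by (intro AE_ball_countable[THEN iffD2] ballI D(1) AE_metric_derivative_at_shifted_point[OF lip])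
  then show ?thesis
  proof eventually_elim
    case (elim x)
    define q where "q u v t = dist (g (x + t *\<^sub>R u + t *\<^sub>R v)) (g (x + t *\<^sub>R u)) / t" for u v t
    have nb: "at_right (0::real) \<noteq> bot" by simp
    have qL: "\<bar>q u v t - q u' v' t\<bar> \<le> 2 * L * dist u u' + L * dist v v'" if t: "t > 0" for u v u' v' t
    proof -
      let ?a = "x + t *\<^sub>R u + t *\<^sub>R v" and ?b = "x + t *\<^sub>R u" and ?a' = "x + t *\<^sub>R u' + t *\<^sub>R v'" and ?b' = "x + t *\<^sub>R u'"
      have b: "dist ?b ?b' = t * dist u u'"
        using t by (simp add: dist_norm flip: scaleR_diff_right)
      have "dist ?a ?a' = t * norm ((u - u') + (v - v'))"
      proof -
        have "?a - ?a' = t *\<^sub>R ((u - u') + (v - v'))" by (simp add: algebra_simps)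
        then show ?thesis using t by (simp add: dist_norm)
      qed
      also have "\<dots> \<le> t * (dist u u' + dist v v')"
        using t by (intro mult_left_mono) (auto simp: dist_norm intro: norm_triangle_ineq)
      finally have a: "dist ?a ?a' \<le> t * (dist u u' + dist v v')" .
      have "\<bar>dist (g ?a) (g ?b) - dist (g ?a') (g ?b')\<bar> \<le> dist (g ?a) (g ?a') + dist (g ?b) (g ?b')"
        by (smt (verit) dist_triangle dist_commute)
      also have "\<dots> \<le> L * dist ?a ?a' + L * dist ?b ?b'" using l by (intro add_mono)
      also have "\<dots> \<le> L * (t * (dist u u' + dist v v')) + L * (t * dist u u')"
        using a b L0 by (intro add_mono mult_left_mono) auto
      finally have "\<bar>dist (g ?a) (g ?b) - dist (g ?a') (g ?b')\<bar> / t \<le> 2 * L * dist u u' + L * dist v v'"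
        using t by (simp add: field_simps)
      then show ?thesis using t by (simp add: q_def flip: diff_divide_distrib)
    qed
    have "\<forall>v\<in>D. \<exists>s. \<forall>u\<in>D. (q u v \<longlongrightarrow> s) (at_right 0)"
    proof
      fix v assume v: "v \<in> D"
      then obtain s where s: "((\<lambda>t. dist (g (x + t *\<^sub>R v)) (g x) / t) \<longlongrightarrow> s) (at_right 0)"
        using elim[rule_format, OF v v] by (elim exE conjE)
      have "(q u v \<longlongrightarrow> s) (at_right 0)" if "u \<in> D" for u
        proof -
        from elim[rule_format, OF that v] obtain s' where
          s': "((\<lambda>t. dist (g (x + t *\<^sub>R v)) (g x) / t) \<longlongrightarrow> s') (at_right 0)" "(q u v \<longlongrightarrow> s') (at_right 0)"
          unfolding q_def by (elim exE conjE)
        then show ?thesis using tendsto_unique[OF nb s s'(1)] by simp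
      qed
      then show "\<exists>s. \<forall>u\<in>D. (q u v \<longlongrightarrow> s) (at_right 0)" by blast
    qed
    from bchoice[OF this] obtain s where s: "\<And>u v. v \<in> D \<Longrightarrow> u \<in> D \<Longrightarrow> (q u v \<longlongrightarrow> s v) (at_right 0)" by blast
    have Dne: "D \<noteq> {}" using D(2) by auto
    have "L-lipschitz_on D s"
    proof (rule lipschitz_onI[OF _ L0])
      fix v w assume vw: "v \<in> D" "w \<in> D"
      have "((\<lambda>t. \<bar>q v v t - q v w t\<bar>) \<longlongrightarrow> \<bar>s v - s w\<bar>) (at_right 0)"
        using vw by (intro tendsto_intros s)
      moreover have "\<forall>\<^sub>F t in at_right 0. \<bar>q v v t - q v w t\<bar> \<le> L * dist v w"
        unfolding eventually_at_right_field using qL[of _ v v v w] by (intro exI[of _ 1]) simp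
      ultimately have "\<bar>s v - s w\<bar> \<le> L * dist v w" using tendsto_upperbound nb by blast
      then show "dist (s v) (s w) \<le> L * dist v w" by (simp add: dist_real_def)
    qed
    then obtain \<sigma> where \<sigma>: "L-lipschitz_on UNIV \<sigma>" "\<And>v. v \<in> D \<Longrightarrow> \<sigma> v = s v"
      using lipschitz_extend_closure[of L D s] D(2) by auto
    have "(q u v \<longlongrightarrow> \<sigma> v) (at_right 0)" for u v
    proof (rule tendstoI)
      fix e :: real assume e: "e > 0"
      define \<delta> where "\<delta> = e / (8 * (L + 1))"
      have \<delta>: "\<delta> > 0" "4 * (L * \<delta>) \<le> e / 2" using e L0 by (auto simp: \<delta>_def field_simps)
      obtain u' where u': "u' \<in> D" "dist u' u < \<delta>"
        using D(2) \<delta>(1) closure_approachable[of u D] by auto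
      obtain v' where v': "v' \<in> D" "dist v' v < \<delta>"
        using D(2) \<delta>(1) closure_approachable[of v D] by auto
      have "\<forall>\<^sub>F t in at_right 0. dist (q u' v' t) (\<sigma> v') < e/2"
        using s[OF v'(1) u'(1)] \<sigma>(2)[OF v'(1)] e by (intro tendstoD) auto
      moreover have "\<forall>\<^sub>F t in at_right 0. t > (0::real)" by (rule eventually_at_right_less)
      ultimately show "\<forall>\<^sub>F t in at_right 0. dist (q u v t) (\<sigma> v) < e"
      proof eventually_elim
        case (elim t)
        have Lu: "L * dist u u' \<le> L * \<delta>" using u' L0 by (intro mult_left_mono) (auto simp: dist_commute)
        have Lv: "L * dist v v' \<le> L * \<delta>" using v' L0 by (intro mult_left_mono) (auto simp: dist_commute)
        have "dist (\<sigma> v) (\<sigma> v') \<le> L * dist v v'" using lipschitz_onD[OF \<sigma>(1)] by simp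
        then have "\<bar>\<sigma> v - \<sigma> v'\<bar> \<le> L * \<delta>" using Lv by (simp add: dist_real_def)
        moreover have "\<bar>q u v t - q u' v' t\<bar> \<le> 3 * (L * \<delta>)"
          using qL[OF elim(2), of u v u' v'] Lu Lv by linarith
        moreover have "\<bar>q u' v' t - \<sigma> v'\<bar> < e/2" using elim(1) by (simp add: dist_real_def)
        ultimately show ?case using \<delta>(2) unfolding dist_real_def by linarith
      qed
    qed
    then have "has_metric_derivative g \<sigma> x"
      using \<sigma>(1) by (intro has_metric_derivative_of_directional_limits[OF lip]) (auto simp: q_def[abs_def])
    then show ?case by (auto simp: metrically_differentiable_def)
  qed
qed

section \<open>Unordered sums and outer measure\<close>

lemma infsum_cmult_left_ennreal:
  fixes f :: "'i \<Rightarrow> ennreal"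
  shows "(\<Sum>\<^sub>\<infinity>i\<in>I. c * f i) = c * (\<Sum>\<^sub>\<infinity>i\<in>I. f i)"
  by (simp add: nonneg_infsum_complete SUP_mult_left_ennreal flip: sum_distrib_left)

lemma infsum_Un_le_ennreal:
  fixes f :: "'i \<Rightarrow> ennreal"
  shows "infsum f (A \<union> B) \<le> infsum f A + infsum f B"
proof -
  have "infsum f (A \<union> (B - A)) = infsum f A + infsum f (B - A)"
    by (rule infsum_Un_disjoint) (auto intro: nonneg_summable_on_complete)
  also have "infsum f (B - A) \<le> infsum f B"
    by (rule infsum_mono_neutral) (auto intro: nonneg_summable_on_complete)
  finally show ?thesis by (simp add: add_left_mono)
qed

text \<open>Unordered sums over arbitrary countable index sets occur in the definitions of all
contents, so countable subadditivity is needed in this form.\<close>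
lemma emeasure_UN_le_infsum:
  assumes "countable I" and X: "\<And>i. i \<in> I \<Longrightarrow> X i \<in> sets M"
  shows "emeasure M (\<Union>i\<in>I. X i) \<le> (\<Sum>\<^sub>\<infinity>i\<in>I. emeasure M (X i))"
proof -
  define J where "J n = {i \<in> I. to_nat_on I i \<le> n}" for n
  have finJ: "finite (J n)" for n
    by (rule finite_subset[OF _ finite_imageD[of "to_nat_on I" "J n"]])
      (auto simp: J_def intro!: inj_on_subset[OF inj_on_to_nat_on[OF assms(1)]] intro: finite_subset[of _ "{..n}"])
  define Y where "Y n = (\<Union>i\<in>J n. X i)" for n
  have Y: "range Y \<subseteq> sets M"
    unfolding Y_def using finJ X by (auto simp: J_def intro!: sets.finite_UN)
  have inc: "incseq Y" by (rule incseq_SucI) (auto simp: Y_def J_def)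
  have UY: "(\<Union>i\<in>I. X i) = (\<Union>n. Y n)" by (auto simp: Y_def J_def)
  have "emeasure M (Y n) \<le> (\<Sum>\<^sub>\<infinity>i\<in>I. emeasure M (X i))" for n
  proof -
    have "emeasure M (Y n) \<le> (\<Sum>i\<in>J n. emeasure M (X i))"
      unfolding Y_def using finJ X by (intro emeasure_subadditive_finite) (auto simp: J_def)
    also have "\<dots> \<le> (\<Sum>\<^sub>\<infinity>i\<in>I. emeasure M (X i))"
      using finJ by (subst nonneg_infsum_complete) (auto simp: J_def intro!: SUP_upper)
    finally show ?thesis .
  qed
  then show ?thesis
    unfolding UY SUP_emeasure_incseq[OF Y inc, symmetric] by (rule SUP_least)
qed

lemma infsum_emeasure_disjoint_le:
  assumes "disjoint_family_on X I" and "\<And>i. i \<in> I \<Longrightarrow> X i \<in> sets M"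
    and "\<And>i. i \<in> I \<Longrightarrow> X i \<subseteq> U" and "U \<in> sets M"
  shows "(\<Sum>\<^sub>\<infinity>i\<in>I. emeasure M (X i)) \<le> emeasure M U"
proof (subst nonneg_infsum_complete, simp, rule SUP_least)
  fix F assume "F \<in> {F. finite F \<and> F \<subseteq> I}"
  then have F: "finite F" "F \<subseteq> I" by auto
  then have "(\<Sum>i\<in>F. emeasure M (X i)) = emeasure M (\<Union>i\<in>F. X i)"
    using assms by (intro sum_emeasure) (auto intro: disjoint_family_on_mono)
  also have "\<dots> \<le> emeasure M U"
    using assms F by (intro emeasure_mono) auto
  finally show "(\<Sum>i\<in>F. emeasure M (X i)) \<le> emeasure M U" .
qed

abbreviation outer_lebesgue :: "'a::euclidean_space set \<Rightarrow> ennreal" where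
  "outer_lebesgue \<equiv> outer_measure_of lebesgue"

lemma outer_lebesgue_UN_le_infsum:
  fixes X :: "'i \<Rightarrow> 'a::euclidean_space set"
  assumes "countable I"
  shows "outer_lebesgue (\<Union>i\<in>I. X i) \<le> (\<Sum>\<^sub>\<infinity>i\<in>I. outer_lebesgue (X i))"
proof -
  have "\<exists>E. \<forall>i. E i \<in> sets lebesgue \<and> X i \<subseteq> E i \<and> outer_lebesgue (X i) = emeasure lebesgue (E i)"
    using outer_measure_of_attain[of _ lebesgue] by (intro choice) auto
  then obtain E where E: "\<And>i. E i \<in> sets lebesgue" "\<And>i. X i \<subseteq> E i"
      "\<And>i. outer_lebesgue (X i) = emeasure lebesgue (E i)" by blast
  have "outer_lebesgue (\<Union>i\<in>I. X i) \<le> outer_lebesgue (\<Union>i\<in>I. E i)"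
    using E by (intro outer_measure_of_mono) blast
  also have "\<dots> = emeasure lebesgue (\<Union>i\<in>I. E i)"
    using E assms by (intro outer_measure_of_eq sets.countable_UN') auto
  also have "\<dots> \<le> (\<Sum>\<^sub>\<infinity>i\<in>I. emeasure lebesgue (E i))"
    using E assms by (intro emeasure_UN_le_infsum) auto
  finally show ?thesis by (simp add: E)
qed

lemma negligible_iff_outer_lebesgue: "negligible S \<longleftrightarrow> outer_lebesgue S = 0"
proof
  assume "negligible S"
  then show "outer_lebesgue S = 0"
    by (metis negligible_iff_null_sets null_setsD1 null_setsD2 outer_measure_of_eq)
next
  assume 0: "outer_lebesgue S = 0"
  obtain E where "E \<in> sets lebesgue" "S \<subseteq> E" "outer_lebesgue S = emeasure lebesgue E"
    using outer_measure_of_attain[of S lebesgue] by auto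
  then show "negligible S"
    using 0 by (metis negligible_iff_null_sets negligible_subset null_setsI)
qed

lemma outer_lebesgue_le_diameter_power:
  fixes G :: "'a::euclidean_space set"
  assumes "\<And>x y. x \<in> G \<Longrightarrow> y \<in> G \<Longrightarrow> dist x y \<le> d" and "d \<ge> 0"
  shows "outer_lebesgue G \<le> ennreal ((2 * d) ^ DIM('a))"
proof (cases "G = {}")
  case False
  then obtain x where x: "x \<in> G" by blast
  let ?Q = "cbox (x - d *\<^sub>R One) (x + d *\<^sub>R One)"
  have "G \<subseteq> ?Q"
  proof
    fix y assume "y \<in> G"
    then have d: "norm (y - x) \<le> d" using assms(1)[OF _ x, of y] by (simp add: dist_norm)
    have "\<bar>(y - x) \<bullet> i\<bar> \<le> d" if "i \<in> Basis" for i
      using Basis_le_norm[OF that, of "y - x"] d by linarith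
    then show "y \<in> ?Q" by (fastforce simp: mem_box inner_simps abs_le_iff)
  qed
  then have "outer_lebesgue G \<le> outer_lebesgue ?Q" by (rule outer_measure_of_mono)
  also have "\<dots> = emeasure lborel ?Q" by (simp add: outer_measure_of_eq)
  also have "\<dots> = ennreal ((2 * d) ^ DIM('a))"
    using assms(2) by (subst emeasure_lborel_cbox) (auto simp: inner_simps)
  finally show ?thesis .
qed (simp add: outer_measure_of_eq)

section \<open>Slabs and the rank of a seminorm\<close>

text \<open>A list rather than a set of vectors: the vectors are approximated by members of a
countable dense set, which keeps the number of terms even if two of them coincide.\<close>
definition inner_sum :: "'a::real_inner list \<Rightarrow> 'a \<Rightarrow> real" where
  "inner_sum cs v = (\<Sum>c\<leftarrow>cs. \<bar>c \<bullet> v\<bar>)"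

lemma inner_sum_Cons: "inner_sum (c # cs) v = \<bar>c \<bullet> v\<bar> + inner_sum cs v"
  by (simp add: inner_sum_def)

lemma inner_sum_le:
  assumes "\<And>c. c \<in> set cs \<Longrightarrow> \<bar>c \<bullet> v\<bar> \<le> s"
  shows "inner_sum cs v \<le> real (length cs) * s"
  using assms
proof (induction cs)
  case (Cons c cs)
  from Cons.prems[of c] have "\<bar>c \<bullet> v\<bar> \<le> s" by simp
  moreover have "inner_sum cs v \<le> real (length cs) * s" using Cons by simp
  ultimately show ?case by (simp add: inner_sum_Cons distrib_right)
qed (simp add: inner_sum_def)

lemma continuous_on_inner_sum [continuous_intros]:
  assumes "continuous_on S f"
  shows "continuous_on S (\<lambda>x. inner_sum cs (f x))"
proof (induction cs)
  case (Cons c cs)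
  then show ?case unfolding inner_sum_Cons by (intro continuous_intros assms)
qed (simp add: inner_sum_def)

lemma inner_sum_perturb:
  assumes "list_all2 (\<lambda>c b. dist c b \<le> \<tau>) cs bs"
  shows "inner_sum bs v \<le> inner_sum cs v + real (length cs) * \<tau> * norm v"
  using assms
proof (induction rule: list_all2_induct)
  case (Cons c cs b bs)
  have "\<bar>b \<bullet> v\<bar> \<le> \<bar>c \<bullet> v\<bar> + \<bar>(c - b) \<bullet> v\<bar>" by (simp add: inner_diff_left)
  also have "\<bar>(c - b) \<bullet> v\<bar> \<le> norm (c - b) * norm v" by (rule Cauchy_Schwarz_ineq2)
  also have "\<dots> \<le> \<tau> * norm v" using Cons by (intro mult_right_mono) (auto simp: dist_norm)
  finally show ?case using Cons by (simp add: inner_sum_Cons algebra_simps)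
qed (simp add: inner_sum_def)

lemma list_approximation:
  fixes bs :: "'a::metric_space list"
  assumes "set bs \<subseteq> closure D" "\<tau> > 0"
  shows "\<exists>cs\<in>lists D. list_all2 (\<lambda>c b. dist c b \<le> \<tau>) cs bs"
  using assms(1)
proof (induction bs)
  case (Cons b bs)
  then obtain cs where cs: "cs \<in> lists D" "list_all2 (\<lambda>c b. dist c b \<le> \<tau>) cs bs" by auto
  obtain c where "c \<in> D" "dist c b < \<tau>"
    using Cons.prems assms(2) by (auto simp: closure_approachable)
  then show ?case using cs by (intro bexI[of _ "c # cs"]) auto
qed auto

text \<open>Each vector of the list splits a set of diameter \<open>d\<close> into at most
\<open>2 * d / s + 1\<close> slabs of width \<open>s\<close> orthogonal to it. This count is
what produces the exponents \<open>n - 1\<close> and \<open>m\<close> later on.\<close>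
lemma slab_partition:
  fixes A :: "'a::real_inner set"
  assumes "\<And>c. c \<in> set cs \<Longrightarrow> norm c \<le> 1" and d: "\<And>x y. x \<in> A \<Longrightarrow> y \<in> A \<Longrightarrow> dist x y \<le> d"
    and "d \<ge> 0" "s > 0"
  shows "\<exists>\<P>. finite \<P> \<and> real (card \<P>) \<le> (2 * d / s + 1) ^ length cs \<and> \<Union>\<P> = A \<and>
           (\<forall>P\<in>\<P>. \<forall>x\<in>P. \<forall>y\<in>P. \<forall>c\<in>set cs. \<bar>c \<bullet> (x - y)\<bar> \<le> s)"
  using assms(1)
proof (induction cs)
  case Nil
  then show ?case by (intro exI[of _ "{A}"]) auto
next
  case (Cons c cs)
  then obtain \<P> where P: "finite \<P>" "real (card \<P>) \<le> (2 * d / s + 1) ^ length cs" "\<Union>\<P> = A"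
    "\<And>P x y c. \<lbrakk>P \<in> \<P>; x \<in> P; y \<in> P; c \<in> set cs\<rbrakk> \<Longrightarrow> \<bar>c \<bullet> (x - y)\<bar> \<le> s" by auto
  show ?case
  proof (cases "A = {}")
    case True
    then show ?thesis using assms(3,4) by (intro exI[of _ "{}"]) auto
  next
    case False
    then obtain x0 where x0: "x0 \<in> A" by blast
    define idx where "idx x = \<lfloor>(c \<bullet> (x - x0) + d) / s\<rfloor>" for x
    define I where "I = {0..\<lfloor>2 * d / s\<rfloor>}"
    define \<P>' where "\<P>' = (\<lambda>(i, P). {x \<in> P. idx x = i}) ` (I \<times> \<P>)"
    have idxI: "idx x \<in> I" if "x \<in> A" for x
    proof -
      have "\<bar>c \<bullet> (x - x0)\<bar> \<le> norm c * norm (x - x0)" by (rule Cauchy_Schwarz_ineq2)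
      also have "\<dots> \<le> 1 * d"
        using Cons.prems[of c] d[OF that x0] assms(3) by (intro mult_mono) (auto simp: dist_norm)
      finally have "0 \<le> c \<bullet> (x - x0) + d" "c \<bullet> (x - x0) + d \<le> 2 * d" by auto
      then show ?thesis using assms(4) by (auto simp: I_def idx_def divide_right_mono intro!: floor_mono)
    qed
    have fI: "finite I" by (simp add: I_def)
    have cardI: "real (card I) \<le> 2 * d / s + 1"
    proof -
      have "0 \<le> 2 * d / s" using assms(3,4) by simp
      then have "real (card I) = of_int \<lfloor>2 * d / s\<rfloor> + 1" by (simp add: I_def)
      then show ?thesis by linarith
    qed
    have "finite \<P>'" unfolding \<P>'_def using fI P(1) by simp
    moreover have "real (card \<P>') \<le> (2 * d / s + 1) ^ length (c # cs)"
    proof -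
      have "card \<P>' \<le> card (I \<times> \<P>)" unfolding \<P>'_def using fI P(1) by (intro card_image_le) simp
      then have "real (card \<P>') \<le> real (card I) * real (card \<P>)"
        by (metis card_cartesian_product of_nat_le_iff of_nat_mult)
      also have "\<dots> \<le> (2 * d / s + 1) * (2 * d / s + 1) ^ length cs"
        using cardI P(2) assms(3,4) by (intro mult_mono) auto
      finally show ?thesis by simp
    qed
    moreover have "\<Union>\<P>' = A"
    proof
      show "\<Union>\<P>' \<subseteq> A" using P(3) by (auto simp: \<P>'_def)
      show "A \<subseteq> \<Union>\<P>'"
      proof
        fix x assume "x \<in> A"
        then obtain P where "P \<in> \<P>" "x \<in> P" using P(3) by blast
        then show "x \<in> \<Union>\<P>'" using idxI[OF \<open>x \<in> A\<close>] by (force simp: \<P>'_def)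
      qed
    qed
    moreover have "\<bar>c' \<bullet> (x - y)\<bar> \<le> s" if P': "P' \<in> \<P>'" "x \<in> P'" "y \<in> P'" "c' \<in> set (c # cs)" for P' x y c'
    proof -
      obtain i P where iP: "P \<in> \<P>" "x \<in> P" "y \<in> P" "idx x = i" "idx y = i"
        using P' by (auto simp: \<P>'_def)
      show ?thesis
      proof (cases "c' = c")
        case True
        have "\<bar>(c \<bullet> (x - x0) + d) / s - (c \<bullet> (y - x0) + d) / s\<bar> < 1"
          using iP(4,5) unfolding idx_def by linarith
        moreover have "(c \<bullet> (x - x0) + d) / s - (c \<bullet> (y - x0) + d) / s = (c \<bullet> (x - y)) / s"
          by (simp add: inner_diff_right diff_divide_distrib add_divide_distrib)
        ultimately show ?thesis using assms(4) True by simp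
      next
        case False
        then show ?thesis using P(4)[OF iP(1,2,3)] P'(4) by auto
      qed
    qed
    ultimately show ?thesis by (intro exI[of _ \<P>']) blast
  qed
qed

lemma is_seminorm_zero: "is_seminorm \<sigma> \<Longrightarrow> \<sigma> 0 = 0"
  unfolding is_seminorm_def by (metis abs_zero mult_zero_left scaleR_zero_left)

lemma is_seminorm_uminus: "is_seminorm \<sigma> \<Longrightarrow> \<sigma> (- v) = \<sigma> v"
  unfolding is_seminorm_def by (metis abs_minus_cancel abs_one mult_1 scaleR_minus1_left)

lemma is_seminorm_nonneg: assumes "is_seminorm \<sigma>" shows "\<sigma> v \<ge> 0"
proof -
  have "\<sigma> (v + - v) \<le> \<sigma> v + \<sigma> (- v)" using assms unfolding is_seminorm_def by blast
  then show ?thesis using is_seminorm_zero[OF assms] is_seminorm_uminus[OF assms, of v] by simp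
qed

lemma is_seminorm_diff_le: assumes "is_seminorm \<sigma>" shows "\<bar>\<sigma> v - \<sigma> w\<bar> \<le> \<sigma> (v - w)"
proof -
  have "\<sigma> ((v - w) + w) \<le> \<sigma> (v - w) + \<sigma> w" "\<sigma> (- (v - w) + v) \<le> \<sigma> (- (v - w)) + \<sigma> v"
    using assms unfolding is_seminorm_def by blast+
  then show ?thesis using is_seminorm_uminus[OF assms, of "v - w"] by simp
qed

lemma subspace_seminorm_kernel: assumes "is_seminorm \<sigma>" shows "subspace {v. \<sigma> v = 0}"
proof (rule subspaceI)
  fix x y assume "x \<in> {v. \<sigma> v = 0}" "y \<in> {v. \<sigma> v = 0}"
  moreover have "\<sigma> (x + y) \<le> \<sigma> x + \<sigma> y" using assms by (simp add: is_seminorm_def)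
  ultimately show "x + y \<in> {v. \<sigma> v = 0}" using is_seminorm_nonneg[OF assms, of "x + y"] by simp
qed (use assms is_seminorm_zero in \<open>auto simp: is_seminorm_def\<close>)

lemma orthonormal_list_subspace:
  fixes S :: "'a::euclidean_space set"
  assumes "subspace S"
  obtains bs where "length bs = dim S" "set bs \<subseteq> S" "\<And>b. b \<in> set bs \<Longrightarrow> norm b = 1"
    "\<And>y. y \<in> S \<Longrightarrow> norm y \<le> inner_sum bs y"
proof -
  obtain B where B: "B \<subseteq> S" "pairwise orthogonal B" "\<And>x. x \<in> B \<Longrightarrow> norm x = 1"
    "independent B" "card B = dim S" "span B = S"
    using orthonormal_basis_subspace[OF assms] by metis
  have fB: "finite B" using B(4) by (rule independent_imp_finite)
  obtain bs where bs: "set bs = B" "distinct bs" using finite_distinct_list[OF fB] by blast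
  have "norm y \<le> inner_sum bs y" if y: "y \<in> S" for y
  proof -
    have "(\<Sum>b\<in>B. (y \<bullet> b) *\<^sub>R b) = y"
      using B y fB by (intro orthonormal_basis_expand) auto
    then have "norm y \<le> (\<Sum>b\<in>B. norm ((y \<bullet> b) *\<^sub>R b))" by (metis norm_sum)
    also have "\<dots> = (\<Sum>b\<in>B. \<bar>b \<bullet> y\<bar>)" using B(3) by (intro sum.cong) (auto simp: inner_commute)
    also have "\<dots> = inner_sum bs y"
      using bs by (simp add: inner_sum_def sum_list_distinct_conv_sum_set)
    finally show ?thesis .
  qed
  then show ?thesis using that[of bs] B bs distinct_card[OF bs(2)] by auto
qed

text \<open>The vectors form an orthonormal basis of the orthogonal complement of the kernel of
\<open>\<sigma>\<close>; only the component of \<open>v\<close> in this complement contributes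
to \<open>\<sigma> v\<close>.\<close>
lemma seminorm_le_inner_sum_of_rank:
  fixes \<sigma> :: "'a::euclidean_space \<Rightarrow> real"
  assumes \<sigma>: "is_seminorm \<sigma>" and L: "\<And>v. \<sigma> v \<le> L * norm v" "L \<ge> 0"
  obtains bs where "length bs = seminorm_rank \<sigma>" "\<And>b. b \<in> set bs \<Longrightarrow> norm b \<le> 1"
    "\<And>v. \<sigma> v \<le> L * inner_sum bs v"
proof -
  define Z where "Z = {v. \<sigma> v = 0}"
  have Z: "subspace Z" unfolding Z_def by (rule subspace_seminorm_kernel[OF \<sigma>])
  define W where "W = {y \<in> UNIV. \<forall>x\<in>Z. orthogonal x y}"
  have W: "subspace W" unfolding W_def by (simp add: subspace_orthogonal_to_vectors)
  have dW: "dim W = seminorm_rank \<sigma>"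
    using dim_subspace_orthogonal_to_vectors[OF Z subspace_UNIV] unfolding W_def
    by (simp add: seminorm_rank_def flip: Z_def)
  obtain bs where bs: "length bs = dim W" "set bs \<subseteq> W" "\<And>b. b \<in> set bs \<Longrightarrow> norm b = 1"
    "\<And>y. y \<in> W \<Longrightarrow> norm y \<le> inner_sum bs y" using orthonormal_list_subspace[OF W] by metis
  have "\<sigma> v \<le> L * inner_sum bs v" for v
  proof -
    obtain y z where yz: "y \<in> span Z" "\<And>w. w \<in> span Z \<Longrightarrow> orthogonal z w" "v = y + z"
      using orthogonal_subspace_decomp_exists by blast
    have y: "y \<in> Z" using yz(1) Z by (simp add: span_eq_iff[THEN iffD2])
    have z: "z \<in> W" using yz(2) by (auto simp: W_def span_base orthogonal_commute)
    have "inner_sum bs v = inner_sum bs z"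
      unfolding inner_sum_def
    proof (intro arg_cong[where f = sum_list] map_cong refl)
      fix b assume "b \<in> set bs"
      then have "b \<bullet> y = 0" using bs(2) y by (auto simp: W_def orthogonal_def inner_commute)
      then show "\<bar>b \<bullet> v\<bar> = \<bar>b \<bullet> z\<bar>" by (simp add: yz(3) inner_add_right)
    qed
    moreover have "\<sigma> v \<le> \<sigma> y + \<sigma> z" using \<sigma> yz(3) by (simp add: is_seminorm_def)
    then have "\<sigma> v \<le> L * norm z" using y L(1)[of z] by (simp add: Z_def)
    moreover have "L * norm z \<le> L * inner_sum bs z" using bs(4)[OF z] L(2) by (rule mult_left_mono)
    ultimately show ?thesis by simp
  qed
  then show ?thesis using that[of bs] bs dW by auto
qed

text \<open>The vectors form an orthonormal basis of the kernel of \<open>\<sigma>\<close>, so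
that the sum bounds the kernel component of \<open>v\<close>; on the orthogonal complement
\<open>\<sigma>\<close> is bounded below by compactness of the unit sphere.\<close>
lemma seminorm_ge_norm_minus_inner_sum:
  fixes \<sigma> :: "'a::euclidean_space \<Rightarrow> real"
  assumes \<sigma>: "is_seminorm \<sigma>" and L: "\<And>v. \<sigma> v \<le> L * norm v"
  obtains cs \<kappa> where "length cs = DIM('a) - seminorm_rank \<sigma>" "\<And>c. c \<in> set cs \<Longrightarrow> norm c \<le> 1"
    "\<kappa> > 0" "\<And>v. \<kappa> * norm v - inner_sum cs v \<le> \<sigma> v"
proof -
  define Z where "Z = {v. \<sigma> v = 0}"
  have Z: "subspace Z" unfolding Z_def by (rule subspace_seminorm_kernel[OF \<sigma>])
  define W where "W = {y \<in> UNIV. \<forall>x\<in>Z. orthogonal x y}"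
  have W: "subspace W" unfolding W_def by (simp add: subspace_orthogonal_to_vectors)
  have dZ: "dim Z = DIM('a) - seminorm_rank \<sigma>"
    using dim_subset_UNIV[of Z] by (simp add: seminorm_rank_def flip: Z_def)
  obtain cs where cs: "length cs = dim Z" "set cs \<subseteq> Z" "\<And>b. b \<in> set cs \<Longrightarrow> norm b = 1"
    "\<And>y. y \<in> Z \<Longrightarrow> norm y \<le> inner_sum cs y" using orthonormal_list_subspace[OF Z] by metis
  have cont: "continuous_on UNIV \<sigma>"
  proof -
    have "\<bar>\<sigma> x - \<sigma> y\<bar> \<le> \<bar>L\<bar> * norm (x - y)" for x y
      using is_seminorm_diff_le[OF \<sigma>, of x y] L[of "x - y"] mult_right_mono[OF abs_ge_self[of L], of "norm (x - y)"]
      by simp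
    then have "\<bar>L\<bar>-lipschitz_on UNIV \<sigma>" by (intro lipschitz_onI) (auto simp: dist_norm)
    then show ?thesis by (rule lipschitz_on_continuous_on)
  qed
  \<comment> \<open>\<open>\<kappa> \<le> 1\<close> lets the sum over \<open>cs\<close>, taken with coefficient one, absorb \<open>\<kappa>\<close> times the kernel component\<close>
  have "\<exists>\<kappa>. 0 < \<kappa> \<and> \<kappa> \<le> 1 \<and> (\<forall>z\<in>W. \<kappa> * norm z \<le> \<sigma> z)"
  proof (cases "W \<inter> sphere 0 1 = {}")
    case True
    have "z = 0" if "z \<in> W" for z
    proof (rule ccontr)
      assume "z \<noteq> 0"
      then have "z /\<^sub>R norm z \<in> W \<inter> sphere 0 1" using that W by (simp add: subspace_scale)
      then show False using True by blast
    qed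
    then have "1 * norm z \<le> \<sigma> z" if "z \<in> W" for z using is_seminorm_zero[OF \<sigma>] that by (metis mult_1 norm_zero order_refl)
    then show ?thesis by (intro exI[of _ 1]) auto
  next
    case False
    have "compact (W \<inter> sphere 0 1)" by (intro closed_Int_compact closed_subspace W compact_sphere)
    then obtain z0 where z0: "z0 \<in> W \<inter> sphere 0 1" "\<And>z. z \<in> W \<inter> sphere 0 1 \<Longrightarrow> \<sigma> z0 \<le> \<sigma> z"
      using continuous_attains_inf[OF _ False continuous_on_subset[OF cont]] by blast
    have pos: "\<sigma> z0 > 0"
    proof (rule ccontr)
      assume "\<not> ?thesis"
      then have "z0 \<in> Z" using is_seminorm_nonneg[OF \<sigma>, of z0] by (simp add: Z_def)
      then have "orthogonal z0 z0" using z0(1) by (auto simp: W_def)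
      then show False using z0(1) by (simp add: orthogonal_def)
    qed
    have "\<sigma> z0 * norm z \<le> \<sigma> z" if "z \<in> W" for z
    proof (cases "z = 0")
      case False
      then have "z /\<^sub>R norm z \<in> W \<inter> sphere 0 1" using that W by (simp add: subspace_scale)
      then have "\<sigma> z0 \<le> \<sigma> (z /\<^sub>R norm z)" by (rule z0(2))
      also have "\<dots> = \<bar>inverse (norm z)\<bar> * \<sigma> z" using \<sigma> unfolding is_seminorm_def by blast
      finally show ?thesis using False by (simp add: field_simps)
    qed (use is_seminorm_zero[OF \<sigma>] in simp)
    moreover have "min 1 (\<sigma> z0) * norm z \<le> \<sigma> z0 * norm z" for z :: 'a
      by (intro mult_right_mono) auto
    ultimately have "\<forall>z\<in>W. min 1 (\<sigma> z0) * norm z \<le> \<sigma> z" by (meson order.trans)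
    then show ?thesis using pos
      by (intro exI[of _ "min 1 (\<sigma> z0)"]) auto
  qed
  then obtain \<kappa> where \<kappa>: "0 < \<kappa>" "\<kappa> \<le> 1" "\<And>z. z \<in> W \<Longrightarrow> \<kappa> * norm z \<le> \<sigma> z" by blast
  have "\<kappa> * norm v - inner_sum cs v \<le> \<sigma> v" for v
  proof -
    obtain y z where yz: "y \<in> span Z" "\<And>w. w \<in> span Z \<Longrightarrow> orthogonal z w" "v = y + z"
      using orthogonal_subspace_decomp_exists by blast
    have y: "y \<in> Z" using yz(1) Z by (simp add: span_eq_iff[THEN iffD2])
    have z: "z \<in> W" using yz(2) by (auto simp: W_def span_base orthogonal_commute)
    have eq: "inner_sum cs v = inner_sum cs y"
      unfolding inner_sum_def
    proof (intro arg_cong[where f = sum_list] map_cong refl)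
      fix b assume "b \<in> set cs"
      then have "b \<bullet> z = 0" using cs(2) z by (auto simp: W_def orthogonal_def)
      then show "\<bar>b \<bullet> v\<bar> = \<bar>b \<bullet> y\<bar>" by (simp add: yz(3) inner_add_right)
    qed
    have "\<sigma> z \<le> \<sigma> v + \<sigma> (- y)"
      using \<sigma> yz(3) unfolding is_seminorm_def by (metis add_uminus_conv_diff add_diff_cancel_left')
    then have "\<sigma> z \<le> \<sigma> v" using y is_seminorm_uminus[OF \<sigma>] by (simp add: Z_def)
    moreover have "\<kappa> * norm v \<le> \<kappa> * norm y + \<kappa> * norm z"
      using \<kappa>(1) norm_triangle_ineq[of y z] by (simp add: yz(3) flip: distrib_left)
    moreover have "\<kappa> * norm y \<le> inner_sum cs v"
      using cs(4)[OF y] mult_left_le_one_le[OF norm_ge_zero less_imp_le[OF \<kappa>(1)] \<kappa>(2), of y] eq by linarith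
    ultimately show ?thesis using \<kappa>(3)[OF z] by linarith
  qed
  then show ?thesis using that[of cs \<kappa>] cs \<kappa>(1) dZ by auto
qed

lemma has_metric_derivativeD:
  assumes "has_metric_derivative g \<sigma> x" "e > 0"
  obtains d where "d > 0" "\<And>y. dist y x < d \<Longrightarrow> \<bar>dist (g y) (g x) - \<sigma> (y - x)\<bar> \<le> e * norm (y - x)"
proof -
  have \<sigma>: "is_seminorm \<sigma>" using assms by (simp add: has_metric_derivative_def)
  have "\<forall>\<^sub>F y in at x. dist ((dist (g y) (g x) - \<sigma> (y - x)) / norm (y - x)) 0 < e"
    using assms by (intro tendstoD) (auto simp: has_metric_derivative_def)
  then obtain d where d: "d > 0" "\<And>y. y \<noteq> x \<Longrightarrow> dist y x < d \<Longrightarrow> \<bar>(dist (g y) (g x) - \<sigma> (y - x)) / norm (y - x)\<bar> < e"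
    unfolding eventually_at by (auto simp: dist_real_def)
  have "\<bar>dist (g y) (g x) - \<sigma> (y - x)\<bar> \<le> e * norm (y - x)" if "dist y x < d" for y
  proof (cases "y = x")
    case False
    then have "norm (y - x) > 0" by simp
    then show ?thesis using d(2)[OF False that] by (simp add: field_simps)
  qed (simp add: is_seminorm_zero[OF \<sigma>])
  then show ?thesis using that d(1) by blast
qed

lemma has_metric_derivative_le_lipschitz:
  assumes md: "has_metric_derivative g \<sigma> x" and lip: "L-lipschitz_on UNIV g"
  shows "\<sigma> v \<le> L * norm v"
proof (rule field_le_epsilon)
  fix e :: real assume e: "e > 0"
  have \<sigma>: "is_seminorm \<sigma>" using md by (simp add: has_metric_derivative_def)
  have pos: "0 < 1 + norm v" by (simp add: add_pos_nonneg)
  define e' where "e' = e / (1 + norm v)"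
  have e': "e' > 0" "e' * norm v \<le> e" using e pos by (auto simp: e'_def field_simps)
  obtain d where d: "d > 0" "\<And>y. dist y x < d \<Longrightarrow> \<bar>dist (g y) (g x) - \<sigma> (y - x)\<bar> \<le> e' * norm (y - x)"
    using has_metric_derivativeD[OF md e'(1)] by blast
  define t where "t = d / (1 + norm v)"
  have t: "t > 0" "t * norm v < d" using d(1) pos by (auto simp: t_def field_simps)
  have "\<bar>dist (g (x + t *\<^sub>R v)) (g x) - \<sigma> (t *\<^sub>R v)\<bar> \<le> e' * (t * norm v)"
    using d(2)[of "x + t *\<^sub>R v"] t by (simp add: dist_norm)
  moreover have "\<sigma> (t *\<^sub>R v) = t * \<sigma> v" using \<sigma> t by (simp add: is_seminorm_def)
  moreover have "dist (g (x + t *\<^sub>R v)) (g x) \<le> L * (t * norm v)"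
    using lipschitz_onD[OF lip, of "x + t *\<^sub>R v" x] t by (simp add: dist_norm)
  ultimately have "t * \<sigma> v \<le> t * (L * norm v + e' * norm v)" by (simp add: algebra_simps)
  then have "\<sigma> v \<le> L * norm v + e' * norm v" using t(1) by simp
  then show "\<sigma> v \<le> L * norm v + e" using e'(2) by linarith
qed

section \<open>Estimates of the Hausdorff content\<close>

lemma diameter_le_metric:
  fixes S :: "'a::metric_space set"
  assumes "\<And>x y. x \<in> S \<Longrightarrow> y \<in> S \<Longrightarrow> dist x y \<le> \<delta>" "\<delta> \<ge> 0"
  shows "diameter S \<le> \<delta>"
proof (cases "S = {}")
  case False
  then have "(SUP (x, y)\<in>S \<times> S. dist x y) \<le> \<delta>"
    using assms(1) by (intro cSUP_least) auto
  then show ?thesis using False by (simp add: diameter_def)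
qed (use assms(2) in simp)

lemma bounded_of_dist_le:
  assumes "\<And>x y. x \<in> S \<Longrightarrow> y \<in> S \<Longrightarrow> dist x y \<le> \<delta>"
  shows "bounded S"
proof (cases "S = {}")
  case False
  then obtain x where "x \<in> S" by blast
  then have "\<forall>y\<in>S. dist x y \<le> \<delta>" using assms by blast
  then show ?thesis unfolding bounded_def by blast
qed simp

lemma hausdorff_content_le_sum:
  assumes "countable \<C>" "A \<subseteq> \<Union>\<C>" "\<And>B. B \<in> \<C> \<Longrightarrow> bounded B"
  shows "hausdorff_content n A \<le> (\<Sum>\<^sub>\<infinity>B\<in>\<C>. ennreal (unit_ball_vol (real n) / 2 ^ n * diameter B ^ n))"
  unfolding hausdorff_content_def using assms by (intro INF_lower) auto

lemma hausdorff_content_mono: "A \<subseteq> B \<Longrightarrow> hausdorff_content n A \<le> hausdorff_content n B"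
  unfolding hausdorff_content_def by (rule INF_superset_mono) auto

lemma hausdorff_content_le_card:
  fixes A :: "'a::metric_space set"
  assumes fin: "finite \<P>" and cov: "A \<subseteq> \<Union>\<P>" and \<delta>: "\<delta> \<ge> 0"
    and d: "\<And>P x y. P \<in> \<P> \<Longrightarrow> x \<in> P \<Longrightarrow> y \<in> P \<Longrightarrow> dist x y \<le> \<delta>"
  shows "hausdorff_content n A \<le> ennreal (real (card \<P>) * (unit_ball_vol (real n) / 2 ^ n * \<delta> ^ n))"
proof -
  have b: "bounded P" if "P \<in> \<P>" for P using d[OF that] by (rule bounded_of_dist_le)
  have dia: "diameter P \<le> \<delta>" if "P \<in> \<P>" for P using d[OF that] \<delta> by (rule diameter_le_metric)
  have "hausdorff_content n A \<le> (\<Sum>\<^sub>\<infinity>B\<in>\<P>. ennreal (unit_ball_vol (real n) / 2 ^ n * diameter B ^ n))"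
    using cov b by (intro hausdorff_content_le_sum countable_finite[OF fin])
  also have "\<dots> = (\<Sum>B\<in>\<P>. ennreal (unit_ball_vol (real n) / 2 ^ n * diameter B ^ n))"
    using fin by (rule infsum_finite)
  also have "\<dots> \<le> (\<Sum>B\<in>\<P>. ennreal (unit_ball_vol (real n) / 2 ^ n * \<delta> ^ n))"
    using dia b by (intro sum_mono ennreal_leI mult_left_mono power_mono diameter_ge_0) auto
  also have "\<dots> = ennreal (real (card \<P>) * (unit_ball_vol (real n) / 2 ^ n * \<delta> ^ n))"
    by (simp add: ennreal_mult'[symmetric] ennreal_of_nat_eq_real_of_nat)
  finally show ?thesis .
qed

lemma countable_dense_unit_ball:
  obtains D :: "'a::euclidean_space set" where "countable D" "D \<subseteq> cball 0 1" "cball 0 1 \<subseteq> closure D"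
proof -
  obtain E :: "'a set" where E: "countable E" "closure E = UNIV" using countable_dense_directions by blast
  have "ball 0 1 \<subseteq> closure (ball 0 1 \<inter> E)"
    using open_Int_closure_subset[OF open_ball, of 0 1 E] E(2) by simp
  then have "closure (ball 0 1) \<subseteq> closure (ball 0 1 \<inter> E)"
    by (intro closure_minimal closed_closure)
  then have "cball 0 1 \<subseteq> closure (ball 0 1 \<inter> E)" by (simp add: closure_ball)
  moreover have "countable (ball 0 1 \<inter> E)" using E(1) by simp
  moreover have "ball 0 1 \<inter> E \<subseteq> cball 0 1" by auto
  ultimately show ?thesis using that by blast
qed

section \<open>Small rank implies vanishing upper density\<close>

text \<open>On \<open>F\<close> the map varies, up to an error of relative size
\<open>e\<close>, only in the \<open>k\<close> directions of \<open>cs\<close>, and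
\<open>F\<close> comes within \<open>e * r\<close> of every point of the ball. Slabs of width
\<open>e * r\<close> cut the ball into at most \<open>(5 / e) ^ k\<close> pieces, whose images
have diameter at most a constant times \<open>e * r\<close>; the exponent \<open>k + 1\<close>
of the content leaves one factor \<open>e\<close>.\<close>
lemma hausdorff_content_image_ball_le:
  fixes g :: "'a::euclidean_space \<Rightarrow> 'b::metric_space"
  assumes lip: "L-lipschitz_on UNIV g"
    and cs: "length cs \<le> k" "\<And>c. c \<in> set cs \<Longrightarrow> norm c \<le> 1"
    and F: "closed F" "F \<noteq> {}"
      "\<And>p y. p \<in> F \<Longrightarrow> dist y p < \<delta> \<Longrightarrow> dist (g y) (g p) \<le> L * inner_sum cs (y - p) + e * norm (y - p)"
    and por: "\<And>z. dist z x < d \<Longrightarrow> infdist z F \<le> e * dist z x"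
    and e: "0 < e" "e \<le> 1" and r: "0 < r" "r \<le> d" "3 * r < \<delta>"
  shows "hausdorff_content (Suc k) (g ` ball x r)
     \<le> ennreal (5 ^ k * (L + 2 * L * real k + 3) ^ Suc k * e * (unit_ball_vol (real (Suc k)) * r ^ Suc k))"
proof -
  define n where "n = Suc k"
  have L0: "L \<ge> 0" using lip by (rule lipschitz_on_nonneg)
  define M where "M = L + 2 * L * real k + 3"
  have M0: "M \<ge> 0" using L0 by (simp add: M_def)
  have l: "dist (g y) (g w) \<le> L * dist y w" for y w using lipschitz_onD[OF lip] by simp
  have bd: "dist y z \<le> 2 * r" if "y \<in> ball x r" "z \<in> ball x r" for y z
    using that dist_triangle[of y z x] by (simp add: dist_commute)
  obtain \<P> where P: "finite \<P>" "real (card \<P>) \<le> (2 * (2 * r) / (e * r) + 1) ^ length cs" "\<Union>\<P> = ball x r"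
    "\<And>P y z c. P \<in> \<P> \<Longrightarrow> y \<in> P \<Longrightarrow> z \<in> P \<Longrightarrow> c \<in> set cs \<Longrightarrow> \<bar>c \<bullet> (y - z)\<bar> \<le> e * r"
    using slab_partition[of cs "ball x r" "2 * r" "e * r"] cs(2) bd e r(1) by auto
  have close: "dist (g z) (g z') \<le> e * r * M" if zz: "P \<in> \<P>" "z \<in> P" "z' \<in> P" for P z z'
  proof -
    have zb: "z \<in> ball x r" "z' \<in> ball x r" using P(3) zz by auto
    have "infdist z F \<le> e * dist z x" using zb r by (intro por) (auto simp: dist_commute)
    also have "\<dots> \<le> e * r" using zb e by (intro mult_left_mono) (auto simp: dist_commute)
    finally obtain p where p: "p \<in> F" "dist z p \<le> e * r"
      using infdist_attains_inf[OF F(1,2), of z] by metis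
    have er: "e * r \<le> r" using e r by simp
    have z'p: "norm (z' - p) \<le> 3 * r"
      using bd[OF zb(2,1)] p(2) er dist_triangle[of z' p z] by (simp add: dist_norm)
    have "dist (g z') (g p) \<le> L * inner_sum cs (z' - p) + e * norm (z' - p)"
      using z'p r(3) p(1) by (intro F(3)) (auto simp: dist_norm)
    moreover have "inner_sum cs (z' - p) \<le> real (length cs) * (2 * (e * r))"
    proof (rule inner_sum_le)
      fix c assume c: "c \<in> set cs"
      have "\<bar>c \<bullet> (z - p)\<bar> \<le> norm c * norm (z - p)" by (rule Cauchy_Schwarz_ineq2)
      also have "\<dots> \<le> 1 * (e * r)" using cs(2)[OF c] p(2) by (intro mult_mono) (auto simp: dist_norm)
      finally have "\<bar>c \<bullet> (z - p)\<bar> \<le> e * r" by simp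
      moreover have "\<bar>c \<bullet> (z' - z)\<bar> \<le> e * r" using P(4)[OF zz(1,3,2) c] .
      moreover have "c \<bullet> (z' - p) = c \<bullet> (z' - z) + c \<bullet> (z - p)" by (simp add: inner_diff_right)
      ultimately show "\<bar>c \<bullet> (z' - p)\<bar> \<le> 2 * (e * r)" by linarith
    qed
    then have "L * inner_sum cs (z' - p) \<le> L * (real k * (2 * (e * r)))"
      using cs(1) e r L0 by (intro mult_left_mono order.trans[OF _ mult_right_mono[of "real (length cs)" "real k"]]) auto
    moreover have "e * norm (z' - p) \<le> e * (3 * r)" using z'p e by (intro mult_left_mono) auto
    moreover have "dist (g z) (g p) \<le> L * (e * r)"
      using l[of z p] p(2) L0 by (meson mult_left_mono order.trans)
    moreover have "dist (g z) (g z') \<le> dist (g z) (g p) + dist (g z') (g p)" by (rule dist_triangle2)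
    ultimately have "dist (g z) (g z') \<le> L * (e * r) + L * (real k * (2 * (e * r))) + e * (3 * r)" by linarith
    also have "\<dots> = e * r * M" by (simp add: M_def algebra_simps)
    finally show ?thesis .
  qed
  have "hausdorff_content n (g ` ball x r)
      \<le> ennreal (real (card ((`) g ` \<P>)) * (unit_ball_vol (real n) / 2 ^ n * (e * r * M) ^ n))"
  proof (rule hausdorff_content_le_card)
    show "g ` ball x r \<subseteq> \<Union> ((`) g ` \<P>)" using P(3) by blast
  qed (use P(1) close M0 e r in auto)
  also have "\<dots> \<le> ennreal ((5 / e) ^ k * (unit_ball_vol (real n) * (e * r * M) ^ n))"
  proof (intro ennreal_leI mult_mono)
    have "real (card ((`) g ` \<P>)) \<le> real (card \<P>)" using P(1) by (simp add: card_image_le)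
    also have "\<dots> \<le> (4 / e + 1) ^ length cs" using P(2) r(1) by simp
    also have "\<dots> \<le> (5 / e) ^ length cs" using e by (intro power_mono) (auto simp: field_simps)
    also have "\<dots> \<le> (5 / e) ^ k" using e cs(1) by (intro power_increasing) (auto simp: field_simps)
    finally show "real (card ((`) g ` \<P>)) \<le> (5 / e) ^ k" .
    have "unit_ball_vol (real n) / 2 ^ n \<le> unit_ball_vol (real n) / 1"
      by (intro divide_left_mono) (auto simp: unit_ball_vol_nonneg)
    then show "unit_ball_vol (real n) / 2 ^ n \<le> unit_ball_vol (real n)" by simp
  qed (use e r M0 in auto)
  also have "(5 / e) ^ k * (unit_ball_vol (real n) * (e * r * M) ^ n)
      = 5 ^ k * M ^ n * e * (unit_ball_vol (real n) * r ^ n)"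
    using e by (simp add: n_def power_mult_distrib power_divide field_simps)
  finally show ?thesis by (simp only: n_def M_def)
qed

text \<open>The sets \<open>F cs i j\<close> are indexed by countably many lists
\<open>cs\<close>, scales \<open>1 / (i + 1)\<close> and errors \<open>1 / (j + 1)\<close>, so
almost every point is a point of non-porosity of each of these sets that contains it.\<close>
lemma AE_upper_density_zero_of_rank:
  fixes g :: "'a::euclidean_space \<Rightarrow> 'b::metric_space"
  assumes lip: "L-lipschitz_on UNIV g" and n: "n \<ge> 1"
  shows "AE x in lebesgue. \<forall>\<sigma>. has_metric_derivative g \<sigma> x \<and> seminorm_rank \<sigma> \<le> n - 1 \<longrightarrow> upper_density n g x = 0"
proof -
  obtain k where nk: "n = Suc k" using n by (cases n) auto
  have L0: "L \<ge> 0" using lip by (rule lipschitz_on_nonneg)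
  have cont: "continuous_on UNIV g" using lip by (rule lipschitz_on_continuous_on)
  obtain D :: "'a set" where D: "countable D" "D \<subseteq> cball 0 1" "cball 0 1 \<subseteq> closure D"
    using countable_dense_unit_ball by blast
  define F where "F cs i j = {x. \<forall>y. dist y x < inverse (real (Suc i)) \<longrightarrow>
      dist (g y) (g x) \<le> L * inner_sum cs (y - x) + inverse (real (Suc j)) * norm (y - x)}" for cs i j
  have clF: "closed (F cs i j)" for cs i j
    unfolding F_def
    by (intro closed_Collect_all closed_Collect_imp open_Collect_less closed_Collect_le continuous_intros cont)
  have "AE x in lebesgue. \<forall>cs\<in>lists D. \<forall>i j. x \<in> F cs i j \<longrightarrow>
      (\<forall>e>0. \<exists>d>0. \<forall>z. dist z x < d \<longrightarrow> infdist z (F cs i j) \<le> e * dist z x)"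
    by (intro AE_ball_countable[THEN iffD2] ballI AE_all_countable[THEN iffD2] allI AE_not_porous clF
        countable_lists D(1))
  then show ?thesis
  proof eventually_elim
    case (elim x)
    show ?case
    proof (intro allI impI, elim conjE)
      fix \<sigma> assume md: "has_metric_derivative g \<sigma> x" and rank: "seminorm_rank \<sigma> \<le> n - 1"
      have \<sigma>: "is_seminorm \<sigma>" using md by (simp add: has_metric_derivative_def)
      obtain bs where bs: "length bs = seminorm_rank \<sigma>" "\<And>b. b \<in> set bs \<Longrightarrow> norm b \<le> 1"
        "\<And>v. \<sigma> v \<le> L * inner_sum bs v"
        using seminorm_le_inner_sum_of_rank[OF \<sigma> has_metric_derivative_le_lipschitz[OF md lip] L0] by blast
      define C where "C = 5 ^ k * (L + 2 * L * real k + 3) ^ Suc k"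
      have C0: "C \<ge> 0" using L0 by (simp add: C_def)
      have bound: "upper_density n g x \<le> ennreal (C * inverse (real (Suc j)))" for j
      proof -
        define e where "e = inverse (real (Suc j))"
        have e: "0 < e" "e \<le> 1" by (auto simp: e_def inverse_le_1_iff)
        \<comment> \<open>\<open>\<tau>\<close> is small enough for the replacement of \<open>bs\<close> by \<open>cs\<close> to cost at most \<open>e / 2 * norm (y - x)\<close>\<close>
        define M where "M = L * real (length bs) + 1"
        define \<tau> where "\<tau> = (e / 2) / M"
        have L1: "M > 0" unfolding M_def using L0 by (simp add: add_nonneg_pos)
        have \<tau>: "\<tau> > 0" using L1 e(1) by (simp add: \<tau>_def)
        have \<tau>L: "L * (real (length bs) * \<tau>) \<le> e / 2"
        proof -
          have "L * (real (length bs) * \<tau>) \<le> M * \<tau>"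
            using \<tau> by (simp add: M_def algebra_simps)
          also have "\<dots> = e / 2" using L1 by (simp add: \<tau>_def)
          finally show ?thesis .
        qed
        obtain cs where cs: "cs \<in> lists D" "list_all2 (\<lambda>c b. dist c b \<le> \<tau>) cs bs"
          using list_approximation[of bs D \<tau>] bs(2) D(3) \<tau> by (auto simp: subset_iff)
        have len: "length cs = length bs" using cs(2) by (rule list_all2_lengthD)
        obtain d1 where d1: "d1 > 0" "\<And>y. dist y x < d1 \<Longrightarrow> \<bar>dist (g y) (g x) - \<sigma> (y - x)\<bar> \<le> e / 2 * norm (y - x)"
          using has_metric_derivativeD[OF md, of "e / 2"] e by auto
        obtain i where i: "inverse (real (Suc i)) < d1" using reals_Archimedean[OF d1(1)] by blast
        have xF: "x \<in> F cs i j"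
          unfolding F_def e_def[symmetric]
        proof (intro CollectI allI impI)
          fix y assume y: "dist y x < inverse (real (Suc i))"
          have "dist (g y) (g x) \<le> \<sigma> (y - x) + e / 2 * norm (y - x)"
            using d1(2)[OF order.strict_trans[OF y i]] by linarith
          moreover have "L * inner_sum bs (y - x) \<le> L * (inner_sum cs (y - x) + real (length bs) * \<tau> * norm (y - x))"
            using inner_sum_perturb[OF cs(2), of "y - x"] L0 len by (intro mult_left_mono) auto
          then have "L * inner_sum bs (y - x) \<le> L * inner_sum cs (y - x) + (L * (real (length bs) * \<tau>)) * norm (y - x)"
            by (simp add: algebra_simps)
          moreover have "(L * (real (length bs) * \<tau>)) * norm (y - x) \<le> e / 2 * norm (y - x)"
            using \<tau>L by (intro mult_right_mono) auto
          ultimately show "dist (g y) (g x) \<le> L * inner_sum cs (y - x) + e * norm (y - x)"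
            using bs(3)[of "y - x"] by (simp add: algebra_simps)
        qed
        obtain d where d: "d > 0" "\<And>z. dist z x < d \<Longrightarrow> infdist z (F cs i j) \<le> e * dist z x"
          using elim cs(1) xF e(1) by blast
        have main: "hausdorff_content n (g ` ball x r) \<le> ennreal (C * e * (unit_ball_vol (real n) * r ^ n))"
          if r: "0 < r" "r < min d (inverse (real (Suc i)) / 4)" for r
          unfolding nk C_def
        proof (rule hausdorff_content_image_ball_le[OF lip _ _ clF _ _ d(2)])
          show "length cs \<le> k" using len bs(1) rank nk by simp
          show "norm c \<le> 1" if "c \<in> set cs" for c using that cs(1) D(2) by (auto simp: subset_iff)
          show "F cs i j \<noteq> {}" using xF by blast
          show "dist (g y) (g p) \<le> L * inner_sum cs (y - p) + e * norm (y - p)"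
            if "p \<in> F cs i j" "dist y p < inverse (real (Suc i))" for p y
            using that unfolding F_def e_def by blast
          show "3 * r < inverse (real (Suc i))" using r by auto
        qed (use e r in auto)
        show ?thesis
          unfolding upper_density_def e_def[symmetric]
        proof (rule Limsup_bounded)
          have "hausdorff_content n (g ` ball x r) / ennreal (unit_ball_vol (real n) * r ^ n) \<le> ennreal (C * e)"
            if r: "0 < r" "r < min d (inverse (real (Suc i)) / 4)" for r
          proof -
            have pos: "unit_ball_vol (real n) * r ^ n > 0" using r by simp
            have "hausdorff_content n (g ` ball x r) / ennreal (unit_ball_vol (real n) * r ^ n)
              \<le> ennreal (C * e * (unit_ball_vol (real n) * r ^ n)) / ennreal (unit_ball_vol (real n) * r ^ n)"
              by (intro divide_right_mono_ennreal main r)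
            also have "\<dots> = ennreal (C * e)"
              using pos C0 e divide_ennreal[of "C * e * W" W for W]
              by (metis less_imp_le mult_nonneg_nonneg nonzero_mult_div_cancel_right not_less)
            finally show ?thesis .
          qed
          then show "\<forall>\<^sub>F r in at_right 0. hausdorff_content n (g ` ball x r) / ennreal (unit_ball_vol (real n) * r ^ n) \<le> ennreal (C * e)"
            unfolding eventually_at_right_field using d(1)
            by (intro exI[of _ "min d (inverse (real (Suc i)) / 4)"]) auto
        qed
      qed
      have "(\<lambda>j. ennreal (C * inverse (real (Suc j)))) \<longlonglongrightarrow> ennreal (C * 0)"
        by (intro tendsto_ennrealI tendsto_mult tendsto_const LIMSEQ_inverse_real_of_nat)
      then have "upper_density n g x \<le> 0"
        using bound by (intro LIMSEQ_le_const[of _ 0]) auto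
      then show "upper_density n g x = 0" by simp
    qed
  qed
qed

section \<open>Dyadic cubes and vanishing lower density\<close>

text \<open>The minimum assigns points of the upper faces of the unit cube to the last dyadic
cubes inside it, so that at every level each point of the closed unit cube receives a dyadic
cube contained in the unit cube.\<close>
definition cube_index :: "nat \<Rightarrow> real ^ 'k \<Rightarrow> int ^ 'k" where
  "cube_index j x = (\<chi> i. min \<lfloor>x $ i * 2 ^ j\<rfloor> (2 ^ j - 1))"

definition dyadic_box :: "nat \<Rightarrow> int ^ 'k \<Rightarrow> (real ^ 'k) set" where
  "dyadic_box j z = cbox (\<chi> i. of_int (z $ i) / 2 ^ j) (\<chi> i. (of_int (z $ i) + 1) / 2 ^ j)"

text \<open>Dyadic cubes are nested: the index at a finer level determines the index at a
coarser level.\<close>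
lemma cube_index_coarser:
  assumes "j \<le> j'"
  shows "cube_index j x = (\<chi> i. cube_index j' x $ i div 2 ^ (j' - j))"
proof -
  define p where "p = (2::int) ^ (j' - j)"
  have p: "p > 0" by (simp add: p_def)
  have pj: "(2::int) ^ j' = 2 ^ j * p" using assms by (simp add: p_def flip: power_add)
  have pr: "(2::real) ^ j' = 2 ^ j * real_of_int p" using assms by (simp add: p_def flip: power_add)
  have "min \<lfloor>x $ i * 2 ^ j\<rfloor> (2 ^ j - 1) = min \<lfloor>x $ i * 2 ^ j'\<rfloor> (2 ^ j' - 1) div p" for i
  proof -
    have "x $ i * 2 ^ j = x $ i * 2 ^ j' / real_of_int p"
      using p by (simp add: pr)
    then have 1: "\<lfloor>x $ i * 2 ^ j\<rfloor> = \<lfloor>x $ i * 2 ^ j'\<rfloor> div p"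
      using p by (simp add: floor_divide_real_eq_div)
    have 2: "(2 ^ j' - 1) div p = 2 ^ j - (1::int)"
    proof -
      have "(2::int) ^ j' - 1 = (p - 1) + (2 ^ j - 1) * p" by (simp add: pj algebra_simps)
      then have "(2 ^ j' - 1) div p = ((p - 1) + (2 ^ j - 1) * p) div p" by (simp only:)
      also have "\<dots> = (2 ^ j - 1) + (p - 1) div p" using p by (intro div_mult_self1) simp
      also have "(p - 1) div p = 0" using p by (intro div_pos_pos_trivial) auto
      finally show ?thesis by simp
    qed
    have "mono (\<lambda>a::int. a div p)" using p by (intro monoI zdiv_mono1) auto
    from min_of_mono[OF this] show ?thesis unfolding 1 2[symmetric] by simp
  qed
  then show ?thesis by (simp add: cube_index_def p_def vec_eq_iff)
qed

lemma mem_dyadic_box_cube_index: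
  assumes "x \<in> unit_cube"
  shows "x \<in> dyadic_box j (cube_index j x)"
proof -
  have x: "0 \<le> x $ i" "x $ i \<le> 1" for i using assms by (auto simp: mem_box_cart)
  have "real_of_int (min \<lfloor>x $ i * 2 ^ j\<rfloor> (2 ^ j - 1)) / 2 ^ j \<le> x $ i" for i
  proof -
    have "real_of_int (min \<lfloor>x $ i * 2 ^ j\<rfloor> (2 ^ j - 1)) \<le> x $ i * 2 ^ j" by linarith
    then show ?thesis by (simp add: field_simps)
  qed
  moreover have "x $ i \<le> (real_of_int (min \<lfloor>x $ i * 2 ^ j\<rfloor> (2 ^ j - 1)) + 1) / 2 ^ j" for i
  proof -
    have "x $ i * 2 ^ j \<le> 2 ^ j" using x[of i] by simp
    then have "x $ i * 2 ^ j \<le> real_of_int (min \<lfloor>x $ i * 2 ^ j\<rfloor> (2 ^ j - 1)) + 1"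
      by (simp add: min_def)
    then show ?thesis by (simp add: field_simps)
  qed
  ultimately show ?thesis by (simp add: dyadic_box_def cube_index_def mem_box_cart)
qed

lemma dyadic_box_cube_index_subset:
  assumes "x \<in> unit_cube"
  shows "dyadic_box j (cube_index j x) \<subseteq> unit_cube"
proof
  fix y assume y: "y \<in> dyadic_box j (cube_index j x)"
  have x: "0 \<le> x $ i" for i using assms by (auto simp: mem_box_cart)
  have "0 \<le> y $ i \<and> y $ i \<le> 1" for i
  proof -
    define z where "z = min \<lfloor>x $ i * 2 ^ j\<rfloor> (2 ^ j - 1)"
    have "0 \<le> z" using x[of i] by (simp add: z_def)
    then have z0: "0 \<le> real_of_int z" by simp
    have "z + 1 \<le> 2 ^ j" by (simp add: z_def)
    then have "real_of_int (z + 1) \<le> real_of_int (2 ^ j)" by (simp only: of_int_le_iff)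
    then have z1: "real_of_int z + 1 \<le> 2 ^ j" by simp
    have "real_of_int z / 2 ^ j \<le> y $ i" "y $ i \<le> (real_of_int z + 1) / 2 ^ j"
      using y by (auto simp: dyadic_box_def cube_index_def mem_box_cart z_def)
    moreover have "0 \<le> real_of_int z / 2 ^ j" using z0 by simp
    moreover have "(real_of_int z + 1) / 2 ^ j \<le> 1" using z1 by simp
    ultimately show ?thesis by linarith
  qed
  then show "y \<in> unit_cube" by (simp add: mem_box_cart)
qed

lemma cube_index_interior:
  assumes "y \<in> interior (dyadic_box j (cube_index j x))"
  shows "cube_index j y = cube_index j x"
proof -
  have "\<lfloor>y $ i * 2 ^ j\<rfloor> = cube_index j x $ i \<and> cube_index j x $ i \<le> 2 ^ j - 1" for i
  proof
    define z where "z = cube_index j x $ i"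
    have "real_of_int z / 2 ^ j < y $ i" "y $ i < (real_of_int z + 1) / 2 ^ j"
      using assms by (auto simp: dyadic_box_def interior_cbox mem_box_cart z_def)
    then have "real_of_int z < y $ i * 2 ^ j" "y $ i * 2 ^ j < real_of_int z + 1"
      by (auto simp: field_simps)
    then show "\<lfloor>y $ i * 2 ^ j\<rfloor> = z" by linarith
    show "cube_index j x $ i \<le> 2 ^ j - 1" by (simp add: cube_index_def)
  qed
  then show ?thesis by (simp add: vec_eq_iff cube_index_def[of j y])
qed

lemma dyadic_box_size:
  fixes z :: "int ^ 'k"
  shows "diameter (dyadic_box j z) = sqrt (real CARD('k)) / 2 ^ j"
    and "emeasure lborel (dyadic_box j z) = ennreal ((1 / 2 ^ j) ^ CARD('k))"
    and "emeasure lborel (interior (dyadic_box j z)) = ennreal ((1 / 2 ^ j) ^ CARD('k))"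
proof -
  define a b :: "real ^ 'k" where "a = (\<chi> i. of_int (z $ i) / 2 ^ j)" and "b = (\<chi> i. (of_int (z $ i) + 1) / 2 ^ j)"
  have ba: "b - a = (\<chi> i. 1 / 2 ^ j)" by (simp add: a_def b_def vec_eq_iff flip: diff_divide_distrib)
  have le: "a \<bullet> i \<le> b \<bullet> i" if "i \<in> Basis" for i
    using that by (auto simp: Basis_vec_def inner_axis a_def b_def divide_right_mono)
  have Q: "dyadic_box j z = cbox a b" by (simp add: dyadic_box_def a_def b_def)
  have "dist a b = norm (b - a)" by (simp add: dist_norm norm_minus_commute)
  also have "\<dots> = sqrt (\<Sum>i\<in>(UNIV::'k set). (1 / 2 ^ j)\<^sup>2)" unfolding ba by (simp add: norm_vec_def L2_set_def)
  also have "\<dots> = sqrt (real CARD('k)) / 2 ^ j" by (simp add: real_sqrt_mult real_sqrt_divide power_divide)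
  finally show "diameter (dyadic_box j z) = sqrt (real CARD('k)) / 2 ^ j"
    unfolding Q using le by (simp add: diameter_cbox)
  have prod: "(\<Prod>i\<in>Basis. (b - a) \<bullet> i) = (1 / 2 ^ j) ^ CARD('k)"
  proof -
    have "(\<Prod>i\<in>Basis. (b - a) \<bullet> i) = (\<Prod>i\<in>(Basis::(real ^ 'k) set). (1 / 2 ^ j))"
      unfolding ba by (intro prod.cong) (auto simp: Basis_vec_def inner_axis)
    then show ?thesis by simp
  qed
  show "emeasure lborel (dyadic_box j z) = ennreal ((1 / 2 ^ j) ^ CARD('k))"
    unfolding Q using le by (subst emeasure_lborel_cbox) (auto simp: prod)
  show "emeasure lborel (interior (dyadic_box j z)) = ennreal ((1 / 2 ^ j) ^ CARD('k))"
    unfolding Q interior_cbox using le by (subst emeasure_lborel_box) (auto simp: prod)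
qed

lemma dyadic_box_diameter_power:
  fixes z :: "int ^ 'k"
  shows "ennreal (diameter (dyadic_box j z) ^ CARD('k))
    = ennreal (sqrt (real CARD('k)) ^ CARD('k)) * emeasure lborel (dyadic_box j z)"
  by (simp add: dyadic_box_size ennreal_mult'[symmetric] power_divide)

text \<open>For each point the largest good cube among those given by \<open>cube_index\<close>
is selected. By nestedness, two selected cubes whose interiors meet coincide, so the volumes of
the selected cubes add up to at most the volume of \<open>U\<close>.\<close>
lemma maximal_dyadic_cover:
  fixes S :: "(real ^ 'k) set"
  assumes S: "S \<subseteq> unit_cube"
    and good: "\<And>x. x \<in> S \<Longrightarrow> \<exists>j. Good (dyadic_box j (cube_index j x))"
    and U: "U \<in> sets borel" "\<And>Q. Good Q \<Longrightarrow> Q \<subseteq> U"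
  shows "\<exists>\<Q>. countable \<Q> \<and> S \<subseteq> \<Union>\<Q> \<and>
      (\<forall>Q\<in>\<Q>. Good Q \<and> Q \<subseteq> unit_cube \<and> (\<exists>j z. Q = dyadic_box j z)) \<and>
      (\<Sum>\<^sub>\<infinity>Q\<in>\<Q>. emeasure lborel Q) \<le> emeasure lborel U"
proof -
  define J where "J x = (LEAST j. Good (dyadic_box j (cube_index j x)))" for x
  define cube where "cube x = dyadic_box (J x) (cube_index (J x) x)" for x
  define \<Q> where "\<Q> = cube ` S"
  have gd: "Good (cube x)" if "x \<in> S" for x
    using good[OF that] unfolding cube_def J_def by (rule LeastI_ex)
  have box: "\<exists>j z. Q = dyadic_box j z" if "Q \<in> \<Q>" for Q
    using that by (auto simp: \<Q>_def cube_def)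
  have "\<Q> \<subseteq> range (\<lambda>(j, z). dyadic_box j z)" by (auto simp: \<Q>_def cube_def)
  then have cnt: "countable \<Q>" by (rule countable_subset) simp
  have same: "cube x = cube x'"
    if le: "J x \<le> J x'" and xx: "x \<in> S" "x' \<in> S" and y: "y \<in> interior (cube x)" "y \<in> interior (cube x')" for x x' y
  proof -
    have 1: "cube_index (J x) y = cube_index (J x) x"
      using y(1) unfolding cube_def by (rule cube_index_interior)
    have 2: "cube_index (J x') y = cube_index (J x') x'"
      using y(2) unfolding cube_def by (rule cube_index_interior)
    have eq: "cube_index (J x) x' = cube_index (J x) x"
      using cube_index_coarser[OF le, of x'] cube_index_coarser[OF le, of y] 1 2 by simp
    then have "Good (dyadic_box (J x) (cube_index (J x) x'))" using gd[OF xx(1)] by (simp add: cube_def)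
    then have "J x' \<le> J x" unfolding J_def[of x'] by (rule Least_le)
    then have "J x = J x'" using le by simp
    then show ?thesis using eq by (simp add: cube_def)
  qed
  have disj: "disjoint_family_on interior \<Q>"
    unfolding disjoint_family_on_def
  proof (intro ballI impI, rule ccontr)
    fix Q Q' assume Q: "Q \<in> \<Q>" "Q' \<in> \<Q>" "Q \<noteq> Q'" "interior Q \<inter> interior Q' \<noteq> {}"
    then obtain x x' y where xx: "x \<in> S" "x' \<in> S" "Q = cube x" "Q' = cube x'" "y \<in> interior (cube x)" "y \<in> interior (cube x')"
      by (auto simp: \<Q>_def)
    then show False using same[of x x' y] same[of x' x y] Q(3) by (metis nle_le)
  qed
  have "(\<Sum>\<^sub>\<infinity>Q\<in>\<Q>. emeasure lborel Q) = (\<Sum>\<^sub>\<infinity>Q\<in>\<Q>. emeasure lborel (interior Q))"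
  proof (rule infsum_cong)
    fix Q assume "Q \<in> \<Q>"
    then show "emeasure lborel Q = emeasure lborel (interior Q)"
      using box by (metis dyadic_box_size(2,3))
  qed
  also have "\<dots> \<le> emeasure lborel U"
  proof (rule infsum_emeasure_disjoint_le[OF disj])
    fix Q assume "Q \<in> \<Q>"
    then have "Good Q" using gd by (auto simp: \<Q>_def)
    then show "interior Q \<subseteq> U" using U(2) interior_subset by blast
  qed (use U(1) in auto)
  finally have sum: "(\<Sum>\<^sub>\<infinity>Q\<in>\<Q>. emeasure lborel Q) \<le> emeasure lborel U" .
  have cov: "S \<subseteq> \<Union>\<Q>"
    using mem_dyadic_box_cube_index S by (fastforce simp: \<Q>_def cube_def)
  have "Good Q \<and> Q \<subseteq> unit_cube \<and> (\<exists>j z. Q = dyadic_box j z)" if "Q \<in> \<Q>" for Q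
    using that gd box[OF that] dyadic_box_cube_index_subset S by (auto simp: \<Q>_def cube_def)
  with cnt cov sum show ?thesis by blast
qed

lemma dyadic_box_subset_ball:
  fixes x :: "real ^ 'k"
  assumes "x \<in> unit_cube" "sqrt (real CARD('k)) / 2 ^ j < r"
  shows "dyadic_box j (cube_index j x) \<subseteq> ball x r"
proof
  fix y assume y: "y \<in> dyadic_box j (cube_index j x)"
  have "dist x y \<le> diameter (dyadic_box j (cube_index j x))"
    using y mem_dyadic_box_cube_index[OF assms(1), of j]
    by (intro diameter_bounded_bound) (auto simp: dyadic_box_def)
  then show "y \<in> ball x r" using assms(2) by (simp add: dyadic_box_size)
qed

lemma hausdorff_content_image_lipschitz_le:
  fixes f :: "'a::metric_space \<Rightarrow> 'b::metric_space"
  assumes "L-lipschitz_on S f" "bounded S"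
  shows "hausdorff_content n (f ` S) \<le> ennreal (unit_ball_vol (real n) * L ^ n * diameter S ^ n)"
proof -
  have L0: "L \<ge> 0" using assms(1) by (rule lipschitz_on_nonneg)
  have d0: "diameter S \<ge> 0" using assms(2) by (rule diameter_ge_0)
  have "hausdorff_content n (f ` S)
      \<le> ennreal (real (card {f ` S}) * (unit_ball_vol (real n) / 2 ^ n * (L * diameter S) ^ n))"
  proof (rule hausdorff_content_le_card)
    fix P x y assume "P \<in> {f ` S}" "x \<in> P" "y \<in> P"
    then obtain a b where ab: "a \<in> S" "b \<in> S" "x = f a" "y = f b" by auto
    then have "dist x y \<le> L * dist a b" using lipschitz_onD[OF assms(1)] by simp
    also have "\<dots> \<le> L * diameter S"
      using ab assms(2) L0 by (intro mult_left_mono diameter_bounded_bound) auto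
    finally show "dist x y \<le> L * diameter S" .
  qed (use L0 d0 in auto)
  also have "\<dots> \<le> ennreal (unit_ball_vol (real n) * L ^ n * diameter S ^ n)"
  proof (intro ennreal_leI)
    have "unit_ball_vol (real n) / 2 ^ n \<le> unit_ball_vol (real n) / 1"
      by (intro divide_left_mono) (auto simp: unit_ball_vol_nonneg)
    then have "unit_ball_vol (real n) / 2 ^ n * (L * diameter S) ^ n \<le> unit_ball_vol (real n) * (L * diameter S) ^ n"
      using L0 d0 by (intro mult_right_mono) auto
    then show "real (card {f ` S}) * (unit_ball_vol (real n) / 2 ^ n * (L * diameter S) ^ n)
        \<le> unit_ball_vol (real n) * L ^ n * diameter S ^ n"
      by (simp add: power_mult_distrib)
  qed
  finally show ?thesis .
qed

text \<open>For a cube, \<open>diameter Q ^ (n + m)\<close> is a constant multiple of its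
volume, so that sums over non-overlapping cubes are controlled by the volume they fill.\<close>
lemma sum_dyadic_contents_le:
  fixes f :: "real ^ 'k \<Rightarrow> 'b::metric_space"
  assumes dim: "CARD('k) = n + m" and c: "c \<ge> 0"
    and Q: "\<And>Q. Q \<in> \<Q> \<Longrightarrow> hausdorff_content n (f ` Q) \<le> ennreal (c * diameter Q ^ n) \<and> (\<exists>j z. Q = dyadic_box j z)"
    and sum: "(\<Sum>\<^sub>\<infinity>Q\<in>\<Q>. emeasure lborel Q) \<le> ennreal v" and v: "v \<ge> 0"
  shows "(\<Sum>\<^sub>\<infinity>Q\<in>\<Q>. hausdorff_content n (f ` Q) * ennreal (diameter Q ^ m))
      \<le> ennreal (c * sqrt (real CARD('k)) ^ CARD('k) * v)"
proof -
  let ?N = "CARD('k)"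
  have "(\<Sum>\<^sub>\<infinity>Q\<in>\<Q>. hausdorff_content n (f ` Q) * ennreal (diameter Q ^ m))
      \<le> (\<Sum>\<^sub>\<infinity>Q\<in>\<Q>. ennreal (c * sqrt (real ?N) ^ ?N) * emeasure lborel Q)"
  proof (rule infsum_mono)
    fix Q assume "Q \<in> \<Q>"
    then obtain j z where jz: "Q = dyadic_box j z" and h: "hausdorff_content n (f ` Q) \<le> ennreal (c * diameter Q ^ n)"
      using Q by blast
    have d0: "diameter Q \<ge> 0" by (simp add: jz dyadic_box_size)
    have "hausdorff_content n (f ` Q) * ennreal (diameter Q ^ m)
        \<le> ennreal (c * diameter Q ^ n) * ennreal (diameter Q ^ m)"
      using h by (rule mult_right_mono) simp
    also have "\<dots> = ennreal c * ennreal (diameter Q ^ ?N)"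
      using c d0 by (simp add: dim power_add ennreal_mult'[symmetric] mult.assoc)
    also have "\<dots> = ennreal (c * sqrt (real ?N) ^ ?N) * emeasure lborel Q"
      unfolding jz dyadic_box_diameter_power using c by (simp add: ennreal_mult' mult.assoc)
    finally show "hausdorff_content n (f ` Q) * ennreal (diameter Q ^ m)
        \<le> ennreal (c * sqrt (real ?N) ^ ?N) * emeasure lborel Q" .
  qed (auto intro: nonneg_summable_on_complete)
  also have "\<dots> = ennreal (c * sqrt (real ?N) ^ ?N) * (\<Sum>\<^sub>\<infinity>Q\<in>\<Q>. emeasure lborel Q)"
    by (rule infsum_cmult_left_ennreal)
  also have "\<dots> \<le> ennreal (c * sqrt (real ?N) ^ ?N) * ennreal v"
    using sum by (rule mult_left_mono) simp
  also have "\<dots> = ennreal (c * sqrt (real ?N) ^ ?N * v)"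
    using v by (simp add: ennreal_mult'')
  finally show ?thesis .
qed

text \<open>If \<open>r\<close> is a radius for which the content of the image of the ball is
small, the largest dyadic cube at \<open>x\<close> of diameter less than \<open>r\<close> lies
in the ball, and its diameter is at least \<open>r / 2\<close>.\<close>
lemma good_dyadic_box_of_lower_density:
  fixes f :: "real ^ 'k \<Rightarrow> 'b::metric_space"
  assumes x: "x \<in> unit_cube" and ld: "lower_density n f x = 0" and e: "e > 0"
  shows "\<exists>j. hausdorff_content n (f ` dyadic_box j (cube_index j x))
      \<le> ennreal (e * diameter (dyadic_box j (cube_index j x)) ^ n)"
proof -
  let ?s = "sqrt (real CARD('k))" and ?w = "unit_ball_vol (real n)"
  have w: "?w > 0" by simp
  \<comment> \<open>\<open>2 ^ n\<close> accounts for passing from \<open>r\<close> to the diameter of the cube\<close>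
  define \<eta> where "\<eta> = e / (?w * 2 ^ n)"
  have \<eta>: "\<eta> > 0" using e w by (simp add: \<eta>_def)
  have "\<exists>r. 0 < r \<and> r < 1 \<and> hausdorff_content n (f ` ball x r) / ennreal (?w * r ^ n) < ennreal \<eta>"
  proof (rule ccontr)
    assume "\<not> ?thesis"
    then have "\<forall>\<^sub>F r in at_right 0. ennreal \<eta> \<le> hausdorff_content n (f ` ball x r) / ennreal (?w * r ^ n)"
      unfolding eventually_at_right_field by (intro exI[of _ 1]) (meson not_less zero_less_one)
    then have "ennreal \<eta> \<le> lower_density n f x" unfolding lower_density_def by (rule Liminf_bounded)
    then show False using ld \<eta> by simp
  qed
  then obtain r where r: "0 < r" "r < 1" "hausdorff_content n (f ` ball x r) / ennreal (?w * r ^ n) < ennreal \<eta>" by blast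
  have cont: "hausdorff_content n (f ` ball x r) \<le> ennreal (\<eta> * (?w * r ^ n))"
  proof -
    have p: "0 < ?w * r ^ n" using w r by simp
    have "inverse (ennreal w) * ennreal w = 1" if "w > 0" for w
      using that by (simp add: inverse_ennreal ennreal_mult'[symmetric])
    from this[OF p] have "hausdorff_content n (f ` ball x r) = hausdorff_content n (f ` ball x r) / ennreal (?w * r ^ n) * ennreal (?w * r ^ n)"
      by (simp add: divide_ennreal_def mult.assoc)
    also have "\<dots> \<le> ennreal \<eta> * ennreal (?w * r ^ n)" using r(3) by (intro mult_right_mono) auto
    also have "\<dots> = ennreal (\<eta> * (?w * r ^ n))" using \<eta> by (simp add: ennreal_mult')
    finally show ?thesis .
  qed
  have "\<exists>j. ?s / 2 ^ j < r"
  proof -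
    obtain j where "?s / r < 2 ^ j" using real_arch_pow[of 2 "?s / r"] by auto
    then show ?thesis using r(1) by (intro exI[of _ j]) (simp add: field_simps)
  qed
  define j where "j = (LEAST j. ?s / 2 ^ j < r)"
  have j: "?s / 2 ^ j < r" unfolding j_def by (rule LeastI_ex) fact
  have "j > 0"
  proof (rule ccontr)
    assume "\<not> 0 < j"
    then have "?s < r" using j by simp
    then have "?s < 1" using r(2) by (rule order.strict_trans)
    moreover have "1 \<le> real CARD('k)" by (simp add: Suc_leI)
    ultimately show False by (simp add: real_sqrt_lt_1_iff)
  qed
  then obtain i where i: "j = Suc i" by (cases j) auto
  then have "\<not> ?s / 2 ^ i < r" unfolding j_def using not_less_Least by (metis lessI)
  then have r2: "r \<le> 2 * (?s / 2 ^ j)" by (simp add: i)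
  define Q where "Q = dyadic_box j (cube_index j x)"
  have "hausdorff_content n (f ` Q) \<le> hausdorff_content n (f ` ball x r)"
    unfolding Q_def by (intro hausdorff_content_mono image_mono dyadic_box_subset_ball x j)
  also have "\<dots> \<le> ennreal (\<eta> * (?w * r ^ n))" by (rule cont)
  also have "\<dots> \<le> ennreal (\<eta> * (?w * (2 * diameter Q) ^ n))"
    using r r2 \<eta> w by (intro ennreal_leI mult_left_mono power_mono) (auto simp: Q_def dyadic_box_size)
  also have "\<eta> * (?w * (2 * diameter Q) ^ n) = e * diameter Q ^ n"
    using less_imp_neq[OF w, symmetric] by (simp add: \<eta>_def power_mult_distrib)
  finally show ?thesis unfolding Q_def by blast
qed

text \<open>The points of \<open>E\<close> where the lower density does not vanish, together
with those on the boundary of the cube, form a null set \<open>Z\<close>; it is covered by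
cubes inside an open set of small measure, for which the trivial Lipschitz bound of the content
is enough.\<close>
lemma dyadic_mapping_content_zero_of_lower_density:
  fixes f :: "real ^ 'k \<Rightarrow> 'b::metric_space"
  assumes dim: "CARD('k) = n + m" and lip: "L-lipschitz_on unit_cube f" and E: "E \<subseteq> unit_cube"
    and ld: "AE x in lebesgue. x \<in> E \<inter> interior unit_cube \<longrightarrow> lower_density n f x = 0"
  shows "dyadic_mapping_content n m f E = 0"
proof -
  let ?K = "sqrt (real CARD('k)) ^ CARD('k)"
  have L0: "L \<ge> 0" using lip by (rule lipschitz_on_nonneg)
  define S where "S = {x \<in> E. lower_density n f x = 0}"
  define Z where "Z = E - S"
  have Z: "negligible Z"
  proof -
    obtain N where N: "negligible N" "{x. \<not> (x \<in> E \<inter> interior unit_cube \<longrightarrow> lower_density n f x = 0)} \<subseteq> N"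
      using ld unfolding eventually_ae_filter_negligible by blast
    have "Z \<subseteq> N \<union> frontier unit_cube"
    proof
      fix x assume x: "x \<in> Z"
      then have xE: "x \<in> E" "lower_density n f x \<noteq> 0" by (auto simp: Z_def S_def)
      show "x \<in> N \<union> frontier unit_cube"
      proof (cases "x \<in> interior unit_cube")
        case True
        then show ?thesis using xE N(2) by blast
      next
        case False
        then show ?thesis using xE(1) E unfolding frontier_def closure_cbox by blast
      qed
    qed
    moreover have "negligible (N \<union> frontier (unit_cube :: (real ^ 'k) set))"
      using N(1) by (intro negligible_Un negligible_convex_frontier convex_box)
    ultimately show ?thesis using negligible_subset by blast
  qed
  define C where "C = unit_ball_vol (real n) * L ^ n"
  have C0: "C \<ge> 0" using L0 by (simp add: C_def)
  have bound: "dyadic_mapping_content n m f E \<le> ennreal (\<epsilon> * ?K + C * ?K * \<epsilon>)" if \<epsilon>: "\<epsilon> > 0" for \<epsilon>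
  proof -
    have "\<exists>\<Q>1. countable \<Q>1 \<and> S \<subseteq> \<Union>\<Q>1 \<and>
        (\<forall>Q\<in>\<Q>1. (hausdorff_content n (f ` Q) \<le> ennreal (\<epsilon> * diameter Q ^ n) \<and> Q \<subseteq> unit_cube) \<and> Q \<subseteq> unit_cube \<and> (\<exists>j z. Q = dyadic_box j z)) \<and>
        (\<Sum>\<^sub>\<infinity>Q\<in>\<Q>1. emeasure lborel Q) \<le> emeasure lborel (unit_cube :: (real ^ 'k) set)"
    proof (rule maximal_dyadic_cover[of S "\<lambda>Q. hausdorff_content n (f ` Q) \<le> ennreal (\<epsilon> * diameter Q ^ n) \<and> Q \<subseteq> unit_cube" unit_cube])
      show "S \<subseteq> unit_cube" using E by (auto simp: S_def)
      fix x assume "x \<in> S"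
      then have "x \<in> unit_cube" "lower_density n f x = 0" using E by (auto simp: S_def)
      then show "\<exists>j. hausdorff_content n (f ` dyadic_box j (cube_index j x)) \<le> ennreal (\<epsilon> * diameter (dyadic_box j (cube_index j x)) ^ n)
          \<and> dyadic_box j (cube_index j x) \<subseteq> unit_cube"
        using good_dyadic_box_of_lower_density[of x n f \<epsilon>] \<epsilon> dyadic_box_cube_index_subset[of x] by simp
    qed auto
    then obtain \<Q>1 where Q1: "countable \<Q>1" "S \<subseteq> \<Union>\<Q>1"
      "\<forall>Q\<in>\<Q>1. (hausdorff_content n (f ` Q) \<le> ennreal (\<epsilon> * diameter Q ^ n) \<and> Q \<subseteq> unit_cube) \<and> Q \<subseteq> unit_cube \<and> (\<exists>j z. Q = dyadic_box j z)"
      "(\<Sum>\<^sub>\<infinity>Q\<in>\<Q>1. emeasure lborel Q) \<le> emeasure lborel (unit_cube :: (real ^ 'k) set)"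
      by (elim exE conjE)
    have "emeasure lborel (unit_cube :: (real ^ 'k) set) = ennreal 1"
      using dyadic_box_size(2)[of 0 "0 :: int ^ 'k"] by (simp add: dyadic_box_def zero_vec_def one_vec_def)
    then have s1: "(\<Sum>\<^sub>\<infinity>Q\<in>\<Q>1. hausdorff_content n (f ` Q) * ennreal (diameter Q ^ m)) \<le> ennreal (\<epsilon> * ?K * 1)"
      using Q1(3,4) \<epsilon> by (intro sum_dyadic_contents_le[OF dim]) simp_all
    obtain U where U: "open U" "Z \<subseteq> U" "(U - Z) \<in> lmeasurable" "emeasure lebesgue (U - Z) < ennreal \<epsilon>"
      using sets_lebesgue_outer_open[OF negligible_imp_sets[OF Z] \<epsilon>] by blast
    have Um: "emeasure lborel U \<le> ennreal \<epsilon>"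
    proof -
      have "emeasure lborel U = emeasure lebesgue (U - Z)"
        using emeasure_Diff_null_set[of Z lebesgue U] U(1) Z by (simp add: negligible_iff_null_sets)
      then show ?thesis using U(4) by simp
    qed
    have "\<exists>\<Q>2. countable \<Q>2 \<and> Z \<subseteq> \<Union>\<Q>2 \<and>
        (\<forall>Q\<in>\<Q>2. Q \<subseteq> U \<and> Q \<subseteq> unit_cube \<and> (\<exists>j z. Q = dyadic_box j z)) \<and>
        (\<Sum>\<^sub>\<infinity>Q\<in>\<Q>2. emeasure lborel Q) \<le> emeasure lborel U"
    proof (rule maximal_dyadic_cover[of Z "\<lambda>Q. Q \<subseteq> U" U])
      show "Z \<subseteq> unit_cube" using E by (auto simp: Z_def)
      fix x assume x: "x \<in> Z"
      then obtain r where r: "r > 0" "ball x r \<subseteq> U" using U(1,2) open_contains_ball by blast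
      obtain j where "sqrt (real CARD('k)) / r < 2 ^ j" using real_arch_pow[of 2 "sqrt (real CARD('k)) / r"] by auto
      then have "sqrt (real CARD('k)) / 2 ^ j < r" using r(1) by (simp add: field_simps)
      then show "\<exists>j. dyadic_box j (cube_index j x) \<subseteq> U"
        using dyadic_box_subset_ball[of x j r] r(2) x E by (intro exI[of _ j]) (auto simp: Z_def)
    qed (use U(1) in auto)
    then obtain \<Q>2 where Q2: "countable \<Q>2" "Z \<subseteq> \<Union>\<Q>2"
      "\<forall>Q\<in>\<Q>2. Q \<subseteq> U \<and> Q \<subseteq> unit_cube \<and> (\<exists>j z. Q = dyadic_box j z)"
      "(\<Sum>\<^sub>\<infinity>Q\<in>\<Q>2. emeasure lborel Q) \<le> emeasure lborel U"
      by (elim exE conjE)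
    have h2: "hausdorff_content n (f ` Q) \<le> ennreal (C * diameter Q ^ n)" if "Q \<in> \<Q>2" for Q
    proof -
      have sub: "Q \<subseteq> unit_cube" using Q2(3) that by blast
      show ?thesis
        unfolding C_def
        by (rule hausdorff_content_image_lipschitz_le[OF lipschitz_on_subset[OF lip sub] bounded_subset[OF bounded_cbox sub]])
    qed
    have s2: "(\<Sum>\<^sub>\<infinity>Q\<in>\<Q>2. hausdorff_content n (f ` Q) * ennreal (diameter Q ^ m)) \<le> ennreal (C * ?K * \<epsilon>)"
      using Q2(3) h2 C0 \<epsilon> order.trans[OF Q2(4) Um] by (intro sum_dyadic_contents_le[OF dim]) simp_all
    have dy: "dyadic_cube (dyadic_box j z)" for j and z :: "int ^ 'k"
      unfolding dyadic_cube_def dyadic_box_def by blast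
    have "dyadic_mapping_content n m f E \<le> (\<Sum>\<^sub>\<infinity>Q\<in>\<Q>1 \<union> \<Q>2. hausdorff_content n (f ` Q) * ennreal (diameter Q ^ m))"
      unfolding dyadic_mapping_content_def
    proof (rule INF_lower)
      show "\<Q>1 \<union> \<Q>2 \<in> {\<Q>. countable \<Q> \<and> E \<subseteq> \<Union> \<Q> \<and> (\<forall>Q\<in>\<Q>. dyadic_cube Q \<and> Q \<subseteq> unit_cube)}"
      proof (intro CollectI conjI ballI)
        show "countable (\<Q>1 \<union> \<Q>2)" using Q1(1) Q2(1) by simp
        show "E \<subseteq> \<Union> (\<Q>1 \<union> \<Q>2)" using Q1(2) Q2(2) by (auto simp: Z_def)
        fix Q assume "Q \<in> \<Q>1 \<union> \<Q>2"
        then have "Q \<subseteq> unit_cube \<and> (\<exists>j z. Q = dyadic_box j z)" using Q1(3) Q2(3) by blast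
        then show "dyadic_cube Q" "Q \<subseteq> unit_cube" using dy by blast+
      qed
    qed
    also have "\<dots> \<le> ennreal (\<epsilon> * ?K * 1) + ennreal (C * ?K * \<epsilon>)"
      by (rule order.trans[OF infsum_Un_le_ennreal add_mono[OF s1 s2]])
    also have "\<dots> = ennreal (\<epsilon> * ?K + C * ?K * \<epsilon>)"
      using \<epsilon> C0 by (subst ennreal_plus) auto
    finally show ?thesis .
  qed
  have "(\<lambda>i. ennreal (inverse (real (Suc i)) * ?K + C * ?K * inverse (real (Suc i)))) \<longlonglongrightarrow> ennreal (0 * ?K + C * ?K * 0)"
    by (intro tendsto_ennrealI tendsto_add tendsto_mult tendsto_const LIMSEQ_inverse_real_of_nat)
  then have "dyadic_mapping_content n m f E \<le> 0"
    using bound by (intro LIMSEQ_le_const[of _ 0]) auto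
  then show ?thesis by simp
qed

section \<open>Vanishing mapping content implies small rank\<close>

text \<open>For every \<open>s > \<beta>\<close>, slabs of width \<open>s\<close> orthogonal to
the vectors in \<open>cs\<close> cut \<open>G\<close> into at most \<open>(2 * d / s + 1) ^
m\<close> pieces, and by the lower bound each of them has diameter at most \<open>(1 + m) * s /
\<kappa>\<close>. Letting \<open>s\<close> tend to \<open>\<beta>\<close> includes the case
\<open>\<beta> = 0\<close>.\<close>
lemma outer_lebesgue_le_of_image_diameter:
  fixes G :: "'a::euclidean_space set" and f :: "'a \<Rightarrow> 'b::metric_space"
  assumes dim: "DIM('a) = n + m"
    and cs: "length cs \<le> m" "\<And>c. c \<in> set cs \<Longrightarrow> norm c \<le> 1"
    and \<kappa>: "\<kappa> > 0"
    and lower: "\<And>x y. x \<in> G \<Longrightarrow> y \<in> G \<Longrightarrow> \<kappa> * dist x y - inner_sum cs (x - y) \<le> dist (f x) (f y)"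
    and d: "\<And>x y. x \<in> G \<Longrightarrow> y \<in> G \<Longrightarrow> dist x y \<le> d" "d \<ge> 0"
    and \<beta>: "\<And>x y. x \<in> G \<Longrightarrow> y \<in> G \<Longrightarrow> dist (f x) (f y) \<le> \<beta>" "\<beta> \<ge> 0"
  shows "outer_lebesgue G \<le> ennreal ((2 * (1 + real m) / \<kappa>) ^ (n + m) * (2 * d + \<beta>) ^ m * \<beta> ^ n)"
proof -
  define K where "K = (2 * (1 + real m) / \<kappa>) ^ (n + m)"
  have K0: "K \<ge> 0" using \<kappa> by (simp add: K_def)
  have bound: "outer_lebesgue G \<le> ennreal (K * (2 * d + s) ^ m * s ^ n)" if s: "s > \<beta>" for s
  proof -
    have s0: "s > 0" using s \<beta>(2) by simp
    obtain \<P> where P: "finite \<P>" "real (card \<P>) \<le> (2 * d / s + 1) ^ length cs" "\<Union>\<P> = G"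
      "\<And>P x y c. P \<in> \<P> \<Longrightarrow> x \<in> P \<Longrightarrow> y \<in> P \<Longrightarrow> c \<in> set cs \<Longrightarrow> \<bar>c \<bullet> (x - y)\<bar> \<le> s"
      using slab_partition[of cs G d s] cs(2) d s0 by auto
    define t where "t = (1 + real m) * s / \<kappa>"
    have t0: "t \<ge> 0" using s0 \<kappa> by (simp add: t_def)
    have small: "dist x y \<le> t" if xy: "P \<in> \<P>" "x \<in> P" "y \<in> P" for P x y
    proof -
      have G: "x \<in> G" "y \<in> G" using xy P(3) by auto
      have "inner_sum cs (x - y) \<le> real (length cs) * s"
        using P(4)[OF xy] by (rule inner_sum_le)
      also have "\<dots> \<le> real m * s" using cs(1) s0 by (intro mult_right_mono) auto
      finally have "\<kappa> * dist x y \<le> (1 + real m) * s"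
        using lower[OF G] \<beta>(1)[OF G] s by (simp add: distrib_right)
      then show ?thesis using \<kappa> by (simp add: t_def pos_le_divide_eq mult.commute)
    qed
    have "outer_lebesgue G = outer_lebesgue (\<Union>P\<in>\<P>. P)" using P(3) by simp
    also have "\<dots> \<le> (\<Sum>\<^sub>\<infinity>P\<in>\<P>. outer_lebesgue P)"
      by (rule outer_lebesgue_UN_le_infsum[OF countable_finite[OF P(1)]])
    also have "\<dots> = (\<Sum>P\<in>\<P>. outer_lebesgue P)" using P(1) by (rule infsum_finite)
    also have "\<dots> \<le> (\<Sum>P\<in>\<P>. ennreal ((2 * t) ^ (n + m)))"
      using outer_lebesgue_le_diameter_power[OF small t0] unfolding dim by (rule sum_mono)
    also have "\<dots> = ennreal (real (card \<P>) * (2 * t) ^ (n + m))"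
      by (simp add: ennreal_mult'[symmetric] ennreal_of_nat_eq_real_of_nat)
    also have "\<dots> \<le> ennreal ((2 * d / s + 1) ^ m * (2 * t) ^ (n + m))"
    proof (intro ennreal_leI mult_right_mono)
      have "(2 * d / s + 1) ^ length cs \<le> (2 * d / s + 1) ^ m"
        using cs(1) d(2) s0 by (intro power_increasing) auto
      then show "real (card \<P>) \<le> (2 * d / s + 1) ^ m" using P(2) by linarith
    qed (use t0 in simp)
    also have "(2 * d / s + 1) ^ m * (2 * t) ^ (n + m) = K * (2 * d + s) ^ m * s ^ n"
    proof -
      define q where "q = 2 * (1 + real m) / \<kappa>"
      have "2 * t = q * s" by (simp add: t_def q_def)
      then have "(2 * t) ^ (n + m) = K * s ^ n * s ^ m"
        unfolding K_def q_def[symmetric] by (simp add: power_mult_distrib power_add mult_ac)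
      moreover have "(2 * d / s + 1) ^ m * s ^ m = (2 * d + s) ^ m"
        using s0 by (simp add: distrib_right flip: power_mult_distrib)
      ultimately show ?thesis by (metis mult.assoc mult.commute)
    qed
    finally show ?thesis .
  qed
  have "((\<lambda>s. ennreal (K * (2 * d + s) ^ m * s ^ n)) \<longlongrightarrow> ennreal (K * (2 * d + \<beta>) ^ m * \<beta> ^ n)) (at_right \<beta>)"
    by (intro tendsto_ennrealI tendsto_intros)
  moreover have "\<forall>\<^sub>F s in at_right \<beta>. outer_lebesgue G \<le> ennreal (K * (2 * d + s) ^ m * s ^ n)"
    unfolding eventually_at_right_field using bound by (intro exI[of _ "\<beta> + 1"]) auto
  ultimately show ?thesis unfolding K_def[symmetric] by (rule tendsto_lowerbound) simp
qed

text \<open>Each member \<open>B\<close> of a covering of \<open>f ` A\<close> contributes the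
points of \<open>F \<inter> A\<close> that are mapped into \<open>B\<close>. Their image has
diameter at most \<open>min (diameter B) (L * diameter A)\<close>; the second bound turns the
sum \<open>2 * diameter A + \<beta>\<close> into a multiple of \<open>diameter
A\<close>.\<close>
lemma outer_lebesgue_le_hausdorff_content:
  fixes A :: "'a::euclidean_space set" and f :: "'a \<Rightarrow> 'b::metric_space"
  assumes dim: "DIM('a) = n + m" and lip: "L-lipschitz_on A f" and A: "bounded A"
    and cs: "length cs \<le> m" "\<And>c. c \<in> set cs \<Longrightarrow> norm c \<le> 1"
    and \<kappa>: "\<kappa> > 0"
    and lower: "\<And>x y. x \<in> F \<Longrightarrow> y \<in> F \<Longrightarrow> \<kappa> * dist x y - inner_sum cs (x - y) \<le> dist (f x) (f y)"
    and C: "C = (2 * (1 + real m) / \<kappa>) ^ (n + m) * (2 + L) ^ m * (2 ^ n / unit_ball_vol (real n))"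
  shows "outer_lebesgue (F \<inter> A) \<le> ennreal C * (hausdorff_content n (f ` A) * ennreal (diameter A ^ m))"
proof -
  let ?w = "unit_ball_vol (real n)"
  have w: "?w \<noteq> 0" by (metis less_irrefl of_nat_0_le_iff unit_ball_vol_pos)
  have w0: "?w \<ge> 0" by simp
  have L0: "L \<ge> 0" using lip by (rule lipschitz_on_nonneg)
  define d where "d = diameter A"
  have d0: "d \<ge> 0" unfolding d_def by (rule diameter_ge_0[OF A])
  have C0: "C \<ge> 0" using \<kappa> L0 w0 by (simp add: C)
  define h where "h B = ennreal (?w / 2 ^ n * diameter B ^ n)" for B :: "'b set"
  have cover: "outer_lebesgue (F \<inter> A) \<le> ennreal (C * d ^ m) * (\<Sum>\<^sub>\<infinity>B\<in>\<C>. h B)"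
    if \<C>: "countable \<C>" "f ` A \<subseteq> \<Union>\<C>" "\<forall>B\<in>\<C>. bounded B" for \<C>
  proof -
    define G where "G B = {x \<in> F \<inter> A. f x \<in> B}" for B
    have piece: "outer_lebesgue (G B) \<le> ennreal (C * d ^ m) * h B" if B: "B \<in> \<C>" for B
    proof -
      have bB: "bounded B" using \<C>(3) B by blast
      have B0: "diameter B \<ge> 0" by (rule diameter_ge_0[OF bB])
      define \<beta> where "\<beta> = min (diameter B) (L * d)"
      have \<beta>0: "\<beta> \<ge> 0" using B0 L0 d0 by (simp add: \<beta>_def)
      have dd: "dist x y \<le> d" if "x \<in> G B" "y \<in> G B" for x y
        using that A unfolding G_def d_def by (intro diameter_bounded_bound) auto
      have \<beta>1: "dist (f x) (f y) \<le> \<beta>" if xy: "x \<in> G B" "y \<in> G B" for x y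
      proof -
        have "dist (f x) (f y) \<le> diameter B"
          using xy bB unfolding G_def by (intro diameter_bounded_bound) auto
        moreover have "dist (f x) (f y) \<le> L * dist x y"
          using xy unfolding G_def by (intro lipschitz_onD[OF lip]) auto
        moreover have "L * dist x y \<le> L * d" using dd[OF xy] L0 by (rule mult_left_mono)
        ultimately show ?thesis by (simp add: \<beta>_def)
      qed
      have "outer_lebesgue (G B) \<le> ennreal ((2 * (1 + real m) / \<kappa>) ^ (n + m) * (2 * d + \<beta>) ^ m * \<beta> ^ n)"
        by (rule outer_lebesgue_le_of_image_diameter[OF dim cs \<kappa> _ dd d0 \<beta>1 \<beta>0]) (auto simp: G_def intro: lower)
      also have "\<dots> \<le> ennreal ((2 * (1 + real m) / \<kappa>) ^ (n + m) * ((2 + L) * d) ^ m * diameter B ^ n)"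
      proof (intro ennreal_leI mult_mono power_mono)
        have "\<beta> \<le> L * d" by (simp add: \<beta>_def)
        then show "2 * d + \<beta> \<le> (2 + L) * d" by (simp add: distrib_right)
      qed (use \<beta>0 d0 L0 \<kappa> in \<open>auto simp: \<beta>_def\<close>)
      also have "(2 * (1 + real m) / \<kappa>) ^ (n + m) * ((2 + L) * d) ^ m * diameter B ^ n
          = C * d ^ m * (?w / 2 ^ n * diameter B ^ n)"
        using w by (simp add: C power_mult_distrib)
      also have "ennreal (C * d ^ m * (?w / 2 ^ n * diameter B ^ n)) = ennreal (C * d ^ m) * h B"
        unfolding h_def using C0 d0 by (intro ennreal_mult') simp
      finally show ?thesis .
    qed
    have "F \<inter> A \<subseteq> (\<Union>B\<in>\<C>. G B)" using \<C>(2) by (auto simp: G_def)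
    then have "outer_lebesgue (F \<inter> A) \<le> outer_lebesgue (\<Union>B\<in>\<C>. G B)" by (rule outer_measure_of_mono)
    also have "\<dots> \<le> (\<Sum>\<^sub>\<infinity>B\<in>\<C>. outer_lebesgue (G B))" by (rule outer_lebesgue_UN_le_infsum[OF \<C>(1)])
    also have "\<dots> \<le> (\<Sum>\<^sub>\<infinity>B\<in>\<C>. ennreal (C * d ^ m) * h B)"
      using piece by (intro infsum_mono nonneg_summable_on_complete) auto
    also have "\<dots> = ennreal (C * d ^ m) * (\<Sum>\<^sub>\<infinity>B\<in>\<C>. h B)" by (rule infsum_cmult_left_ennreal)
    finally show ?thesis .
  qed
  define H where "H = hausdorff_content n (f ` A)"
  have Hfin: "H < top"
    using hausdorff_content_image_lipschitz_le[OF lip A, of n] unfolding H_def by (rule order.strict_trans1) simp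
  have "outer_lebesgue (F \<inter> A) \<le> ennreal (C * d ^ m) * (H + ennreal (inverse (real (Suc i))))" for i
  proof -
    have "H < H + ennreal (inverse (real (Suc i)))"
    proof -
      obtain a where "H = ennreal a" "a \<ge> 0" using Hfin by (cases H) auto
      then show ?thesis by (simp add: ennreal_less_iff flip: ennreal_plus)
    qed
    then obtain \<C> where \<C>: "countable \<C>" "f ` A \<subseteq> \<Union>\<C>" "\<forall>B\<in>\<C>. bounded B"
      "(\<Sum>\<^sub>\<infinity>B\<in>\<C>. h B) < H + ennreal (inverse (real (Suc i)))"
      unfolding H_def hausdorff_content_def h_def INF_less_iff by auto
    have "outer_lebesgue (F \<inter> A) \<le> ennreal (C * d ^ m) * (\<Sum>\<^sub>\<infinity>B\<in>\<C>. h B)" by (rule cover[OF \<C>(1,2,3)])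
    also have "\<dots> \<le> ennreal (C * d ^ m) * (H + ennreal (inverse (real (Suc i))))"
      using \<C>(4) by (intro mult_left_mono) auto
    finally show ?thesis .
  qed
  moreover have "(\<lambda>i. ennreal (C * d ^ m) * (H + ennreal (inverse (real (Suc i))))) \<longlonglongrightarrow> ennreal (C * d ^ m) * (H + ennreal 0)"
    by (intro ennreal_tendsto_cmult tendsto_add tendsto_const tendsto_ennrealI LIMSEQ_inverse_real_of_nat) simp
  ultimately have "outer_lebesgue (F \<inter> A) \<le> ennreal (C * d ^ m) * (H + ennreal 0)"
    by (intro LIMSEQ_le_const) auto
  then show ?thesis
    using C0 d0 by (simp add: H_def d_def ennreal_mult' mult_ac)
qed

lemma negligible_of_mapping_content_zero:
  fixes f :: "real ^ 'k \<Rightarrow> 'b::metric_space"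
  assumes dim: "CARD('k) = n + m" and lip: "L-lipschitz_on unit_cube f"
    and E: "F \<subseteq> E" "mapping_content n m f E = 0"
    and cs: "length cs \<le> m" "\<And>c. c \<in> set cs \<Longrightarrow> norm c \<le> 1"
    and \<kappa>: "\<kappa> > 0"
    and lower: "\<And>x y. x \<in> F \<Longrightarrow> y \<in> F \<Longrightarrow> \<kappa> * dist x y - inner_sum cs (x - y) \<le> dist (f x) (f y)"
  shows "negligible F"
proof -
  define C where "C = (2 * (1 + real m) / \<kappa>) ^ (n + m) * (2 + L) ^ m * (2 ^ n / unit_ball_vol (real n))"
  have "outer_lebesgue F \<le> ennreal C * ennreal (inverse (real (Suc i)))" for i
  proof -
    have "mapping_content n m f E < ennreal (inverse (real (Suc i)))"
      using E(2) by simp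
    then obtain \<A> where \<A>: "countable \<A>" "E \<subseteq> \<Union>\<A>" "\<forall>A\<in>\<A>. A \<subseteq> unit_cube"
      "(\<Sum>\<^sub>\<infinity>A\<in>\<A>. hausdorff_content n (f ` A) * ennreal (diameter A ^ m)) < ennreal (inverse (real (Suc i)))"
      unfolding mapping_content_def INF_less_iff by auto
    have "F \<subseteq> (\<Union>A\<in>\<A>. F \<inter> A)" using E(1) \<A>(2) by blast
    then have "outer_lebesgue F \<le> outer_lebesgue (\<Union>A\<in>\<A>. F \<inter> A)" by (rule outer_measure_of_mono)
    also have "\<dots> \<le> (\<Sum>\<^sub>\<infinity>A\<in>\<A>. outer_lebesgue (F \<inter> A))" by (rule outer_lebesgue_UN_le_infsum[OF \<A>(1)])
    also have "\<dots> \<le> (\<Sum>\<^sub>\<infinity>A\<in>\<A>. ennreal C * (hausdorff_content n (f ` A) * ennreal (diameter A ^ m)))"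
    proof (rule infsum_mono)
      fix A assume "A \<in> \<A>"
      then have sub: "A \<subseteq> unit_cube" using \<A>(3) by blast
      show "outer_lebesgue (F \<inter> A) \<le> ennreal C * (hausdorff_content n (f ` A) * ennreal (diameter A ^ m))"
        by (rule outer_lebesgue_le_hausdorff_content[OF _ lipschitz_on_subset[OF lip sub] bounded_subset[OF bounded_cbox sub] cs \<kappa> lower C_def])
          (simp_all add: dim)
    qed (auto intro: nonneg_summable_on_complete)
    also have "\<dots> = ennreal C * (\<Sum>\<^sub>\<infinity>A\<in>\<A>. hausdorff_content n (f ` A) * ennreal (diameter A ^ m))"
      by (rule infsum_cmult_left_ennreal)
    also have "\<dots> \<le> ennreal C * ennreal (inverse (real (Suc i)))"
      using \<A>(4) by (intro mult_left_mono) auto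
    finally show ?thesis .
  qed
  moreover have "(\<lambda>i. ennreal C * ennreal (inverse (real (Suc i)))) \<longlonglongrightarrow> ennreal C * ennreal 0"
    by (intro ennreal_tendsto_cmult tendsto_ennrealI LIMSEQ_inverse_real_of_nat) simp
  ultimately have "outer_lebesgue F \<le> ennreal C * ennreal 0"
    by (intro LIMSEQ_le_const) auto
  then show ?thesis by (simp add: negligible_iff_outer_lebesgue)
qed

text \<open>The points of \<open>E\<close> where the rank is at least \<open>n\<close> are
covered by countably many sets \<open>F q cs i j\<close>. Restricting to a small ball around
\<open>q\<close> makes the lower bound, which is valid at scale \<open>1 / (i + 1)\<close>,
hold for all pairs of points of such a set.\<close>
lemma AE_rank_less_of_mapping_content_zero:
  fixes f g :: "real ^ 'k \<Rightarrow> 'b::metric_space"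
  assumes dim: "CARD('k) = n + m" and n: "n \<ge> 1" and lip: "L-lipschitz_on unit_cube f"
    and lipg: "L-lipschitz_on UNIV g" and fg: "\<And>x. x \<in> unit_cube \<Longrightarrow> g x = f x"
    and E: "E \<subseteq> unit_cube" "mapping_content n m f E = 0"
  shows "AE x in lebesgue. x \<in> E \<longrightarrow> (\<forall>\<sigma>. has_metric_derivative g \<sigma> x \<longrightarrow> seminorm_rank \<sigma> \<le> n - 1)"
proof -
  obtain D :: "(real ^ 'k) set" where D: "countable D" "D \<subseteq> cball 0 1" "cball 0 1 \<subseteq> closure D"
    using countable_dense_unit_ball by blast
  obtain D' :: "(real ^ 'k) set" where D': "countable D'" "closure D' = UNIV"
    using countable_dense_directions by blast
  define F where "F q cs i j = {x \<in> E. dist x q < inverse (real (Suc i)) / 2 \<and>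
     (\<forall>y. dist y x < inverse (real (Suc i)) \<longrightarrow> inverse (real (Suc j)) * dist y x - inner_sum cs (y - x) \<le> dist (g y) (g x))}" for q cs i j
  define CS where "CS = {cs \<in> lists D. length cs \<le> m}"
  have cCS: "countable CS" unfolding CS_def by (rule countable_subset[OF _ countable_lists[OF D(1)]]) auto
  have neg: "negligible (F q cs i j)" if cs: "cs \<in> CS" for q cs i j
  proof (rule negligible_of_mapping_content_zero[OF dim lip _ E(2), where cs = cs])
    show "F q cs i j \<subseteq> E" by (auto simp: F_def)
    show "length cs \<le> m" using cs by (simp add: CS_def)
    show "norm c \<le> 1" if "c \<in> set cs" for c using cs that D(2) by (auto simp: CS_def subset_iff)
    show "0 < inverse (real (Suc j))" by simp
    fix x y assume xy: "x \<in> F q cs i j" "y \<in> F q cs i j"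
    then have "dist x q < inverse (real (Suc i)) / 2" "dist y q < inverse (real (Suc i)) / 2" by (auto simp: F_def)
    then have "dist x y < inverse (real (Suc i))" using dist_triangle2[of x y q] by linarith
    then have "inverse (real (Suc j)) * dist x y - inner_sum cs (x - y) \<le> dist (g x) (g y)"
      using xy(2) by (auto simp: F_def)
    moreover have "x \<in> unit_cube" "y \<in> unit_cube" using xy E(1) by (auto simp: F_def)
    ultimately show "inverse (real (Suc j)) * dist x y - inner_sum cs (x - y) \<le> dist (f x) (f y)"
      using fg by simp
  qed
  have "AE x in lebesgue. \<forall>q\<in>D'. \<forall>cs\<in>CS. \<forall>i j. x \<notin> F q cs i j"
    using neg by (intro AE_ball_countable[THEN iffD2] ballI AE_all_countable[THEN iffD2] allI cCS D'(1) AE_not_in)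
      (simp add: negligible_iff_null_sets)
  then show ?thesis
  proof eventually_elim
    case (elim x)
    show ?case
    proof (intro impI allI)
      fix \<sigma> assume xE: "x \<in> E" and md: "has_metric_derivative g \<sigma> x"
      have \<sigma>: "is_seminorm \<sigma>" using md by (simp add: has_metric_derivative_def)
      show "seminorm_rank \<sigma> \<le> n - 1"
      proof (rule ccontr)
        assume "\<not> ?thesis"
        then have rank: "seminorm_rank \<sigma> \<ge> n" using n by simp
        obtain cs' \<kappa> where cs': "length cs' = DIM(real ^ 'k) - seminorm_rank \<sigma>" "\<And>c. c \<in> set cs' \<Longrightarrow> norm c \<le> 1"
          and \<kappa>: "\<kappa> > 0" "\<And>v. \<kappa> * norm v - inner_sum cs' v \<le> \<sigma> v"
          using seminorm_ge_norm_minus_inner_sum[OF \<sigma> has_metric_derivative_le_lipschitz[OF md lipg]] by metis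
        have len': "length cs' \<le> m" using cs'(1) rank dim by simp
        \<comment> \<open>the bound loses \<open>\<kappa> / 3\<close> for approximating \<open>cs'\<close> by \<open>cs\<close>, and as much for the metric derivative\<close>
        define M where "M = real (length cs') + 1"
        have M: "M > 0" by (simp add: M_def)
        define \<tau> where "\<tau> = \<kappa> / 3 / M"
        have \<tau>: "\<tau> > 0" using \<kappa> M by (simp add: \<tau>_def)
        have \<tau>2: "real (length cs') * \<tau> \<le> \<kappa> / 3"
        proof -
          have "real (length cs') * \<tau> \<le> M * \<tau>" using \<tau> by (intro mult_right_mono) (auto simp: M_def)
          also have "\<dots> = \<kappa> / 3" using M by (simp add: \<tau>_def)
          finally show ?thesis .
        qed
        obtain cs where cs: "cs \<in> lists D" "list_all2 (\<lambda>c b. dist c b \<le> \<tau>) cs cs'"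
          using list_approximation[of cs' D \<tau>] cs'(2) D(3) \<tau> by (auto simp: subset_iff)
        have len: "length cs = length cs'" using cs(2) by (rule list_all2_lengthD)
        have csCS: "cs \<in> CS" using cs(1) len len' by (simp add: CS_def)
        obtain j where j: "inverse (real (Suc j)) < \<kappa> / 3" using reals_Archimedean[of "\<kappa> / 3"] \<kappa>(1) by auto
        obtain d where d: "d > 0" "\<And>y. dist y x < d \<Longrightarrow> \<bar>dist (g y) (g x) - \<sigma> (y - x)\<bar> \<le> \<kappa> / 3 * norm (y - x)"
          using has_metric_derivativeD[OF md, of "\<kappa> / 3"] \<kappa>(1) by auto
        obtain i where i: "inverse (real (Suc i)) < d" using reals_Archimedean[OF d(1)] by blast
        have "x \<in> closure D'" using D'(2) by simp
        moreover have "inverse (real (Suc i)) / 2 > 0" by simp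
        ultimately obtain q where q: "q \<in> D'" "dist q x < inverse (real (Suc i)) / 2"
          using closure_approachable by blast
        have "x \<in> F q cs i j"
          unfolding F_def
        proof (intro CollectI conjI allI impI xE)
          show "dist x q < inverse (real (Suc i)) / 2" using q(2) by (simp add: dist_commute)
          fix y assume y: "dist y x < inverse (real (Suc i))"
          let ?v = "y - x"
          have 1: "\<bar>dist (g y) (g x) - \<sigma> ?v\<bar> \<le> \<kappa> / 3 * norm ?v"
            by (rule d(2)[OF order.strict_trans[OF y i]])
          have "inner_sum cs' ?v \<le> inner_sum cs ?v + real (length cs') * \<tau> * norm ?v"
            using inner_sum_perturb[OF cs(2), of ?v] len by simp
          moreover have "real (length cs') * \<tau> * norm ?v \<le> \<kappa> / 3 * norm ?v"
            using \<tau>2 by (intro mult_right_mono) auto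
          moreover have "inverse (real (Suc j)) * norm ?v \<le> \<kappa> / 3 * norm ?v"
            using j by (intro mult_right_mono) auto
          moreover have "\<kappa> * norm ?v = 3 * (\<kappa> / 3 * norm ?v)" by simp
          ultimately have "inverse (real (Suc j)) * norm ?v - inner_sum cs ?v \<le> dist (g y) (g x)"
            using 1 \<kappa>(2)[of ?v] by linarith
          then show "inverse (real (Suc j)) * dist y x - inner_sum cs ?v \<le> dist (g y) (g x)"
            by (simp add: dist_norm)
        qed
        then show False using elim csCS q(1) by blast
      qed
    qed
  qed
qed

section \<open>The equivalence\<close>

lemma has_metric_derivative_cong_open:
  assumes "open S" "x \<in> S" and eq: "\<And>y. y \<in> S \<Longrightarrow> g y = f y"
  shows "has_metric_derivative g \<sigma> x \<longleftrightarrow> has_metric_derivative f \<sigma> x"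
proof -
  have "\<forall>\<^sub>F y in at x. (dist (g y) (g x) - \<sigma> (y - x)) / norm (y - x) = (dist (f y) (f x) - \<sigma> (y - x)) / norm (y - x)"
    using eventually_at_in_open'[OF assms(1,2)] by eventually_elim (simp add: eq assms(2))
  from tendsto_cong[OF this] show ?thesis by (simp add: has_metric_derivative_def)
qed

lemma upper_density_cong_open:
  assumes "open S" "x \<in> S" and eq: "\<And>y. y \<in> S \<Longrightarrow> g y = f y"
  shows "upper_density n g x = upper_density n f x"
proof -
  obtain e where e: "e > 0" "ball x e \<subseteq> S" using assms(1,2) open_contains_ball by blast
  have im: "g ` ball x r = f ` ball x r" if "r < e" for r
  proof (intro image_cong refl eq)
    fix y assume "y \<in> ball x r"
    then have "y \<in> ball x e" using that by simp
    then show "y \<in> S" using e(2) by blast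
  qed
  have "\<forall>\<^sub>F r in at_right 0. hausdorff_content n (g ` ball x r) / ennreal (unit_ball_vol (real n) * r ^ n)
      = hausdorff_content n (f ` ball x r) / ennreal (unit_ball_vol (real n) * r ^ n)"
    unfolding eventually_at_right_field using e(1) im by (intro exI[of _ e]) simp
  then show ?thesis unfolding upper_density_def by (rule Limsup_eq)
qed

theorem theorem1p3:
  fixes f :: "real ^ 'k \<Rightarrow> 'b::metric_space" and E :: "(real ^ 'k) set"
    and n m :: nat and L :: real
  assumes "n \<ge> 1"
    and "CARD('k) = n + m"
    and "L-lipschitz_on unit_cube f"
    and "E \<subseteq> unit_cube"
    and "E \<in> sets lebesgue"
  shows "((AE x in lebesgue. x \<in> E \<inter> interior unit_cube \<longrightarrow>
             metrically_differentiable f x \<and> seminorm_rank (md f x) \<le> n - 1)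
          \<longleftrightarrow> (AE x in lebesgue. x \<in> E \<inter> interior unit_cube \<longrightarrow> upper_density n f x = 0))
       \<and> ((AE x in lebesgue. x \<in> E \<inter> interior unit_cube \<longrightarrow> upper_density n f x = 0)
          \<longleftrightarrow> (AE x in lebesgue. x \<in> E \<inter> interior unit_cube \<longrightarrow> lower_density n f x = 0))
       \<and> ((AE x in lebesgue. x \<in> E \<inter> interior unit_cube \<longrightarrow> lower_density n f x = 0)
          \<longleftrightarrow> dyadic_mapping_content n m f E = 0)
       \<and> (dyadic_mapping_content n m f E = 0 \<longleftrightarrow> mapping_content n m f E = 0)"
    (is "(?b \<longleftrightarrow> ?c) \<and> (?c \<longleftrightarrow> ?d) \<and> (?d \<longleftrightarrow> ?e) \<and> (?e \<longleftrightarrow> ?f)")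
proof -
  define g where "g x = f (closest_point unit_cube x)" for x
  have "(0 :: real ^ 'k) \<in> unit_cube" by (simp add: mem_box_cart)
  then have ne: "unit_cube \<noteq> ({} :: (real ^ 'k) set)" by blast
  have fg: "g x = f x" if "x \<in> unit_cube" for x
    using that by (simp add: g_def closest_point_self)
  have lipg: "L-lipschitz_on UNIV g"
  proof (rule lipschitz_onI)
    fix x y :: "real ^ 'k"
    have "dist (g x) (g y) \<le> L * dist (closest_point unit_cube x) (closest_point unit_cube y)"
      unfolding g_def
      by (intro lipschitz_onD[OF assms(3)] closest_point_in_set closed_cbox ne)
    also have "\<dots> \<le> L * dist x y"
      using lipschitz_on_nonneg[OF assms(3)]
      by (intro mult_left_mono closest_point_lipschitz convex_box closed_cbox ne)
    finally show "dist (g x) (g y) \<le> L * dist x y" .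
  qed (rule lipschitz_on_nonneg[OF assms(3)])
  have fgi: "g x = f x" if "x \<in> interior unit_cube" for x
    using that interior_subset fg by blast
  have md_iff: "has_metric_derivative g \<sigma> x \<longleftrightarrow> has_metric_derivative f \<sigma> x" if "x \<in> interior unit_cube" for x \<sigma>
    by (rule has_metric_derivative_cong_open[OF open_interior that fgi])
  have md_eq: "md f x = \<sigma>" if "has_metric_derivative f \<sigma> x" for x \<sigma>
    unfolding md_def using that has_metric_derivative_unique by (intro the_equality) blast+
  have bc: ?c if ?b
    using that AE_upper_density_zero_of_rank[OF lipg assms(1)]
  proof eventually_elim
    case (elim x)
    show ?case
    proof
      assume x: "x \<in> E \<inter> interior unit_cube"
      then obtain \<sigma> where \<sigma>: "has_metric_derivative f \<sigma> x"
        using elim(1) by (auto simp: metrically_differentiable_def)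
      then have "seminorm_rank \<sigma> \<le> n - 1" "has_metric_derivative g \<sigma> x"
        using elim(1) x md_eq[OF \<sigma>] md_iff by auto
      then have "upper_density n g x = 0" using elim(2) by blast
      then show "upper_density n f x = 0"
        using upper_density_cong_open[OF open_interior, of x unit_cube g f n] x fgi by simp
    qed
  qed
  have cd: ?d if ?c
    using that
  proof eventually_elim
    case (elim x)
    have "lower_density n f x \<le> upper_density n f x"
      unfolding lower_density_def upper_density_def by (rule Liminf_le_Limsup) simp
    then show ?case using elim by auto
  qed
  have de: ?e if ?d
    using dyadic_mapping_content_zero_of_lower_density[OF assms(2,3,4) that] .
  have ef: ?f if ?e
  proof -
    have "mapping_content n m f E \<le> dyadic_mapping_content n m f E"
      unfolding mapping_content_def dyadic_mapping_content_def by (rule INF_superset_mono) auto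
    then show ?thesis using that by simp
  qed
  have fb: ?b if ?f
  proof -
    have "AE x in lebesgue. x \<in> E \<longrightarrow> (\<forall>\<sigma>. has_metric_derivative g \<sigma> x \<longrightarrow> seminorm_rank \<sigma> \<le> n - 1)"
      by (rule AE_rank_less_of_mapping_content_zero[OF assms(2,1,3) lipg _ assms(4) that]) (rule fg)
    with AE_metrically_differentiable[OF lipg] show ?thesis
    proof eventually_elim
      case (elim x)
      show ?case
      proof
        assume x: "x \<in> E \<inter> interior unit_cube"
        obtain \<sigma> where \<sigma>: "has_metric_derivative g \<sigma> x"
          using elim(1) by (auto simp: metrically_differentiable_def)
        then have "seminorm_rank \<sigma> \<le> n - 1" "has_metric_derivative f \<sigma> x"
          using elim(2) x md_iff by auto
        then show "metrically_differentiable f x \<and> seminorm_rank (md f x) \<le> n - 1"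
          using md_eq by (auto simp: metrically_differentiable_def)
      qed
    qed
  qed
  show ?thesis using bc cd de ef fb by blast
qed

end
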